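(* Fix $\beta>0$ and consider oriented Poisson percolation on $\mathcal L$ with parameter $\beta$ at time $t>0$. For any $\eta>0$, as $t\to\infty$, (i) $P\bigl(\mathbb C_0(t)\subset \mathbb R\times[0,(1+\eta)N]\bigr)\to 1$, and (ii) $P\bigl(-(1+\eta)\Gamma_t(k)\le \ell_t(k) \text{ and } r_t(k)\le (1+\eta)\Gamma_t(k)\text{ for all integers } 0\le k\le (1+\eta)N\bigr)\to 1$.
   Context: Lattice: $\mathcal L=\{(m,n)\in\mathbb Z^2: m+n \text{ is even}\}$ with oriented edges $(m,n)\to(m+1,n+1)$ and $(m,n)\to(m-1,n+1)$. Poisson percolation: fix $\beta>0$. At time $t$, edges are open independently, and an edge with midpoint $(x,y)$, $y>0$, is open with probability $\rho(y,t)=1-\exp(-ty^{-\beta})$. Write $(x,m)\to(y,n)$ if there is an oriented path of open edges from $(x,m)$ to $(y,n)$ (every site is connected to itself). Let $\mathbb C_0(t)=\{(x,n):(0,0)\to(x,n)\}$, $r_t(k)=\max\{x:(x,k)\in\mathbb C_0(t)\}$ and $\ell_t(k)=\min\{x:(x,k)\in\mathbb C_0(t)\}$, with $\max\emptyset=-\infty$ and $\min\emptyset=+\infty$. Homogeneous percolation: in homogeneous oriented bond percolation on $\mathcal L$ with parameter $p$, each edge is open independently with probability $p$; $P_p$ denotes its law. Let $\mathcal C_0$ be the set of sites reachable from the origin by oriented open paths and $p_c=\inf\{p:P_p(|\mathcal C_0|=\infty)>0\}$. Let $r_k=\sup\{x:\exists\, y\le 0\text{ with }(y,0)\to(x,k)\}$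 be the rightmost site at height $k$ reachable from $(-\infty,0]\times\{0\}$. For $p\ge p_c$, the right-edge speed $\alpha(p)$ is the almost sure limit of $r_k/k$ as $k\to\infty$ (it exists; $\alpha(1)=1$, $\alpha(p_c)=0$). Scaling and shape: let $n(p,t)=\max\{y>0:\rho(y,t)\ge p\}$ ($y$ real) and $N=n(p_c,t)$. Let $f(y)=\rho(yt^{1/\beta},t)=1-\exp(-y^{-\beta})$ (with $f(0)=1$), and let $y_c$ be defined by $f(y_c)=p_c$. Define $g$ by $g(0)=0$, $g'(y)=\alpha(f(y))$ for $0\le y\le y_c$, and $g(y)=g(y_c)$ for $y>y_c$. Set $\Gamma_t(y)=t^{1/\beta}g(y/t^{1/\beta})$. *)

theory Defs
  imports "HOL-Probability.Probability"
begin

type_synonym site = "int \<times> int"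
type_synonym edge = "site \<times> site"

definition lattice_sites :: "site set" where
  "lattice_sites = {(m, n). even (m + n)}"

definition edges :: "edge set" where
  "edges = {((m, n), (m', n')). (m, n) \<in> lattice_sites \<and> (m' = m + 1 \<or> m' = m - 1) \<and> n' = n + 1}"

definition mid_height :: "edge \<Rightarrow> real" where
  "mid_height e = (real_of_int (snd (fst e)) + real_of_int (snd (snd e))) / 2"

text \<open>A configuration assigns to each edge whether it is open.\<close>

definition percolation :: "(edge \<Rightarrow> real) \<Rightarrow> (edge \<Rightarrow> bool) measure" where
  "percolation q = Pi\<^sub>M edges (\<lambda>e. measure_pmf (bernoulli_pmf (q e)))"

definition path_to :: "(edge \<Rightarrow> bool) \<Rightarrow> site \<Rightarrow> site \<Rightarrow> bool" where
  "path_to \<omega> a b \<longleftrightarrow> (a, b) \<in> {e \<in> edges. \<omega> e}\<^sup>*"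

definition cluster :: "(edge \<Rightarrow> bool) \<Rightarrow> site set" where
  "cluster \<omega> = {b. path_to \<omega> (0, 0) b}"

text \<open>The sites of the cluster at a given height form a finite set, so the supremum and infimum
  below are a maximum and a minimum; in \<^typ>\<open>ereal\<close> they are \<open>-\<infinity>\<close> and \<open>\<infinity>\<close> for the empty set.\<close>

definition cluster_right :: "(edge \<Rightarrow> bool) \<Rightarrow> int \<Rightarrow> ereal" where
  "cluster_right \<omega> k = (SUP x \<in> {x. (x, k) \<in> cluster \<omega>}. ereal (real_of_int x))"

definition cluster_left :: "(edge \<Rightarrow> bool) \<Rightarrow> int \<Rightarrow> ereal" where
  "cluster_left \<omega> k = (INF x \<in> {x. (x, k) \<in> cluster \<omega>}. ereal (real_of_int x))"

definition homogeneous_percolation :: "real \<Rightarrow> (edge \<Rightarrow> bool) measure" where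
  "homogeneous_percolation p = percolation (\<lambda>_. p)"

definition p_c :: real where
  "p_c = Inf {p \<in> {0..1}. \<P>(\<omega> in homogeneous_percolation p. infinite (cluster \<omega>)) > 0}"

definition right_edge :: "(edge \<Rightarrow> bool) \<Rightarrow> int \<Rightarrow> ereal" where
  "right_edge \<omega> k =
     (SUP x \<in> {x. \<exists>y\<le>0. (y, 0) \<in> lattice_sites \<and> path_to \<omega> (y, 0) (x, k)}. ereal (real_of_int x))"

definition speed :: "real \<Rightarrow> real" where
  "speed p = (THE a. AE \<omega> in homogeneous_percolation p.
     (\<lambda>k. right_edge \<omega> (int k) / ereal (real k)) \<longlonglongrightarrow> ereal a)"

definition rho :: "real \<Rightarrow> real \<Rightarrow> real \<Rightarrow> real" where
  "rho \<beta> y t = 1 - exp (- (t * y powr (- \<beta>)))"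

text \<open>Edges with midpoint below the horizontal axis cannot be reached from the origin and hence
  have no influence on \<^const>\<open>cluster\<close>; they are taken to be closed.\<close>

definition poisson_percolation :: "real \<Rightarrow> real \<Rightarrow> (edge \<Rightarrow> bool) measure" where
  "poisson_percolation \<beta> t =
     percolation (\<lambda>e. if mid_height e > 0 then rho \<beta> (mid_height e) t else 0)"

definition density_height :: "real \<Rightarrow> real \<Rightarrow> real \<Rightarrow> real" where
  "density_height \<beta> p t = (GREATEST y. 0 < y \<and> rho \<beta> y t \<ge> p)"

text \<open>The case distinction is needed because \<^term>\<open>0 powr (- \<beta>) = (0::real)\<close>.\<close>

definition scaled_density :: "real \<Rightarrow> real \<Rightarrow> real" where
  "scaled_density \<beta> y = (if y = 0 then 1 else 1 - exp (- (y powr (- \<beta>))))"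

lemma scaled_density_eq_rho:
  assumes "\<beta> > 0" "t > 0" "y > 0"
  shows "scaled_density \<beta> y = rho \<beta> (y * t powr (1 / \<beta>)) t"
  using assms
  by (simp add: scaled_density_def rho_def powr_mult powr_powr powr_minus field_simps)

definition y_c :: "real \<Rightarrow> real" where
  "y_c \<beta> = (THE y. y \<ge> 0 \<and> scaled_density \<beta> y = p_c)"

text \<open>The function \<open>g\<close> with \<open>g 0 = 0\<close> and derivative \<open>speed \<circ> scaled_density \<beta>\<close> on
  \<open>[0, y_c]\<close>, constant beyond \<open>y_c\<close>. The lemma below says that these properties
  determine it.\<close>

definition shape :: "real \<Rightarrow> real \<Rightarrow> real" where
  "shape \<beta> y = integral {0..min y (y_c \<beta>)} (\<lambda>s. speed (scaled_density \<beta> s))"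

lemma shape_unique:
  assumes "y_c \<beta> \<ge> 0" "g 0 = 0"
    and "\<And>y. y \<in> {0..y_c \<beta>} \<Longrightarrow>
      (g has_real_derivative speed (scaled_density \<beta> y)) (at y within {0..y_c \<beta>})"
    and "\<And>y. y > y_c \<beta> \<Longrightarrow> g y = g (y_c \<beta>)"
    and "y \<ge> 0"
  shows "g y = shape \<beta> y"
proof -
  let ?m = "min y (y_c \<beta>)"
  have "((\<lambda>s. speed (scaled_density \<beta> s)) has_integral (g ?m - g 0)) {0..?m}"
  proof (rule fundamental_theorem_of_calculus)
    show "0 \<le> ?m" using assms by simp
    fix x assume "x \<in> {0..?m}"
    then have "(g has_real_derivative speed (scaled_density \<beta> x)) (at x within {0..?m})"
      using assms(3)[of x] by (auto intro: DERIV_subset)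
    then show "(g has_vector_derivative speed (scaled_density \<beta> x)) (at x within {0..?m})"
      by (simp add: has_real_derivative_iff_has_vector_derivative)
  qed
  then have "shape \<beta> y = g ?m"
    using assms(2) by (simp add: shape_def integral_unique)
  also have "g ?m = g y" using assms(4)[of y] by (auto simp: min_def)
  finally show ?thesis by simp
qed

definition Gamma_shape :: "real \<Rightarrow> real \<Rightarrow> real \<Rightarrow> real" where
  "Gamma_shape \<beta> t y = t powr (1 / \<beta>) * shape \<beta> (y / t powr (1 / \<beta>))"

end

(* Everything rests on the right edge of the homogeneous process started from a half-line, truncated
   so that after n steps it is an integer in [-n, n].  Restarting from the half-line to the left of
   the current edge makes it subadditive with independent increments; Kesten's variance estimate along
   dyadic times then yields the almost sure speed.  A speed that is positive means percolation
   (planarity), percolation means a speed that is not negative (right and left edge would cross), and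
   the speed is strictly increasing where it is not negative; hence it is negative below p_c, and above
   the height N the cluster dies out because boundedly many intervals cover it, each of which shrinks.
   Below N the right edge is controlled in finitely many blocks by homogeneous processes of the density
   at the bottom of the block, which gives Riemann sums of g.  Near height 0 one needs that the speed
   tends to 1 as p tends to 1; this is reduced to p_c < 1 by embedding a sparse copy of the lattice in
   which the drift is built into the edges.  Finally p_c < 1 follows from a supermartingale: the sum
   over all partitions of the occupied set into blocks of products of weights of the block lengths. *)

theory Submission
  imports Defs
begin

section \<open>Oriented paths level by level\<close>

text \<open>Truncation keeps every displacement in a finite range: expectations become finite sums,
  and independence of events on disjoint sets of edges is enough. It also gives a finite drift below
  \<open>p_c\<close>, where the true edge may retreat arbitrarily far. The admissible error is a
  factor 1 + eta and g(0) = 0, so there is no slack near height 0. The only bound at hand there is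
  one unit per step, and it suffices because g has slope 1 at 0. Beyond a fixed scaled height d the
  slack eta * g(d) is a positive constant, which absorbs the errors from blocks, rounding and
  fluctuations. Strict negativity of the drift below \<open>p_c\<close> is essential for extinction:
  intervals whose length is proportional to the number of steps have to collapse. The partition sum
  is 1 on the empty set and 1/96 on a single site, and for p at least 49/50 its mean does not
  increase in a step. So the extinction probability from one site is at most 1/96.\<close>

definition lev :: "edge \<Rightarrow> int" where
  "lev e = snd (fst e)"

definition step :: "(edge \<Rightarrow> bool) \<Rightarrow> int \<Rightarrow> int set \<Rightarrow> int set" where
  "step \<omega> n S = {y. \<exists>x\<in>S. ((x, n), (y, n + 1)) \<in> edges \<and> \<omega> ((x, n), (y, n + 1))}"

primrec evo :: "(edge \<Rightarrow> bool) \<Rightarrow> int \<Rightarrow> int set \<Rightarrow> nat \<Rightarrow> int set" where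
  "evo \<omega> m S 0 = S"
| "evo \<omega> m S (Suc j) = step \<omega> (m + int j) (evo \<omega> m S j)"

definition half_line :: "int \<Rightarrow> int \<Rightarrow> int set" where
  "half_line m x = {y. y \<le> x \<and> even (y + m)}"

text \<open>The displacement of the right edge, truncated from below so that it is an integer in
  \<open>[-j, j]\<close> which depends on finitely many edges only.\<close>

definition disp :: "(edge \<Rightarrow> bool) \<Rightarrow> int \<Rightarrow> int \<Rightarrow> nat \<Rightarrow> int" where
  "disp \<omega> m x j = Max (insert (x - int j) {y \<in> evo \<omega> m (half_line m x) j. x - int j \<le> y}) - x"

lemma edges_iff: "((x, n), (y, k)) \<in> edges \<longleftrightarrow> even (x + n) \<and> (y = x + 1 \<or> y = x - 1) \<and> k = n + 1"
  by (auto simp: edges_def lattice_sites_def)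

lemma edgesE:
  assumes "e \<in> edges"
  obtains x n y where "e = ((x, n), (y, n + 1))" "even (x + n)" "y = x + 1 \<or> y = x - 1" "lev e = n"
  using assms by (auto simp: edges_def lattice_sites_def lev_def)

lemma step_mono: "S \<subseteq> T \<Longrightarrow> (\<And>e. e \<in> edges \<Longrightarrow> \<omega> e \<Longrightarrow> \<omega>' e) \<Longrightarrow> step \<omega> n S \<subseteq> step \<omega>' n T"
  unfolding step_def by blast

lemma evo_mono:
  assumes "S \<subseteq> T" "\<And>e. e \<in> edges \<Longrightarrow> \<omega> e \<Longrightarrow> \<omega>' e"
  shows "evo \<omega> m S j \<subseteq> evo \<omega>' m T j"
proof (induction j)
  case (Suc j)
  show ?case using step_mono[OF Suc assms(2)] by simp
qed (use assms in simp)

lemma evo_mono_set: "S \<subseteq> T \<Longrightarrow> evo \<omega> m S j \<subseteq> evo \<omega> m T j"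
  by (rule evo_mono)

lemma evo_empty [simp]: "evo \<omega> m {} j = {}"
  by (induction j) (auto simp: step_def)

lemma evo_Un: "evo \<omega> m (S \<union> T) j = evo \<omega> m S j \<union> evo \<omega> m T j"
  by (induction j) (auto simp: step_def)

lemma evo_singleton: "y \<in> evo \<omega> m S j \<longleftrightarrow> (\<exists>x\<in>S. y \<in> evo \<omega> m {x} j)"
proof (induction j arbitrary: y)
  case (Suc j)
  show ?case by (simp add: step_def) (use Suc in blast)
qed simp

lemma evo_add: "evo \<omega> m S (i + j) = evo \<omega> (m + int i) (evo \<omega> m S i) j"
  by (induction j) (simp_all add: ac_simps)

lemma evo_cong:
  assumes "\<And>e. e \<in> edges \<Longrightarrow> m \<le> lev e \<Longrightarrow> lev e < m + int j \<Longrightarrow> \<omega> e = \<omega>' e"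
  shows "evo \<omega> m S j = evo \<omega>' m S j"
  using assms
proof (induction j)
  case (Suc j)
  have "evo \<omega> m S j = evo \<omega>' m S j" using Suc by auto
  moreover have "\<omega> ((x, m + int j), (y, m + int j + 1)) = \<omega>' ((x, m + int j), (y, m + int j + 1))"
    if "((x, m + int j), (y, m + int j + 1)) \<in> edges" for x y
    using Suc.prems[OF that] by (simp add: lev_def)
  ultimately show ?case by (auto simp: step_def)
qed simp

lemma evo_bounds: "y \<in> evo \<omega> m {x} j \<Longrightarrow> x - int j \<le> y \<and> y \<le> x + int j"
proof (induction j arbitrary: y)
  case (Suc j)
  then obtain z where "z \<in> evo \<omega> m {x} j" "y = z + 1 \<or> y = z - 1"
    by (auto simp: step_def edges_iff)
  with Suc.IH[of z] show ?case by auto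
qed simp

lemma evo_parity:
  assumes "y \<in> evo \<omega> m S j" "\<And>x. x \<in> S \<Longrightarrow> even (x + m)"
  shows "even (y + m + int j)"
  using assms(1)
proof (induction j arbitrary: y)
  case (Suc j)
  then show ?case by (auto simp: step_def edges_iff)
qed (use assms(2) in simp)

lemma finite_evo: "finite S \<Longrightarrow> finite (evo \<omega> m S j)"
proof (induction j)
  case (Suc j)
  have "step \<omega> (m + int j) (evo \<omega> m S j) \<subseteq> (\<lambda>x. x + 1) ` evo \<omega> m S j \<union> (\<lambda>x. x - 1) ` evo \<omega> m S j"
    by (auto simp: step_def edges_iff)
  with Suc show ?case by (auto intro: finite_subset)
qed simp

lemma evo_half_line_le: "y \<in> evo \<omega> m (half_line m x) j \<Longrightarrow> y \<le> x + int j"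
  using evo_singleton[of y \<omega> m "half_line m x" j] evo_bounds by (fastforce simp: half_line_def)

lemma disp_finite: "finite (insert (x - int j) {y \<in> evo \<omega> m (half_line m x) j. x - int j \<le> y})"
proof -
  have "{y \<in> evo \<omega> m (half_line m x) j. x - int j \<le> y} \<subseteq> {x - int j..x + int j}"
    using evo_half_line_le by fastforce
  then show ?thesis by (auto intro: finite_subset)
qed

text \<open>Characterises the maximum by its upper bounds, the form in which \<open>disp\<close> is
  estimated later. The condition \<open>- int j \<le> c\<close> stems from the artificial element
  \<open>x - int j\<close>.\<close>

lemma disp_le_iff:
  "disp \<omega> m x j \<le> c \<longleftrightarrow> - int j \<le> c \<and> (\<forall>y\<in>evo \<omega> m (half_line m x) j. y \<le> x + c)"
proof -
  have "disp \<omega> m x j \<le> c \<longleftrightarrow> Max (insert (x - int j) {y \<in> evo \<omega> m (half_line m x) j. x - int j \<le> y}) \<le> x + c"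
    by (auto simp: disp_def)
  also have "\<dots> \<longleftrightarrow> - int j \<le> c \<and> (\<forall>y\<in>evo \<omega> m (half_line m x) j. y \<le> x + c)"
  proof (subst Max_le_iff[OF disp_finite insert_not_empty], safe)
    fix y assume "\<forall>a\<in>insert (x - int j) {y \<in> evo \<omega> m (half_line m x) j. x - int j \<le> y}. a \<le> x + c"
      and "y \<in> evo \<omega> m (half_line m x) j"
    then show "y \<le> x + c" by (cases "x - int j \<le> y") auto
  qed auto
  finally show ?thesis .
qed

lemma disp_ge: "- int j \<le> disp \<omega> m x j"
  using disp_le_iff[of \<omega> m x j "disp \<omega> m x j"] by simp

lemma disp_le: "disp \<omega> m x j \<le> int j"
  using evo_half_line_le by (auto simp: disp_le_iff)

lemma evo_le_disp: "y \<in> evo \<omega> m (half_line m x) j \<Longrightarrow> y \<le> x + disp \<omega> m x j"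
  using disp_le_iff[of \<omega> m x j "disp \<omega> m x j"] by simp

lemma disp_attained:
  assumes "- int j < disp \<omega> m x j"
  shows "x + disp \<omega> m x j \<in> evo \<omega> m (half_line m x) j"
  using Max_in[OF disp_finite[of x j \<omega> m]] assms by (auto simp: disp_def)

lemma disp_0 [simp]: "disp \<omega> m x 0 = 0"
  using disp_ge[of 0 \<omega> m x] disp_le[of \<omega> m x 0] by simp

text \<open>The truncation value \<open>x - int j\<close> has the parity of the sites on level
  \<open>m + int j\<close>, so the truncated edge is always a lattice position at which the process
  can be restarted.\<close>

lemma disp_parity:
  assumes "even (x + m)"
  shows "even (disp \<omega> m x j + int j)"
proof (cases "- int j < disp \<omega> m x j")
  case True
  have "even (x + disp \<omega> m x j + m + int j)"
    by (rule evo_parity[OF disp_attained[OF True]]) (auto simp: half_line_def)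
  with assms show ?thesis by presburger
next
  case False
  then have "disp \<omega> m x j = - int j" using disp_ge[of j \<omega> m x] by simp
  then show ?thesis by simp
qed

lemma disp_mono:
  assumes "\<And>e. e \<in> edges \<Longrightarrow> \<omega> e \<Longrightarrow> \<omega>' e"
  shows "disp \<omega> m x j \<le> disp \<omega>' m x j"
  unfolding disp_le_iff
proof (intro conjI ballI disp_ge)
  fix y assume y: "y \<in> evo \<omega> m (half_line m x) j"
  have "evo \<omega> m (half_line m x) j \<subseteq> evo \<omega>' m (half_line m x) j"
    by (rule evo_mono[OF order_refl]) (rule assms)
  with y have "y \<in> evo \<omega>' m (half_line m x) j" by (rule rev_subsetD)
  then show "y \<le> x + disp \<omega>' m x j" by (rule evo_le_disp)
qed

lemma disp_cong:
  assumes "\<And>e. e \<in> edges \<Longrightarrow> m \<le> lev e \<Longrightarrow> lev e < m + int j \<Longrightarrow> \<omega> e = \<omega>' e"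
  shows "disp \<omega> m x j = disp \<omega>' m x j"
proof -
  have "evo \<omega> m (half_line m x) j = evo \<omega>' m (half_line m x) j"
    by (rule evo_cong) (use assms in auto)
  then show ?thesis by (simp add: disp_def)
qed

lemma evo_half_line_subset:
  "evo \<omega> m (half_line m x) j \<subseteq> half_line (m + int j) (x + disp \<omega> m x j)"
proof
  fix y assume y: "y \<in> evo \<omega> m (half_line m x) j"
  have "even (y + m + int j)" by (rule evo_parity[OF y]) (auto simp: half_line_def)
  with evo_le_disp[OF y] show "y \<in> half_line (m + int j) (x + disp \<omega> m x j)"
    unfolding half_line_def by (simp add: add.assoc)
qed

text \<open>After \<open>i\<close> steps all occupied sites lie in the half-line ending at the
  truncated edge, and filling this half-line can only move the later edge to the right. Given the
  restart position, the second term looks only at levels from \<open>m + int i\<close> on, which is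
  the source of independent increments.\<close>

lemma disp_subadd:
  "disp \<omega> m x (i + j) \<le> disp \<omega> m x i + disp \<omega> (m + int i) (x + disp \<omega> m x i) j"
  unfolding disp_le_iff
proof (intro conjI ballI)
  show "- int (i + j) \<le> disp \<omega> m x i + disp \<omega> (m + int i) (x + disp \<omega> m x i) j"
    using disp_ge[of i \<omega> m x] disp_ge[of j \<omega> "m + int i" "x + disp \<omega> m x i"] by simp
  fix y assume "y \<in> evo \<omega> m (half_line m x) (i + j)"
  then have "y \<in> evo \<omega> (m + int i) (half_line (m + int i) (x + disp \<omega> m x i)) j"
    using evo_mono_set[OF evo_half_line_subset] unfolding evo_add by (rule subsetD[rotated])
  from evo_le_disp[OF this] show "y \<le> x + (disp \<omega> m x i + disp \<omega> (m + int i) (x + disp \<omega> m x i) j)"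
    by simp
qed

section \<open>Shifts and reflections of the lattice\<close>

definition shift_edge :: "int \<Rightarrow> int \<Rightarrow> edge \<Rightarrow> edge" where
  "shift_edge a b e = ((fst (fst e) + a, snd (fst e) + b), (fst (snd e) + a, snd (snd e) + b))"

definition reflect_edge :: "edge \<Rightarrow> edge" where
  "reflect_edge e = ((- fst (fst e), snd (fst e)), (- fst (snd e), snd (snd e)))"

lemma shift_edge_in_edges: "even (a + b) \<Longrightarrow> shift_edge a b e \<in> edges \<longleftrightarrow> e \<in> edges"
proof -
  assume *: "even (a + b)"
  obtain x n y k where e: "e = ((x, n), (y, k))" by (metis surj_pair)
  have "even (x + a + (n + b)) = even (x + n)" using * by presburger
  then show ?thesis unfolding e shift_edge_def fst_conv snd_conv edges_iff by simp
qed

lemma inj_shift_edge: "inj_on (shift_edge a b) A"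
  by (auto simp: inj_on_def shift_edge_def prod_eq_iff)

lemma lev_shift_edge [simp]: "lev (shift_edge a b e) = lev e + b"
  by (simp add: lev_def shift_edge_def)

lemma reflect_edge_in_edges: "reflect_edge e \<in> edges \<longleftrightarrow> e \<in> edges"
  by (cases e) (auto simp: reflect_edge_def edges_iff)

lemma inj_reflect_edge: "inj_on reflect_edge A"
  by (auto simp: inj_on_def reflect_edge_def prod_eq_iff)

lemma lev_reflect_edge [simp]: "lev (reflect_edge e) = lev e"
  by (simp add: lev_def reflect_edge_def)

lemma evo_shift:
  assumes ab: "even (a + b)" and \<omega>: "\<And>e. e \<in> edges \<Longrightarrow> \<omega>' e = \<omega> (shift_edge a b e)"
  shows "evo \<omega> (m + b) ((\<lambda>x. x + a) ` S) j = (\<lambda>x. x + a) ` evo \<omega>' m S j"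
proof (induction j)
  case (Suc j)
  have 1: "((x + a, n + b), (y + a, n + b + 1)) \<in> edges \<and> \<omega> ((x + a, n + b), (y + a, n + b + 1)) \<longleftrightarrow>
      ((x, n), (y, n + 1)) \<in> edges \<and> \<omega>' ((x, n), (y, n + 1))" for x y n
    using shift_edge_in_edges[OF ab, of "((x, n), (y, n + 1))"] \<omega>[of "((x, n), (y, n + 1))"]
    by (auto simp: shift_edge_def ac_simps)
  have 2: "step \<omega> (n + b) ((\<lambda>x. x + a) ` T) = (\<lambda>x. x + a) ` step \<omega>' n T" for n T
  proof (rule set_eqI)
    fix y
    have "y \<in> step \<omega> (n + b) ((\<lambda>x. x + a) ` T) \<longleftrightarrow>
      (\<exists>x\<in>T. ((x + a, n + b), ((y - a) + a, n + b + 1)) \<in> edges \<and> \<omega> ((x + a, n + b), ((y - a) + a, n + b + 1)))"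
      by (simp add: step_def)
    also have "\<dots> \<longleftrightarrow> y - a \<in> step \<omega>' n T" unfolding 1 by (simp add: step_def)
    also have "\<dots> \<longleftrightarrow> y \<in> (\<lambda>x. x + a) ` step \<omega>' n T" by force
    finally show "y \<in> step \<omega> (n + b) ((\<lambda>x. x + a) ` T) \<longleftrightarrow> y \<in> (\<lambda>x. x + a) ` step \<omega>' n T" .
  qed
  show ?case
    using 2[of "m + int j" "evo \<omega>' m S j"] Suc by (simp add: ac_simps)
qed simp

lemma disp_shift:
  assumes ab: "even (a + b)" and \<omega>: "\<And>e. e \<in> edges \<Longrightarrow> \<omega>' e = \<omega> (shift_edge a b e)"
  shows "disp \<omega> (m + b) (x + a) j = disp \<omega>' m x j"
proof -
  have "half_line (m + b) (x + a) = (\<lambda>x. x + a) ` half_line m x"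
  proof (rule set_eqI)
    fix y
    have "even (y + (m + b)) \<longleftrightarrow> even (y - a + m)" using ab by presburger
    then show "y \<in> half_line (m + b) (x + a) \<longleftrightarrow> y \<in> (\<lambda>x. x + a) ` half_line m x"
      unfolding half_line_def image_iff by (auto intro!: exI[of _ "y - a"])
  qed
  then have E: "evo \<omega> (m + b) (half_line (m + b) (x + a)) j = (\<lambda>x. x + a) ` evo \<omega>' m (half_line m x) j"
    using evo_shift[OF ab, of \<omega>' \<omega>] \<omega> by simp
  have "disp \<omega> (m + b) (x + a) j \<le> c \<longleftrightarrow> disp \<omega>' m x j \<le> c" for c
    unfolding disp_le_iff E by auto
  then show ?thesis by (meson order_antisym order_refl)
qed

lemma evo_reflect: "evo (\<omega> \<circ> reflect_edge) m (uminus ` S) j = uminus ` evo \<omega> m S j"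
proof (induction j)
  case (Suc j)
  have 1: "((- x, n), (- y, n + 1)) \<in> edges \<and> (\<omega> \<circ> reflect_edge) ((- x, n), (- y, n + 1)) \<longleftrightarrow>
      ((x, n), (y, n + 1)) \<in> edges \<and> \<omega> ((x, n), (y, n + 1))" for x y n
    by (auto simp: reflect_edge_def edges_iff)
  have 2: "step (\<omega> \<circ> reflect_edge) n (uminus ` T) = uminus ` step \<omega> n T" for n T
  proof (rule set_eqI)
    fix y
    have "y \<in> step (\<omega> \<circ> reflect_edge) n (uminus ` T) \<longleftrightarrow>
      (\<exists>x\<in>T. ((- x, n), (- (- y), n + 1)) \<in> edges \<and> (\<omega> \<circ> reflect_edge) ((- x, n), (- (- y), n + 1)))"
      by (simp add: step_def)
    also have "\<dots> \<longleftrightarrow> - y \<in> step \<omega> n T" unfolding 1 by (simp add: step_def)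
    also have "\<dots> \<longleftrightarrow> y \<in> uminus ` step \<omega> n T" by force
    finally show "y \<in> step (\<omega> \<circ> reflect_edge) n (uminus ` T) \<longleftrightarrow> y \<in> uminus ` step \<omega> n T" .
  qed
  show ?case using 2[of "m + int j" "evo \<omega> m S j"] Suc by (simp only: evo.simps)
qed simp

text \<open>The left edge is the right edge of the mirror image. Enlarging the mirror image of
  \<open>S\<close> to a half-line turns an upper bound for the reflected right edge into a lower
  bound for all occupied sites.\<close>

lemma evo_ge_reflect_disp:
  assumes "y \<in> evo \<omega> m S j" "\<And>z. z \<in> S \<Longrightarrow> x \<le> z \<and> even (z + m)"
  shows "x - disp (\<omega> \<circ> reflect_edge) m (- x) j \<le> y"
proof -
  have "uminus ` S \<subseteq> half_line m (- x)"
    using assms(2) by (fastforce simp: half_line_def)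
  then have "evo (\<omega> \<circ> reflect_edge) m (uminus ` S) j \<subseteq> evo (\<omega> \<circ> reflect_edge) m (half_line m (- x)) j"
    by (rule evo_mono_set)
  moreover have "- y \<in> evo (\<omega> \<circ> reflect_edge) m (uminus ` S) j"
    using assms(1) by (simp add: evo_reflect)
  ultimately have "- y \<le> - x + disp (\<omega> \<circ> reflect_edge) m (- x) j"
    using evo_le_disp by blast
  then show ?thesis by simp
qed

section \<open>Paths, clusters and survival\<close>

lemma path_to_iff: "path_to \<omega> (x, m) (y, n) \<longleftrightarrow> m \<le> n \<and> y \<in> evo \<omega> m {x} (nat (n - m))"
proof
  assume "path_to \<omega> (x, m) (y, n)"
  then have "((x, m), (y, n)) \<in> {e \<in> edges. \<omega> e}\<^sup>*" by (simp add: path_to_def)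
  then show "m \<le> n \<and> y \<in> evo \<omega> m {x} (nat (n - m))"
  proof (induction rule: rtrancl_induct2)
    case (step a b c d)
    then have d: "d = b + 1" and e: "((a, b), (c, b + 1)) \<in> edges" "\<omega> ((a, b), (c, b + 1))"
      by (auto simp: edges_iff)
    have "nat (d - m) = Suc (nat (b - m))" "m + int (nat (b - m)) = b" using step.IH d by auto
    then show ?case using step.IH e d by (auto simp: step_def)
  qed simp
next
  have *: "y \<in> evo \<omega> m {x} j \<Longrightarrow> ((x, m), (y, m + int j)) \<in> {e \<in> edges. \<omega> e}\<^sup>*" for j
  proof (induction j arbitrary: y)
    case (Suc j)
    then obtain z where "z \<in> evo \<omega> m {x} j" "((z, m + int j), (y, m + int j + 1)) \<in> {e \<in> edges. \<omega> e}"
      by (auto simp: step_def)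
    with Suc.IH[of z] show ?case
      by (auto simp: ac_simps intro: rtrancl_into_rtrancl)
  qed simp
  assume "m \<le> n \<and> y \<in> evo \<omega> m {x} (nat (n - m))"
  with *[of "nat (n - m)"] show "path_to \<omega> (x, m) (y, n)" by (simp add: path_to_def)
qed

lemma cluster_iff: "(x, n) \<in> cluster \<omega> \<longleftrightarrow> 0 \<le> n \<and> x \<in> evo \<omega> 0 {0} (nat n)"
  by (simp add: cluster_def path_to_iff)

lemma evo_empty_mono: "evo \<omega> m S i = {} \<Longrightarrow> i \<le> j \<Longrightarrow> evo \<omega> m S j = {}"
  using evo_add[of \<omega> m S i "j - i"] by simp

text \<open>Each level of the cluster is finite, so an infinite cluster reaches every height;
  conversely one site per height already gives infinitely many.\<close>

lemma infinite_cluster_iff: "infinite (cluster \<omega>) \<longleftrightarrow> (\<forall>n. evo \<omega> 0 {0} n \<noteq> {})"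
proof
  assume inf: "infinite (cluster \<omega>)"
  show "\<forall>n. evo \<omega> 0 {0} n \<noteq> {}"
  proof (rule ccontr)
    assume "\<not> (\<forall>n. evo \<omega> 0 {0} n \<noteq> {})"
    then obtain n where n: "evo \<omega> 0 {0} n = {}" by auto
    have "cluster \<omega> \<subseteq> (\<Union>k\<in>{..<n}. evo \<omega> 0 {0} k \<times> {int k})"
    proof clarify
      fix x k assume "(x, k) \<in> cluster \<omega>"
      then have *: "0 \<le> k" "x \<in> evo \<omega> 0 {0} (nat k)" by (auto simp: cluster_iff)
      then have "nat k < n" using evo_empty_mono[OF n] by (metis empty_iff not_le)
      with * show "(x, k) \<in> (\<Union>k\<in>{..<n}. evo \<omega> 0 {0} k \<times> {int k})" by force
    qed
    moreover have "finite (\<Union>k\<in>{..<n}. evo \<omega> 0 {0} k \<times> {int k})"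
      by (auto intro: finite_evo)
    ultimately show False using inf finite_subset by blast
  qed
next
  assume *: "\<forall>n. evo \<omega> 0 {0} n \<noteq> {}"
  have "range int \<subseteq> snd ` cluster \<omega>"
  proof clarify
    fix n
    obtain x where "x \<in> evo \<omega> 0 {0} n" using * by blast
    then have "(x, int n) \<in> cluster \<omega>" by (simp add: cluster_iff)
    then show "int n \<in> snd ` cluster \<omega>" by force
  qed
  then show "infinite (cluster \<omega>)"
    using finite_subset[OF _ finite_imageI] range_inj_infinite[OF inj_of_nat] by blast
qed

section \<open>Independent labels\<close>

definition unif :: "real measure" where
  "unif = uniform_measure lborel {0..1}"

text \<open>All percolation measures are realised on one space of independent uniform labels, an edge
  being open when its label is below its density.\<close>

definition labels :: "(edge \<Rightarrow> real) measure" where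
  "labels = Pi\<^sub>M edges (\<lambda>_. unif)"

definition configs :: "(edge \<Rightarrow> bool) measure" where
  "configs = Pi\<^sub>M edges (\<lambda>_. count_space UNIV)"

text \<open>The density depends on the level only, which covers the homogeneous model, the Poisson
  model and the mixtures of two densities below. The common labels make the configuration monotone
  in \<open>Q\<close>; restriction to \<open>edges\<close> puts it into the space of
  \<open>configs\<close>.\<close>

definition conf :: "(int \<Rightarrow> real) \<Rightarrow> (edge \<Rightarrow> real) \<Rightarrow> edge \<Rightarrow> bool" where
  "conf Q u = (\<lambda>e\<in>edges. u e \<le> Q (lev e))"

lemma prob_space_unif: "prob_space unif"
  unfolding unif_def by (rule prob_space_uniform_measure) auto

lemma sets_unif [measurable_cong, simp]: "sets unif = sets borel"
  by (simp add: unif_def)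

lemma space_unif [simp]: "space unif = UNIV"
  by (simp add: unif_def)

interpretation labels: prob_space labels
  unfolding labels_def by (intro prob_space_PiM prob_space_unif)

lemma measurable_label: "e \<in> edges \<Longrightarrow> (\<lambda>u. u e) \<in> borel_measurable labels"
proof -
  assume "e \<in> edges"
  then have "(\<lambda>u. u e) \<in> measurable labels unif"
    unfolding labels_def by (rule measurable_component_singleton)
  then show ?thesis by (simp cong: measurable_cong_sets)
qed

lemma measurable_config: "e \<in> edges \<Longrightarrow> Measurable.pred configs (\<lambda>\<omega>. \<omega> e)"
  unfolding configs_def by (rule measurable_component_singleton)

lemma measurable_conf_gen [measurable]:
  "(\<lambda>u. \<lambda>e\<in>edges. u e \<le> q e) \<in> measurable labels configs"
  unfolding configs_def
proof (rule measurable_restrict)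
  fix e assume "e \<in> edges"
  note [measurable] = measurable_label[OF this]
  show "Measurable.pred labels (\<lambda>u. u e \<le> q e)" by measurable
qed

lemma measurable_conf [measurable]: "conf Q \<in> measurable labels configs"
  unfolding conf_def[abs_def] by measurable

lemma measurable_evo [measurable]: "Measurable.pred configs (\<lambda>\<omega>. y \<in> evo \<omega> m S j)"
proof (induction j arbitrary: y)
  case (Suc j)
  have *: "y \<in> evo \<omega> m S (Suc j) \<longleftrightarrow>
     (\<exists>x. x \<in> evo \<omega> m S j \<and> ((x, m + int j), (y, m + int j + 1)) \<in> edges
        \<and> \<omega> ((x, m + int j), (y, m + int j + 1)))" for \<omega>
    by (auto simp: step_def)
  have "Measurable.pred configs (\<lambda>\<omega>. ((x, m + int j), (y, m + int j + 1)) \<in> edges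
        \<and> \<omega> ((x, m + int j), (y, m + int j + 1)))" for x
    by (cases "((x, m + int j), (y, m + int j + 1)) \<in> edges") (simp_all add: measurable_config)
  then show ?case unfolding *
    by (intro pred_intros_countable pred_intros_logic(3)[OF Suc])
qed simp

lemma measurable_disp [measurable]: "(\<lambda>\<omega>. disp \<omega> m x j) \<in> measurable configs (count_space UNIV)"
proof (subst measurable_count_space_eq2_countable, simp, safe)
  fix c
  have *: "disp \<omega> m x j = c \<longleftrightarrow> disp \<omega> m x j \<le> c \<and> \<not> disp \<omega> m x j \<le> c - 1" for \<omega> by auto
  have "Measurable.pred configs (\<lambda>\<omega>. disp \<omega> m x j = c)"
    unfolding * disp_le_iff Ball_def by measurable
  then have "{\<omega> \<in> space configs. disp \<omega> m x j = c} \<in> sets configs" by (rule predE)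
  also have "{\<omega> \<in> space configs. disp \<omega> m x j = c} = (\<lambda>\<omega>. disp \<omega> m x j) -` {c} \<inter> space configs"
    by auto
  finally show "(\<lambda>\<omega>. disp \<omega> m x j) -` {c} \<inter> space configs \<in> sets configs" .
qed

section \<open>Invariance of the labels under shifts and reflections\<close>

definition shift_conf :: "int \<Rightarrow> int \<Rightarrow> (edge \<Rightarrow> bool) \<Rightarrow> edge \<Rightarrow> bool" where
  "shift_conf a b \<omega> = (\<lambda>e\<in>edges. \<omega> (shift_edge a b e))"

definition reflect_conf :: "(edge \<Rightarrow> bool) \<Rightarrow> edge \<Rightarrow> bool" where
  "reflect_conf \<omega> = (\<lambda>e\<in>edges. \<omega> (reflect_edge e))"

lemma measurable_reflect_conf [measurable]: "reflect_conf \<in> measurable configs configs"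
  unfolding reflect_conf_def[abs_def]
proof (subst (2) configs_def, rule measurable_restrict)
  fix e assume "e \<in> edges"
  then show "Measurable.pred configs (\<lambda>u. u (reflect_edge e))"
    by (simp add: measurable_config reflect_edge_in_edges)
qed

lemma distr_labels_reindex:
  assumes "inj_on g edges" "g \<in> edges \<rightarrow> edges"
  shows "distr labels labels (\<lambda>u. \<lambda>e\<in>edges. u (g e)) = labels"
  using distr_PiM_reindex[of edges "\<lambda>_. unif" g edges] prob_space_unif assms
  by (simp add: labels_def)

lemma measurable_labels_reindex:
  assumes "g \<in> edges \<rightarrow> edges"
  shows "(\<lambda>u. \<lambda>e\<in>edges. u (g e)) \<in> measurable labels labels"
  unfolding labels_def
  by (rule measurable_restrict) (use assms in \<open>auto intro: measurable_component_singleton\<close>)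

lemma prob_labels_reindex:
  assumes g: "inj_on g edges" "g \<in> edges \<rightarrow> edges" and [measurable]: "Measurable.pred labels P"
  shows "\<P>(u in labels. P (\<lambda>e\<in>edges. u (g e))) = \<P>(u in labels. P u)"
proof -
  note [measurable] = measurable_labels_reindex[OF g(2)]
  have "\<P>(u in labels. P u) = \<P>(u in distr labels labels (\<lambda>u. \<lambda>e\<in>edges. u (g e)). P u)"
    by (simp add: distr_labels_reindex[OF g])
  also have "\<dots> = \<P>(u in labels. P (\<lambda>e\<in>edges. u (g e)))"
    by (subst measure_distr) (auto intro!: arg_cong[where f="measure labels"] dest: measurable_space[OF measurable_labels_reindex[OF g(2)]])
  finally show ?thesis by simp
qed

text \<open>Moving the labels by a lattice vector preserves their law, while the density profile is
  read \<open>b\<close> levels higher.\<close>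

lemma prob_shift_conf:
  assumes ab: "even (a + b)" and [measurable]: "Measurable.pred configs P"
  shows "\<P>(u in labels. P (shift_conf a b (conf Q u))) = \<P>(u in labels. P (conf (\<lambda>n. Q (n + b)) u))"
proof -
  have "\<P>(u in labels. P (conf (\<lambda>n. Q (n + b)) (\<lambda>e\<in>edges. u (shift_edge a b e)))) =
        \<P>(u in labels. P (conf (\<lambda>n. Q (n + b)) u))"
    by (rule prob_labels_reindex) (auto simp: inj_shift_edge shift_edge_in_edges[OF ab])
  moreover have "conf (\<lambda>n. Q (n + b)) (\<lambda>e\<in>edges. u (shift_edge a b e)) = shift_conf a b (conf Q u)" for u
    by (auto simp: conf_def shift_conf_def fun_eq_iff shift_edge_in_edges[OF ab])
  ultimately show ?thesis by simp
qed

lemma prob_reflect_conf: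
  assumes [measurable]: "Measurable.pred configs P"
  shows "\<P>(u in labels. P (reflect_conf (conf Q u))) = \<P>(u in labels. P (conf Q u))"
proof -
  have "\<P>(u in labels. P (conf Q (\<lambda>e\<in>edges. u (reflect_edge e)))) = \<P>(u in labels. P (conf Q u))"
    by (rule prob_labels_reindex) (auto simp: inj_reflect_edge reflect_edge_in_edges)
  moreover have "conf Q (\<lambda>e\<in>edges. u (reflect_edge e)) = reflect_conf (conf Q u)" for u
    by (auto simp: conf_def reflect_conf_def fun_eq_iff reflect_edge_in_edges)
  ultimately show ?thesis by simp
qed

lemma disp_reflect_conf: "disp (\<omega> \<circ> reflect_edge) m x j = disp (reflect_conf \<omega>) m x j"
  by (rule disp_cong) (simp add: reflect_conf_def)

lemma disp_shift_conf:
  "even (a + b) \<Longrightarrow> disp \<omega> (m + b) (x + a) j = disp (shift_conf a b \<omega>) m x j"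
  by (rule disp_shift) (auto simp: shift_conf_def)

lemma prob_disp_shift:
  assumes "even (x + m)"
  shows "\<P>(u in labels. disp (conf Q u) m x j \<in> A) = \<P>(u in labels. disp (conf (\<lambda>n. Q (n + m)) u) 0 0 j \<in> A)"
proof -
  have "disp (conf Q u) m x j = disp (shift_conf x m (conf Q u)) 0 0 j" for u
    using disp_shift_conf[OF assms, of "conf Q u" 0 0 j] by simp
  then show ?thesis using prob_shift_conf[OF assms, of "\<lambda>\<omega>. disp \<omega> 0 0 j \<in> A" Q] by simp
qed

section \<open>Independence of events on disjoint sets of edges\<close>

lemma indep_vars_labels: "labels.indep_vars (\<lambda>_. unif) (\<lambda>e u. u e) edges"
proof (subst labels.indep_vars_iff_distr_eq_PiM')
  show "edges \<noteq> {}" using edges_iff[of 0 0 1 1] by auto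
  show "labels.random_variable unif (\<lambda>u. u e)" if "e \<in> edges" for e
    using measurable_label[OF that] by (simp cong: measurable_cong_sets)
  have "distr labels (Pi\<^sub>M edges (\<lambda>_. unif)) (\<lambda>x. \<lambda>e\<in>edges. x e) = distr labels labels (\<lambda>x. x)"
    by (rule distr_cong) (auto simp: labels_def space_PiM)
  also have "\<dots> = Pi\<^sub>M edges (\<lambda>_. unif)" by (simp add: distr_id labels_def)
  also have "\<dots> = Pi\<^sub>M edges (\<lambda>e. distr labels unif (\<lambda>u. u e))"
    by (intro PiM_cong) (auto simp: labels_def distr_PiM_component[OF prob_space_unif])
  finally show "distr labels (Pi\<^sub>M edges (\<lambda>_. unif)) (\<lambda>x. \<lambda>e\<in>edges. x e) =
    Pi\<^sub>M edges (\<lambda>e. distr labels unif (\<lambda>u. u e))" .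
qed

definition depends_on :: "edge set \<Rightarrow> ((edge \<Rightarrow> real) \<Rightarrow> bool) \<Rightarrow> bool" where
  "depends_on I P \<longleftrightarrow> (\<forall>u v. (\<forall>e\<in>I. u e = v e) \<longrightarrow> P u = P v)"

lemma depends_on_restrict:
  assumes P: "depends_on I P" "Measurable.pred labels P" and I: "I \<subseteq> edges"
  obtains P' where "Measurable.pred (Pi\<^sub>M I (\<lambda>_. unif)) P'" "\<And>u. P u = P' (\<lambda>e\<in>I. u e)"
proof
  \<comment> \<open>Labels outside \<open>I\<close> are filled with 0; the value is arbitrary
    because \<open>P\<close> ignores them.\<close>
  let ?g = "\<lambda>v. \<lambda>e\<in>edges. if e \<in> I then v e else 0 :: real"
  have "?g \<in> measurable (Pi\<^sub>M I (\<lambda>_. unif)) labels"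
    unfolding labels_def
  proof (rule measurable_restrict)
    fix e
    show "(\<lambda>v. if e \<in> I then v e else 0) \<in> measurable (Pi\<^sub>M I (\<lambda>_. unif)) unif"
      by (cases "e \<in> I") (auto intro: measurable_component_singleton)
  qed
  then show "Measurable.pred (Pi\<^sub>M I (\<lambda>_. unif)) (\<lambda>v. P (?g v))"
    using P(2) by (rule measurable_compose)
  show "P u = P (?g (\<lambda>e\<in>I. u e))" for u
    by (rule P(1)[unfolded depends_on_def, rule_format]) (use I in auto)
qed

lemma prob_indep:
  assumes P: "depends_on I P" "Measurable.pred labels P" and R: "depends_on J R" "Measurable.pred labels R"
    and IJ: "I \<inter> J = {}" "I \<subseteq> edges" "J \<subseteq> edges"
  shows "\<P>(u in labels. P u \<and> R u) = \<P>(u in labels. P u) * \<P>(u in labels. R u)"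
proof -
  obtain P' where P': "Measurable.pred (Pi\<^sub>M I (\<lambda>_. unif)) P'" "\<And>u. P u = P' (\<lambda>e\<in>I. u e)"
    using depends_on_restrict[OF P IJ(2)] by metis
  obtain R' where R': "Measurable.pred (Pi\<^sub>M J (\<lambda>_. unif)) R'" "\<And>u. R u = R' (\<lambda>e\<in>J. u e)"
    using depends_on_restrict[OF R IJ(3)] by metis
  have "labels.indep_var (Pi\<^sub>M I (\<lambda>_. unif)) (\<lambda>u. \<lambda>e\<in>I. u e) (Pi\<^sub>M J (\<lambda>_. unif)) (\<lambda>u. \<lambda>e\<in>J. u e)"
    by (rule labels.indep_var_restrict[OF indep_vars_labels IJ])
  from labels.indep_var_compose[OF this P'(1) R'(1)]
  have "labels.indep_var (count_space UNIV) (P' \<circ> (\<lambda>u. \<lambda>e\<in>I. u e)) (count_space UNIV) (R' \<circ> (\<lambda>u. \<lambda>e\<in>J. u e))" .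
  also have "P' \<circ> (\<lambda>u. \<lambda>e\<in>I. u e) = P" using P'(2) by (auto simp: fun_eq_iff)
  also have "R' \<circ> (\<lambda>u. \<lambda>e\<in>J. u e) = R" using R'(2) by (auto simp: fun_eq_iff)
  finally have "labels.indep_var (count_space UNIV) P (count_space UNIV) R" .
  from labels.prob_indep_random_variable[OF this, of "{True}" "{True}"]
  show ?thesis by simp
qed

lemma prob_label_le:
  assumes e: "e \<in> edges" and q: "0 \<le> q" "q \<le> 1"
  shows "\<P>(u in labels. u e \<le> q) = q"
proof -
  have "\<P>(u in labels. u e \<le> q) = measure (distr labels unif (\<lambda>u. u e)) {..q}"
    using measurable_label[OF e]
    by (subst measure_distr) (auto intro!: arg_cong[where f="measure labels"] cong: measurable_cong_sets)
  also have "distr labels unif (\<lambda>u. u e) = unif"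
    unfolding labels_def by (rule distr_PiM_component[OF prob_space_unif e])
  also have "measure unif {..q} = measure lborel ({0..1} \<inter> {..q})"
    unfolding unif_def by (subst measure_uniform_measure) auto
  also have "{0..1} \<inter> {..q} = {0..q}" using q by auto
  finally show ?thesis using q by simp
qed

text \<open>Stated for arbitrary independent indicators \<open>X\<close> so as to serve twice: for
  single labels, and for the coarse lattice of \<open>macro_percolation\<close>, whose edges are
  open when a whole path is.\<close>

lemma percolation_eq_distr_indep:
  fixes X :: "edge \<Rightarrow> (edge \<Rightarrow> real) \<Rightarrow> bool"
  assumes ind: "labels.indep_vars (\<lambda>_. count_space UNIV) X edges"
    and q: "\<And>e. e \<in> edges \<Longrightarrow> \<P>(u in labels. X e u) = q e"
  shows "percolation q = distr labels configs (\<lambda>u. \<lambda>e\<in>edges. X e u)"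
proof -
  have rv: "Measurable.pred labels (X e)" if "e \<in> edges" for e
    using ind that by (auto simp: labels.indep_vars_def)
  have "distr labels configs (\<lambda>u. \<lambda>e\<in>edges. X e u) =
      Pi\<^sub>M edges (\<lambda>e. distr labels (count_space UNIV) (X e))"
    unfolding configs_def using edges_iff[of 0 0 1 1] rv ind
    by (subst (asm) labels.indep_vars_iff_distr_eq_PiM') auto
  also have "\<dots> = percolation q"
    unfolding percolation_def
  proof (intro PiM_cong refl)
    fix e assume e: "e \<in> edges"
    have q01: "0 \<le> q e" "q e \<le> 1" using q[OF e] labels.prob_le_1 by (auto simp: measure_nonneg simp flip: q[OF e])
    interpret D: prob_space "distr labels (count_space UNIV) (X e)"
      by (rule labels.prob_space_distr[OF rv[OF e]])
    have T: "measure (distr labels (count_space UNIV) (X e)) {True} = q e"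
    proof (subst measure_distr[OF rv[OF e]])
      have "X e -` {True} \<inter> space labels = {u \<in> space labels. X e u}" by auto
      then show "measure labels (X e -` {True} \<inter> space labels) = q e" using q[OF e] by simp
    qed simp
    have "space (distr labels (count_space UNIV) (X e)) - {True} = {False}" by auto
    then have F: "measure (distr labels (count_space UNIV) (X e)) {False} = 1 - q e"
      using D.prob_compl[of "{True}"] T by simp
    show "distr labels (count_space UNIV) (X e) = measure_pmf (bernoulli_pmf (q e))"
    proof (rule measure_eqI_countable[of _ UNIV])
      fix b :: bool
      show "emeasure (distr labels (count_space UNIV) (X e)) {b} = emeasure (measure_pmf (bernoulli_pmf (q e))) {b}"
        using T F q01 by (cases b) (simp_all add: D.emeasure_eq_measure emeasure_pmf_single)
    qed auto
  qed
  finally show ?thesis ..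
qed

lemma percolation_eq_distr:
  assumes q: "\<And>e. e \<in> edges \<Longrightarrow> 0 \<le> q e \<and> q e \<le> 1"
  shows "percolation q = distr labels configs (\<lambda>u. \<lambda>e\<in>edges. u e \<le> q e)"
proof (rule percolation_eq_distr_indep)
  show "labels.indep_vars (\<lambda>_. count_space UNIV) (\<lambda>e u. u e \<le> q e) edges"
    by (rule labels.indep_vars_compose2[OF indep_vars_labels]) measurable
  show "\<P>(u in labels. u e \<le> q e) = q e" if "e \<in> edges" for e
    using prob_label_le[OF that, of "q e"] q[OF that] by simp
qed

section \<open>The law of large numbers for the right edge\<close>

abbreviation hconf :: "real \<Rightarrow> (edge \<Rightarrow> real) \<Rightarrow> edge \<Rightarrow> bool" where
  "hconf p \<equiv> conf (\<lambda>_. p)"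

definition mean_disp :: "real \<Rightarrow> nat \<Rightarrow> real" where
  "mean_disp p n = labels.expectation (\<lambda>u. real_of_int (disp (hconf p u) 0 0 n))"

text \<open>By Fekete's lemma the infimum is also the limit (\<open>mean_disp_tendsto\<close>). It
  makes sense for every \<open>p\<close>, and above \<open>p_c\<close> it is the speed
  (\<open>speed_eq_drift\<close>).\<close>

definition drift :: "real \<Rightarrow> real" where
  "drift p = (INF n\<in>{1..}. mean_disp p n / real n)"

definition law :: "real \<Rightarrow> nat \<Rightarrow> int \<Rightarrow> real" where
  "law p n c = \<P>(u in labels. disp (hconf p u) 0 0 n = c)"

lemma law_nonneg: "0 \<le> law p n c"
  by (simp add: law_def)

lemma depends_on_disp:
  "depends_on {e \<in> edges. m \<le> lev e \<and> lev e < m + int j} (\<lambda>u. disp (conf Q u) m x j \<in> A)"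
  unfolding depends_on_def
proof (intro allI impI)
  fix u v :: "edge \<Rightarrow> real"
  assume *: "\<forall>e\<in>{e \<in> edges. m \<le> lev e \<and> lev e < m + int j}. u e = v e"
  have "disp (conf Q u) m x j = disp (conf Q v) m x j"
  proof (rule disp_cong)
    fix e assume "e \<in> edges" "m \<le> lev e" "lev e < m + int j"
    with * have "u e = v e" by blast
    then show "conf Q u e = conf Q v e" by (simp add: conf_def)
  qed
  then show "(disp (conf Q u) m x j \<in> A) = (disp (conf Q v) m x j \<in> A)" by simp
qed

text \<open>The second displacement starts at a fixed \<open>y\<close>, not at the random edge; a
  random start is recovered by summing over the values of the first displacement.\<close>

lemma prob_disp_chain:
  "\<P>(u in labels. disp (conf Q u) m x i \<in> A \<and> disp (conf Q' u) (m + int i) y j \<in> B) =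
   \<P>(u in labels. disp (conf Q u) m x i \<in> A) * \<P>(u in labels. disp (conf Q' u) (m + int i) y j \<in> B)"
  by (rule prob_indep[OF depends_on_disp _ depends_on_disp]) auto

lemma law_odd: "odd (c + int n) \<Longrightarrow> law p n c = 0"
proof -
  assume "odd (c + int n)"
  then have "disp (hconf p u) 0 0 n \<noteq> c" for u
    using disp_parity[of 0 0 "hconf p u" n] by auto
  then show ?thesis by (simp add: law_def)
qed

lemma expectation_finite_range:
  fixes X :: "(edge \<Rightarrow> real) \<Rightarrow> int" and f :: "int \<Rightarrow> real"
  assumes [measurable]: "X \<in> measurable labels (count_space UNIV)"
    and X: "\<And>u. X u \<in> {-int n..int n}"
  shows "integrable labels (\<lambda>u. f (X u))"
    and "labels.expectation (\<lambda>u. f (X u)) = (\<Sum>c\<in>{-int n..int n}. \<P>(u in labels. X u = c) * f c)"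
proof -
  have eq: "f (X u) = (\<Sum>c\<in>{-int n..int n}. indicator {u \<in> space labels. X u = c} u * f c)"
    if "u \<in> space labels" for u
  proof -
    have "(\<Sum>c\<in>{-int n..int n}. indicator {u \<in> space labels. X u = c} u * f c) =
        (\<Sum>c\<in>{-int n..int n}. if c = X u then f c else 0)"
      using that by (intro sum.cong) (auto simp: indicator_def)
    also have "\<dots> = f (X u)" using X[of u] by simp
    finally show ?thesis ..
  qed
  have int: "integrable labels (\<lambda>u. indicator {u \<in> space labels. X u = c} u * f c)" for c
    by (intro integrable_mult_left integrable_real_indicator) (auto simp: labels.emeasure_eq_measure)
  have "integrable labels (\<lambda>u. \<Sum>c\<in>{-int n..int n}. indicator {u \<in> space labels. X u = c} u * f c)"
    using int by (rule Bochner_Integration.integrable_sum)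
  then show "integrable labels (\<lambda>u. f (X u))"
    by (subst Bochner_Integration.integrable_cong[OF refl eq]) auto
  have "labels.expectation (\<lambda>u. f (X u)) =
      labels.expectation (\<lambda>u. \<Sum>c\<in>{-int n..int n}. indicator {u \<in> space labels. X u = c} u * f c)"
    by (rule Bochner_Integration.integral_cong[OF refl eq])
  also have "\<dots> = (\<Sum>c\<in>{-int n..int n}. labels.expectation (\<lambda>u. indicator {u \<in> space labels. X u = c} u * f c))"
    using int by (rule Bochner_Integration.integral_sum)
  also have "\<dots> = (\<Sum>c\<in>{-int n..int n}. \<P>(u in labels. X u = c) * f c)"
    by (intro sum.cong refl) (auto simp: Int_def conj_commute intro!: arg_cong[where f="measure labels"])
  finally show "labels.expectation (\<lambda>u. f (X u)) = (\<Sum>c\<in>{-int n..int n}. \<P>(u in labels. X u = c) * f c)" .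
qed

lemma disp_range: "disp \<omega> m x n \<in> {-int n..int n}"
  using disp_ge disp_le by simp

lemma expectation_disp:
  fixes f :: "int \<Rightarrow> real"
  shows "integrable labels (\<lambda>u. f (disp (conf Q u) m x n))"
    and "labels.expectation (\<lambda>u. f (disp (conf Q u) m x n)) =
      (\<Sum>c\<in>{-int n..int n}. \<P>(u in labels. disp (conf Q u) m x n = c) * f c)"
  using expectation_finite_range[of "\<lambda>u. disp (conf Q u) m x n" n f] disp_range by auto

lemma sum_law: "(\<Sum>c\<in>{-int n..int n}. law p n c) = 1"
  using expectation_disp(2)[of "\<lambda>_. 1" "\<lambda>_. p" 0 0 n] by (simp add: law_def labels.prob_space)

lemma mean_disp_law: "mean_disp p n = (\<Sum>c\<in>{-int n..int n}. law p n c * real_of_int c)"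
  unfolding mean_disp_def law_def by (rule expectation_disp)

lemma law_shift:
  "even (x + m) \<Longrightarrow> \<P>(u in labels. disp (hconf p u) m x n = c) = law p n c"
  using prob_disp_shift[of x m "\<lambda>_. p" n "{c}"] by (simp add: law_def)

text \<open>The restart at the random edge is resolved by summing over its value \<open>c\<close>;
  for fixed \<open>c\<close> the two increments concern disjoint ranges of levels. Monotonicity of
  \<open>f\<close> is asked for only from \<open>- int (i + j)\<close> on, so that the squared
  distance from the lowest value is admissible.\<close>

lemma expectation_disp_add:
  fixes f :: "int \<Rightarrow> real"
  assumes f: "\<And>x y. - int (i + j) \<le> x \<Longrightarrow> x \<le> y \<Longrightarrow> f x \<le> f y"
  shows "labels.expectation (\<lambda>u. f (disp (hconf p u) 0 0 (i + j))) \<le>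
    (\<Sum>c\<in>{-int i..int i}. \<Sum>d\<in>{-int j..int j}. law p i c * law p j d * f (c + d))"
proof -
  define X where "X u = disp (hconf p u) 0 0 i" for u
  define Y where "Y c u = disp (hconf p u) (int i) c j" for c u
  have X [measurable]: "X \<in> measurable labels (count_space UNIV)" and Y [measurable]: "Y c \<in> measurable labels (count_space UNIV)" for c
    unfolding X_def[abs_def] Y_def[abs_def] by measurable
  have XR: "X u \<in> {-int i..int i}" and YR: "Y c u \<in> {-int j..int j}" for c u
    using disp_range by (simp_all add: X_def Y_def)
  let ?I = "\<lambda>c d. indicator {u \<in> space labels. X u = c \<and> Y c u = d} :: (edge \<Rightarrow> real) \<Rightarrow> real"
  have "f (disp (hconf p u) 0 0 (i + j)) \<le> (\<Sum>c\<in>{-int i..int i}. \<Sum>d\<in>{-int j..int j}. ?I c d u * f (c + d))"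
    if "u \<in> space labels" for u
  proof -
    have "f (disp (hconf p u) 0 0 (i + j)) \<le> f (X u + Y (X u) u)"
      using disp_subadd[of "hconf p u" 0 0 i j] disp_ge[of "i + j" "hconf p u" 0 0]
      by (intro f) (auto simp: X_def Y_def)
    also have "\<dots> = (\<Sum>d\<in>{-int j..int j}. if d = Y (X u) u then f (X u + d) else 0)"
      using YR[of "X u" u] by simp
    also have "\<dots> = (\<Sum>c\<in>{-int i..int i}. if c = X u then \<Sum>d\<in>{-int j..int j}. if d = Y c u then f (c + d) else 0 else 0)"
      using XR[of u] by simp
    also have "\<dots> = (\<Sum>c\<in>{-int i..int i}. \<Sum>d\<in>{-int j..int j}. ?I c d u * f (c + d))"
    proof (intro sum.cong refl)
      fix c assume "c \<in> {-int i..int i}"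
      show "(if c = X u then \<Sum>d\<in>{-int j..int j}. if d = Y c u then f (c + d) else 0 else 0) =
          (\<Sum>d\<in>{-int j..int j}. ?I c d u * f (c + d))"
        using that by (cases "c = X u") (auto intro!: sum.cong simp: indicator_def)
    qed
    finally show ?thesis .
  qed
  moreover have int: "integrable labels (\<lambda>u. ?I c d u * f (c + d))" for c d
    by (intro integrable_mult_left integrable_real_indicator) (auto simp: labels.emeasure_eq_measure)
  ultimately have "labels.expectation (\<lambda>u. f (disp (hconf p u) 0 0 (i + j))) \<le>
     labels.expectation (\<lambda>u. \<Sum>c\<in>{-int i..int i}. \<Sum>d\<in>{-int j..int j}. ?I c d u * f (c + d))"
    by (intro integral_mono expectation_disp Bochner_Integration.integrable_sum) auto
  also have "\<dots> = (\<Sum>c\<in>{-int i..int i}. \<Sum>d\<in>{-int j..int j}. labels.expectation (\<lambda>u. ?I c d u * f (c + d)))"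
    by (subst Bochner_Integration.integral_sum, intro Bochner_Integration.integrable_sum int)
       (intro sum.cong refl Bochner_Integration.integral_sum int)
  also have "\<dots> = (\<Sum>c\<in>{-int i..int i}. \<Sum>d\<in>{-int j..int j}. law p i c * law p j d * f (c + d))"
  proof (intro sum.cong refl)
    fix c d
    have "labels.expectation (\<lambda>u. ?I c d u * f (c + d)) = \<P>(u in labels. X u = c \<and> Y c u = d) * f (c + d)"
      by (auto simp: Int_def conj_commute intro!: arg_cong[where f="measure labels"])
    also have "\<P>(u in labels. X u = c \<and> Y c u = d) = law p i c * \<P>(u in labels. Y c u = d)"
      using prob_disp_chain[of "\<lambda>_. p" 0 0 i "{c}" "\<lambda>_. p" c j "{d}"] by (simp add: X_def Y_def law_def)
    \<comment> \<open>Shifting requires that \<open>c\<close> is a lattice position on level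
      \<open>int i\<close>; otherwise \<open>law p i c\<close> is 0.\<close>
    also have "\<dots> = law p i c * law p j d"
      using law_shift[of c "int i" p j d] law_odd[of c i p] by (cases "even (c + int i)") (auto simp: Y_def)
    finally show "labels.expectation (\<lambda>u. ?I c d u * f (c + d)) = law p i c * law p j d * f (c + d)" .
  qed
  finally show ?thesis .
qed

lemma sum_law_add:
  "(\<Sum>c\<in>{-int i..int i}. \<Sum>d\<in>{-int j..int j}. law p i c * law p j d * (F c + G d)) =
   (\<Sum>c\<in>{-int i..int i}. law p i c * F c) + (\<Sum>d\<in>{-int j..int j}. law p j d * G d)"
proof -
  have "(\<Sum>c\<in>{-int i..int i}. \<Sum>d\<in>{-int j..int j}. law p i c * law p j d * (F c + G d)) =
    (\<Sum>c\<in>{-int i..int i}. law p i c * F c * (\<Sum>d\<in>{-int j..int j}. law p j d)) +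
    (\<Sum>c\<in>{-int i..int i}. law p i c * (\<Sum>d\<in>{-int j..int j}. law p j d * G d))"
    by (simp add: sum_distrib_left distrib_left sum.distrib algebra_simps)
  then show ?thesis by (simp add: sum_law sum_distrib_right[symmetric])
qed

lemma mean_disp_subadd: "mean_disp p (i + j) \<le> mean_disp p i + mean_disp p j"
  using expectation_disp_add[of i j real_of_int p] sum_law_add[where F=real_of_int and G=real_of_int]
  by (simp add: mean_disp_law[symmetric] mean_disp_def[symmetric])

lemma abs_mean_disp_le: "\<bar>mean_disp p n\<bar> \<le> real n"
proof -
  have "\<bar>mean_disp p n\<bar> \<le> (\<Sum>c\<in>{-int n..int n}. law p n c * real n)"
    unfolding mean_disp_law
    by (rule order_trans[OF sum_abs], rule sum_mono)
       (auto simp: abs_mult law_nonneg intro!: mult_left_mono)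
  then show ?thesis by (simp add: sum_distrib_right[symmetric] sum_law)
qed

lemma bdd_below_mean_disp: "bdd_below ((\<lambda>n. mean_disp p n / real n) ` {1..})"
proof (rule bdd_belowI2)
  fix n :: nat assume "n \<in> {1..}"
  then show "-1 \<le> mean_disp p n / real n" using abs_mean_disp_le[of p n] by (simp add: field_simps)
qed

lemma drift_le: "n \<ge> 1 \<Longrightarrow> drift p \<le> mean_disp p n / real n"
  unfolding drift_def by (rule cINF_lower[OF bdd_below_mean_disp]) simp

lemma drift_greatest: "(\<And>n. n \<ge> 1 \<Longrightarrow> c \<le> mean_disp p n / real n) \<Longrightarrow> c \<le> drift p"
  unfolding drift_def by (rule cINF_greatest) auto

lemma drift_le_1: "drift p \<le> 1"
  using drift_le[of 1 p] abs_mean_disp_le[of p 1] by simp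

lemma mean_disp_mono: "p \<le> q \<Longrightarrow> mean_disp p n \<le> mean_disp q n"
  unfolding mean_disp_def
proof (rule integral_mono[OF expectation_disp(1) expectation_disp(1)])
  fix u assume "p \<le> q"
  then show "real_of_int (disp (hconf p u) 0 0 n) \<le> real_of_int (disp (hconf q u) 0 0 n)"
    by (auto intro!: disp_mono simp: conf_def)
qed

lemma drift_mono: "p \<le> q \<Longrightarrow> drift p \<le> drift q"
  by (rule drift_greatest) (meson divide_right_mono drift_le mean_disp_mono of_nat_0_le_iff order_trans)

lemma mean_disp_mult: "mean_disp p (k * n) \<le> real k * mean_disp p n"
proof (induction k)
  case 0
  then show ?case by (simp add: mean_disp_def)
next
  case (Suc k)
  then show ?case using mean_disp_subadd[of p n "k * n"] by (simp add: algebra_simps)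
qed

text \<open>Fekete's lemma. For the upper bound \<open>n\<close> is divided by a nearly optimal
  block length \<open>N\<close>; the remainder costs at most \<open>2 * real N\<close>.\<close>

lemma mean_disp_tendsto: "(\<lambda>n. mean_disp p n / real n) \<longlonglongrightarrow> drift p"
proof (rule LIMSEQ_I)
  fix r :: real assume r: "r > 0"
  have "\<exists>n\<in>{1..}. mean_disp p n / real n < drift p + r / 2"
    using cINF_less_iff[OF _ bdd_below_mean_disp, of p "drift p + r / 2"] r by (auto simp: drift_def)
  then obtain N where N: "N \<ge> 1" "mean_disp p N / real N < drift p + r / 2" by auto
  show "\<exists>no. \<forall>n\<ge>no. norm (mean_disp p n / real n - drift p) < r"
  proof (intro exI allI impI)
    fix n assume n: "n \<ge> nat \<lceil>4 * real N / r\<rceil> + 1"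
    then have n0: "real n > 4 * real N / r" "n \<ge> 1" by linarith+
    define q where "q = n div N"
    define s where "s = n mod N"
    have ns: "n = q * N + s" "s < N" using N by (auto simp: q_def s_def)
    have "mean_disp p n \<le> real q * mean_disp p N + real s"
      using mean_disp_subadd[of p "q * N" s] mean_disp_mult[of p q N] abs_mean_disp_le[of p s] ns by simp
    also have "real q * mean_disp p N = (real n - real s) * (mean_disp p N / real N)"
      using N ns by simp
    also have "\<dots> \<le> real n * (mean_disp p N / real N) + real s"
    proof -
      have "real s * (- (mean_disp p N / real N)) \<le> real s * 1"
        using abs_mean_disp_le[of p N] N by (intro mult_left_mono) (auto simp: field_simps)
      then show ?thesis
        by (simp only: left_diff_distrib mult_minus_right mult_1_right)
    qed
    finally have "mean_disp p n \<le> real n * (mean_disp p N / real N) + 2 * real N" using ns by simp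
    also have "real n * (mean_disp p N / real N) \<le> real n * (drift p + r / 2)"
      using N by (intro mult_left_mono) auto
    also have "2 * real N < real n * (r / 2)" using n0 r by (simp add: field_simps)
    finally have "mean_disp p n / real n < drift p + r" using n0 by (simp add: field_simps)
    with drift_le[of n p] n0 show "norm (mean_disp p n / real n - drift p) < r" by auto
  qed
qed

section \<open>Variances and almost sure convergence\<close>

definition var_disp :: "real \<Rightarrow> nat \<Rightarrow> real" where
  "var_disp p n = labels.expectation (\<lambda>u. (real_of_int (disp (hconf p u) 0 0 n) - mean_disp p n)\<^sup>2)"

text \<open>The second moment is taken about the lowest value \<open>- int n\<close>, from which on
  the square is increasing, so that \<open>expectation_disp_add\<close> applies to it.\<close>

lemma var_disp_eq: "var_disp p n = (\<Sum>c\<in>{-int n..int n}. law p n c * (real_of_int c + real n)\<^sup>2) - (mean_disp p n + real n)\<^sup>2"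
proof -
  have "var_disp p n = (\<Sum>c\<in>{-int n..int n}. law p n c * (real_of_int c - mean_disp p n)\<^sup>2)"
    unfolding var_disp_def law_def by (rule expectation_disp)
  also have "\<dots> = (\<Sum>c\<in>{-int n..int n}. law p n c * (real_of_int c + real n)\<^sup>2
      - 2 * (mean_disp p n + real n) * (law p n c * real_of_int c) + ((mean_disp p n)\<^sup>2 - (real n)\<^sup>2) * law p n c)"
    by (intro sum.cong refl) (simp add: power2_eq_square algebra_simps)
  also have "\<dots> = (\<Sum>c\<in>{-int n..int n}. law p n c * (real_of_int c + real n)\<^sup>2)
      - 2 * (mean_disp p n + real n) * mean_disp p n + ((mean_disp p n)\<^sup>2 - (real n)\<^sup>2)"
    by (simp only: sum.distrib sum_subtractf sum_distrib_left[symmetric] mean_disp_law[symmetric] sum_law mult_1_right)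
  finally show ?thesis by (simp add: power2_eq_square algebra_simps)
qed

text \<open>Kesten's estimate: subadditivity with independent increments bounds the variance at the
  doubled time, up to a term which telescopes.\<close>

lemma var_disp_double:
  "var_disp p (2 * n) \<le> 2 * var_disp p n + 4 * (mean_disp p n + real n)\<^sup>2 - (mean_disp p (2 * n) + 2 * real n)\<^sup>2"
proof -
  define A where "A = {-int n..int n}"
  have "(\<Sum>c\<in>{-int (2 * n)..int (2 * n)}. law p (2 * n) c * (real_of_int c + real (2 * n))\<^sup>2) =
      labels.expectation (\<lambda>u. (real_of_int (disp (hconf p u) 0 0 (n + n)) + 2 * real n)\<^sup>2)"
    using expectation_disp(2)[of "\<lambda>c. (real_of_int c + 2 * real n)\<^sup>2" "\<lambda>_. p" 0 0 "n + n"]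
    by (simp add: law_def mult_2[symmetric])
  also have "\<dots> \<le> (\<Sum>c\<in>A. \<Sum>d\<in>A. law p n c * law p n d * (real_of_int (c + d) + 2 * real n)\<^sup>2)"
    unfolding A_def
    by (rule expectation_disp_add[where f="\<lambda>c. (real_of_int c + 2 * real n)\<^sup>2"]) (auto intro!: power_mono)
  also have "\<dots> = (\<Sum>c\<in>A. \<Sum>d\<in>A. law p n c * law p n d * ((real_of_int c + real n)\<^sup>2 + (real_of_int d + real n)\<^sup>2))
     + 2 * (\<Sum>c\<in>A. \<Sum>d\<in>A. (law p n c * (real_of_int c + real n)) * (law p n d * (real_of_int d + real n)))"
    unfolding sum_distrib_left sum.distrib[symmetric]
    by (intro sum.cong refl) (simp add: power2_eq_square algebra_simps)
  also have "\<dots> = 2 * (\<Sum>c\<in>A. law p n c * (real_of_int c + real n)\<^sup>2)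
     + 2 * (\<Sum>c\<in>A. law p n c * (real_of_int c + real n))\<^sup>2"
    unfolding A_def sum_law_add by (simp add: sum_product power2_eq_square)
  also have "(\<Sum>c\<in>A. law p n c * (real_of_int c + real n)) = mean_disp p n + real n"
    unfolding A_def by (simp add: distrib_left sum.distrib mean_disp_law sum_distrib_right[symmetric] sum_law)
  finally show ?thesis
    unfolding A_def by (simp add: var_disp_eq)
qed

lemma var_disp_nonneg: "0 \<le> var_disp p n"
  by (simp add: var_disp_def)

text \<open>Divided by the squared time, \<open>var_disp_double\<close> becomes
  \<open>v (Suc k) \<le> v k / 2 + m k - m (Suc k)\<close>. On summation the terms \<open>m\<close>
  telescope and half of the partial sum of \<open>v\<close> can be moved to the left.\<close>

lemma summable_var_disp:
  assumes N: "N \<ge> 1"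
  shows "summable (\<lambda>k. var_disp p (N * 2 ^ k) / (real (N * 2 ^ k))\<^sup>2)"
proof -
  define n where "n k = N * 2 ^ k" for k :: nat
  define v where "v k = var_disp p (n k) / (real (n k))\<^sup>2" for k
  define m where "m k = ((mean_disp p (n k) + real (n k)) / real (n k))\<^sup>2" for k
  have n0: "real (n k) > 0" and nS: "n (Suc k) = 2 * n k" for k using N by (auto simp: n_def)
  have v0: "v k \<ge> 0" and m0: "m k \<ge> 0" for k by (simp_all add: v_def m_def var_disp_nonneg)
  have vS: "v (Suc k) \<le> v k / 2 + m k - m (Suc k)" for k
  proof -
    have "v (Suc k) \<le> (2 * var_disp p (n k) + 4 * (mean_disp p (n k) + real (n k))\<^sup>2
        - (mean_disp p (2 * n k) + 2 * real (n k))\<^sup>2) / (real (2 * n k))\<^sup>2"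
      unfolding v_def nS by (intro divide_right_mono var_disp_double) simp
    also have "\<dots> = v k / 2 + m k - m (Suc k)"
      unfolding v_def m_def nS using n0[of k] by (simp add: field_simps power2_eq_square)
    finally show ?thesis .
  qed
  have bound: "(\<Sum>k<Suc K. v k) \<le> v 0 + (\<Sum>k<K. v k) / 2 + m 0 - m K" for K
  proof (induction K)
    case (Suc K)
    then show ?case using vS[of K] by (simp add: add_divide_distrib)
  qed simp
  have "(\<Sum>k<K. v k) \<le> 2 * (v 0 + m 0)" for K
    using bound[of K] m0[of K] v0[of K] by simp
  then have "summable v"
    using v0 by (intro summableI_nonneg_bounded) auto
  then show ?thesis unfolding v_def[abs_def] n_def .
qed

text \<open>The expected squared deviations are summable, so the squared deviations are almost
  surely summable and tend to 0; their centres converge by \<open>mean_disp_tendsto\<close>.\<close>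

lemma AE_disp_dyadic:
  assumes N: "N \<ge> 1"
  shows "AE u in labels. (\<lambda>k. real_of_int (disp (hconf p u) 0 0 (N * 2 ^ k)) / real (N * 2 ^ k)) \<longlonglongrightarrow> drift p"
proof -
  define n where "n k = N * 2 ^ k" for k :: nat
  define Z where "Z k u = ((real_of_int (disp (hconf p u) 0 0 (n k)) - mean_disp p (n k)) / real (n k))\<^sup>2" for k u
  have [measurable]: "Z k \<in> borel_measurable labels" for k unfolding Z_def[abs_def] by measurable
  have int: "integrable labels (Z k)" and EZ: "labels.expectation (Z k) = var_disp p (n k) / (real (n k))\<^sup>2" for k
  proof -
    show "integrable labels (Z k)"
      unfolding Z_def[abs_def]
      using expectation_disp(1)[of "\<lambda>c. ((real_of_int c - mean_disp p (n k)) / real (n k))\<^sup>2"] .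
    show "labels.expectation (Z k) = var_disp p (n k) / (real (n k))\<^sup>2"
      unfolding Z_def[abs_def] var_disp_def power_divide by simp
  qed
  have "(\<integral>\<^sup>+u. (\<Sum>k. ennreal (Z k u)) \<partial>labels) = (\<Sum>k. \<integral>\<^sup>+u. ennreal (Z k u) \<partial>labels)"
    by (rule nn_integral_suminf) measurable
  also have "\<dots> = (\<Sum>k. ennreal (var_disp p (n k) / (real (n k))\<^sup>2))"
    using int EZ by (subst nn_integral_eq_integral) (auto simp: Z_def)
  also have "\<dots> = ennreal (\<Sum>k. var_disp p (n k) / (real (n k))\<^sup>2)"
    using summable_var_disp[OF N, of p] by (intro suminf_ennreal2) (auto simp: n_def var_disp_nonneg)
  finally have "(\<integral>\<^sup>+u. (\<Sum>k. ennreal (Z k u)) \<partial>labels) \<noteq> \<infinity>" by simp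
  then have "AE u in labels. (\<Sum>k. ennreal (Z k u)) \<noteq> \<infinity>"
    by (intro nn_integral_PInf_AE) measurable
  then show ?thesis
  proof (rule AE_mp, intro AE_I2 impI)
    fix u assume "(\<Sum>k. ennreal (Z k u)) \<noteq> \<infinity>"
    then have "summable (\<lambda>k. Z k u)" by (intro summable_suminf_not_top) (auto simp: Z_def)
    then have "(\<lambda>k. Z k u) \<longlonglongrightarrow> 0" by (rule summable_LIMSEQ_zero)
    then have "(\<lambda>k. sqrt (Z k u)) \<longlonglongrightarrow> sqrt 0" by (rule tendsto_real_sqrt)
    then have "(\<lambda>k. \<bar>(real_of_int (disp (hconf p u) 0 0 (n k)) - mean_disp p (n k)) / real (n k)\<bar>) \<longlonglongrightarrow> 0"
      unfolding Z_def by simp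
    then have 1: "(\<lambda>k. (real_of_int (disp (hconf p u) 0 0 (n k)) - mean_disp p (n k)) / real (n k)) \<longlonglongrightarrow> 0"
      by (rule tendsto_rabs_zero_cancel)
    have "strict_mono n" using N by (auto simp: strict_mono_def n_def)
    then have 2: "(\<lambda>k. mean_disp p (n k) / real (n k)) \<longlonglongrightarrow> drift p"
      using LIMSEQ_subseq_LIMSEQ[OF mean_disp_tendsto[of p]] by (simp add: comp_def)
    show "(\<lambda>k. real_of_int (disp (hconf p u) 0 0 (N * 2 ^ k)) / real (N * 2 ^ k)) \<longlonglongrightarrow> drift p"
      using tendsto_add[OF 1 2] by (simp add: n_def diff_divide_distrib)
  qed
qed

text \<open>A time \<open>n\<close> lies between neighbouring grid times \<open>N * 2 ^ k\<close>
  and \<open>(N + 1) * 2 ^ k\<close> with \<open>N\<close> and \<open>N + 1\<close> in the finite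
  set \<open>{L..2*L}\<close>, over which the convergence is uniform. Increments are bounded from
  above only, so the upper bound uses the grid time before \<open>n\<close> and the lower bound the
  one after it.\<close>

lemma tendsto_from_dyadic:
  fixes f :: "nat \<Rightarrow> real"
  assumes inc: "\<And>n j. f (n + j) \<le> f n + real j"
    and lim: "\<And>N. N \<ge> 1 \<Longrightarrow> (\<lambda>k. f (N * 2 ^ k) / real (N * 2 ^ k)) \<longlonglongrightarrow> a"
  shows "(\<lambda>n. f n / real n) \<longlonglongrightarrow> a"
proof (rule LIMSEQ_I)
  fix r :: real assume r: "r > 0"
  define e where "e = r / 2"
  \<comment> \<open>Since \<open>L * 2 ^ k \<le> n\<close>, this choice makes the gap term
    \<open>(\<bar>a\<bar> + e + 1) * 2 ^ k\<close> smaller than \<open>e * real n\<close>.\<close>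
  obtain L :: nat where L: "L > 2 * (\<bar>a\<bar> + e + 1) / r" using reals_Archimedean2 by blast
  have e: "e > 0" using r by (simp add: e_def)
  have "2 * (\<bar>a\<bar> + e + 1) / r > 0" using r e by (intro divide_pos_pos) auto
  with L have "real L > 0" by linarith
  then have L1: "L \<ge> 1" by simp
  have "\<forall>\<^sub>F k in sequentially. \<forall>N\<in>{L..2*L}. norm (f (N * 2 ^ k) / real (N * 2 ^ k) - a) < e"
  proof (intro eventually_ball_finite ballI)
    fix N assume "N \<in> {L..2*L}"
    then have "N \<ge> 1" using L1 by simp
    from tendstoD[OF lim[OF this] e]
    show "\<forall>\<^sub>F k in sequentially. norm (f (N * 2 ^ k) / real (N * 2 ^ k) - a) < e"
      by (simp only: dist_norm)
  qed simp
  then obtain K where K: "\<And>k N. k \<ge> K \<Longrightarrow> N \<in> {L..2*L} \<Longrightarrow> \<bar>f (N * 2 ^ k) / real (N * 2 ^ k) - a\<bar> < e"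
    unfolding eventually_sequentially real_norm_def by metis
  show "\<exists>no. \<forall>n\<ge>no. norm (f n / real n - a) < r"
  proof (intro exI allI impI)
    fix n assume n: "n \<ge> L * 2 ^ K"
    have "\<exists>k\<ge>K. L * 2 ^ k \<le> n \<and> n < L * 2 ^ Suc k"
    proof (rule ccontr)
      assume *: "\<not> ?thesis"
      have "L * 2 ^ (K + i) \<le> n" for i
      proof (induction i)
        case (Suc i)
        then show ?case using *[simplified, rule_format, of "K + i"] by simp
      qed (use n in simp)
      moreover have "1 * 2 ^ (K + n) \<le> L * 2 ^ (K + n)" using L1 by (intro mult_le_mono1)
      ultimately have "2 ^ (K + n) \<le> n" by (metis mult_1 order_trans)
      moreover have "n < 2 ^ n" by (rule less_exp)
      moreover have "(2::nat) ^ n \<le> 2 ^ (K + n)" by (rule power_increasing) auto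
      ultimately show False by linarith
    qed
    then obtain k where k: "k \<ge> K" "L * 2 ^ k \<le> n" "n < L * 2 ^ Suc k" by blast
    define N where "N = n div 2 ^ k"
    have N1: "N * 2 ^ k \<le> n" "n < (N + 1) * 2 ^ k"
      unfolding N_def using dividend_less_times_div[of "2 ^ k" n] by (simp_all add: algebra_simps)
    have "L \<le> N" unfolding N_def using k(2) by (simp add: less_eq_div_iff_mult_less_eq)
    moreover have "N < 2 * L" unfolding N_def using k(3) by (simp add: div_less_iff_less_mult ac_simps)
    ultimately have NL: "N \<in> {L..2*L}" "N + 1 \<in> {L..2*L}" by auto
    let ?P = "2 ^ k :: real"
    have P: "?P \<ge> 1" by simp
    have n0: "real n > 0" 
    proof -
      have "0 < L * 2 ^ k" using L1 by simp
      with k(2) show ?thesis by linarith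
    qed
    have LP: "real L * ?P \<le> real n"
    proof -
      have "real (L * 2 ^ k) \<le> real n" using k(2) by (simp only: of_nat_le_iff)
      then show ?thesis by simp
    qed
    have N2: "real N * ?P \<le> real n" "real n \<le> (real N + 1) * ?P"
    proof -
      have "real (N * 2 ^ k) \<le> real n" using N1(1) by (simp only: of_nat_le_iff)
      then show "real N * ?P \<le> real n" by simp
      have "real n \<le> real ((N + 1) * 2 ^ k)" using N1(2) by (subst of_nat_le_iff) simp
      then show "real n \<le> (real N + 1) * ?P" by (simp add: distrib_right)
    qed
    have Npos: "real N * ?P > 0" using \<open>L \<le> N\<close> L1 by simp
    have up: "f n \<le> f (N * 2 ^ k) + ?P"
    proof -
      have "f n \<le> f (N * 2 ^ k) + real (n - N * 2 ^ k)" using inc[of "N * 2 ^ k" "n - N * 2 ^ k"] N1 by simp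
      then show ?thesis using N2 N1 by (simp add: of_nat_diff algebra_simps)
    qed
    have lo: "f ((N + 1) * 2 ^ k) - ?P \<le> f n"
    proof -
      have "f ((N + 1) * 2 ^ k) \<le> f n + real ((N + 1) * 2 ^ k - n)" using inc[of n "(N + 1) * 2 ^ k - n"] N1 by simp
      then show ?thesis using N2 N1 by (simp add: of_nat_diff algebra_simps)
    qed
    have A: "f (N * 2 ^ k) \<le> (a + e) * (real N * ?P)"
      using K[OF k(1) NL(1)] Npos by (simp add: abs_less_iff field_simps)
    have B: "(a - e) * ((real N + 1) * ?P) \<le> f ((N + 1) * 2 ^ k)"
    proof -
      have "a - e < f ((N + 1) * 2 ^ k) / real ((N + 1) * 2 ^ k)"
        using K[OF k(1) NL(2)] by (simp add: abs_less_iff)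
      moreover have "real ((N + 1) * 2 ^ k) = (real N + 1) * ?P" by (simp add: distrib_right)
      moreover have "(real N + 1) * ?P > 0" by simp
      ultimately show ?thesis by (simp add: less_divide_eq)
    qed
    have "(a + e) * (real N * ?P) - (a + e) * real n = - (a + e) * (real n - real N * ?P)" by (simp add: algebra_simps)
    also have "\<dots> \<le> (\<bar>a\<bar> + e) * (real n - real N * ?P)"
      using N2 e by (intro mult_right_mono) auto
    also have "\<dots> \<le> (\<bar>a\<bar> + e) * ?P" using N2 e by (intro mult_left_mono) (auto simp: algebra_simps)
    finally have U: "f n \<le> (a + e) * real n + (\<bar>a\<bar> + e + 1) * ?P" using up A by (simp add: algebra_simps)
    have "(a - e) * real n - (a - e) * ((real N + 1) * ?P) = - (a - e) * ((real N + 1) * ?P - real n)" by (simp add: algebra_simps)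
    also have "\<dots> \<le> (\<bar>a\<bar> + e) * ((real N + 1) * ?P - real n)"
      using N2 e by (intro mult_right_mono) auto
    also have "\<dots> \<le> (\<bar>a\<bar> + e) * ?P" using N2 e by (intro mult_left_mono) (auto simp: algebra_simps)
    finally have W: "(a - e) * real n - (\<bar>a\<bar> + e + 1) * ?P \<le> f n" using lo B by (simp add: algebra_simps)
    have "(\<bar>a\<bar> + e + 1) * ?P < e * real n"
    proof -
      have "2 * (\<bar>a\<bar> + e + 1) < real L * r" using L r by (simp add: field_simps)
      then have "(\<bar>a\<bar> + e + 1) * ?P < (real L * e) * ?P" by (intro mult_strict_right_mono) (auto simp: e_def)
      also have "\<dots> = e * (real L * ?P)" by simp
      also have "\<dots> \<le> e * real n" using LP e by (intro mult_left_mono) auto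
      finally show ?thesis .
    qed
    with U W have "f n < (a + r) * real n" "(a - r) * real n < f n" by (auto simp: e_def algebra_simps)
    then show "norm (f n / real n - a) < r" using n0 by (simp add: abs_less_iff field_simps)
  qed
qed

theorem AE_disp_tendsto:
  "AE u in labels. (\<lambda>n. real_of_int (disp (hconf p u) 0 0 n) / real n) \<longlonglongrightarrow> drift p"
proof -
  have "AE u in labels. \<forall>N\<in>{1..}. (\<lambda>k. real_of_int (disp (hconf p u) 0 0 (N * 2 ^ k)) / real (N * 2 ^ k)) \<longlonglongrightarrow> drift p"
    by (intro AE_ball_countable[THEN iffD2] ballI AE_disp_dyadic) auto
  then show ?thesis
  proof (rule AE_mp, intro AE_I2 impI)
    fix u
    assume *: "\<forall>N\<in>{1..}. (\<lambda>k. real_of_int (disp (hconf p u) 0 0 (N * 2 ^ k)) / real (N * 2 ^ k)) \<longlonglongrightarrow> drift p"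
    show "(\<lambda>n. real_of_int (disp (hconf p u) 0 0 n) / real n) \<longlonglongrightarrow> drift p"
    proof (rule tendsto_from_dyadic)
      fix n j
      have "disp (hconf p u) 0 0 (n + j) \<le> disp (hconf p u) 0 0 n + int j"
        using disp_subadd[of "hconf p u" 0 0 n j] disp_le by (smt (verit))
      then show "real_of_int (disp (hconf p u) 0 0 (n + j)) \<le> real_of_int (disp (hconf p u) 0 0 n) + real j"
        by linarith
    qed (use * in auto)
  qed
qed

section \<open>Sign of the speed and percolation\<close>

definition theta :: "real \<Rightarrow> real" where
  "theta p = \<P>(u in labels. \<forall>n. evo (hconf p u) 0 {0} n \<noteq> {})"

lemma measurable_evo_empty [measurable]: "Measurable.pred configs (\<lambda>\<omega>. evo \<omega> m S j = {})"
proof -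
  have *: "evo \<omega> m S j = {} \<longleftrightarrow> (\<forall>y. \<not> y \<in> evo \<omega> m S j)" for \<omega> by blast
  show ?thesis unfolding * by measurable
qed

lemma evo_origin_bounds:
  assumes "y \<in> evo \<omega> 0 {0} n"
  shows "y \<le> disp \<omega> 0 0 n" "- disp (reflect_conf \<omega>) 0 0 n \<le> y"
proof -
  have "evo \<omega> 0 {0} n \<subseteq> evo \<omega> 0 (half_line 0 0) n"
    by (rule evo_mono_set) (simp add: half_line_def)
  then show "y \<le> disp \<omega> 0 0 n" using assms evo_le_disp by fastforce
  show "- disp (reflect_conf \<omega>) 0 0 n \<le> y"
    using evo_ge_reflect_disp[OF assms, of 0] by (simp add: disp_reflect_conf)
qed

lemma AE_reflect:
  assumes [measurable]: "Measurable.pred configs P" and "AE u in labels. P (conf Q u)"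
  shows "AE u in labels. P (reflect_conf (conf Q u))"
proof -
  have "\<P>(u in labels. P (conf Q u)) = 1"
    using assms(2) by (subst labels.prob_Collect_eq_1) auto
  then have "\<P>(u in labels. P (reflect_conf (conf Q u))) = 1"
    by (simp add: prob_reflect_conf)
  then show ?thesis by (subst (asm) labels.prob_Collect_eq_1) auto
qed

text \<open>With a negative drift the right edge is eventually negative and, by reflection, the left
  edge eventually positive. A site of the cluster would have to lie to the left of the one and to
  the right of the other.\<close>

lemma drift_nonneg_if_theta_pos:
  assumes "theta p > 0"
  shows "drift p \<ge> 0"
proof (rule ccontr)
  assume "\<not> drift p \<ge> 0"
  then have neg: "drift p < 0" by simp
  let ?P = "\<lambda>\<omega>. \<exists>N. \<forall>n\<ge>N. disp \<omega> 0 0 n < 0"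
  have 1: "AE u in labels. ?P (hconf p u)"
    using AE_disp_tendsto[of p]
  proof (rule AE_mp, intro AE_I2 impI)
    fix u assume "(\<lambda>n. real_of_int (disp (hconf p u) 0 0 n) / real n) \<longlonglongrightarrow> drift p"
    from order_tendstoD(2)[OF this neg]
    obtain N where N: "\<And>n. n \<ge> N \<Longrightarrow> real_of_int (disp (hconf p u) 0 0 n) / real n < 0"
      unfolding eventually_sequentially by blast
    have "disp (hconf p u) 0 0 n < 0" if "n \<ge> N" for n
      using N[OF that] by (simp add: divide_less_0_iff)
    then show "?P (hconf p u)" by blast
  qed
  have 2: "AE u in labels. ?P (reflect_conf (hconf p u))"
    by (rule AE_reflect[OF _ 1]) measurable
  have "AE u in labels. \<not> (\<forall>n. evo (hconf p u) 0 {0} n \<noteq> {})"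
    using 1 2
  proof eventually_elim
    case (elim u)
    then obtain N N' where N: "\<And>n. n \<ge> N \<Longrightarrow> disp (hconf p u) 0 0 n < 0"
      "\<And>n. n \<ge> N' \<Longrightarrow> disp (reflect_conf (hconf p u)) 0 0 n < 0" by blast
    have "evo (hconf p u) 0 {0} (max N N') = {}"
    proof (rule equals0I)
      fix y assume "y \<in> evo (hconf p u) 0 {0} (max N N')"
      from evo_origin_bounds[OF this] N(1)[of "max N N'"] N(2)[of "max N N'"] show False by simp
    qed
    then show ?case by blast
  qed
  then have "theta p = 0"
    unfolding theta_def by (subst labels.prob_Collect_eq_0) auto
  with assms show False by simp
qed

text \<open>Planarity: a path reaching the right edge from far left and a path reaching the left edge from
  far right have to cross, and where they do they are reached from the middle interval.\<close>

lemma evo_interval_nonempty: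
  assumes pA: "\<And>y. y \<in> A \<Longrightarrow> even (y + m)" and pB: "\<And>y. y \<in> B \<Longrightarrow> even (y + m)"
    and AB: "\<And>y l. y \<in> A \<Longrightarrow> l \<in> B \<Longrightarrow> l \<le> y \<Longrightarrow> y \<in> A \<inter> B"
    and BA: "\<And>y r. y \<in> B \<Longrightarrow> r \<in> A \<Longrightarrow> y \<le> r \<Longrightarrow> y \<in> A \<inter> B"
    and cross: "\<And>j. \<exists>l\<in>evo \<omega> m B j. \<exists>r\<in>evo \<omega> m A j. l \<le> r"
  shows "evo \<omega> m (A \<inter> B) j \<noteq> {}"
proof -
  have inv: "(\<forall>y\<in>evo \<omega> m A j. (\<exists>l\<in>evo \<omega> m B j. l \<le> y) \<longrightarrow> y \<in> evo \<omega> m (A \<inter> B) j) \<and>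
      (\<forall>y\<in>evo \<omega> m B j. (\<exists>r\<in>evo \<omega> m A j. y \<le> r) \<longrightarrow> y \<in> evo \<omega> m (A \<inter> B) j)" for j
  proof (induction j)
    case 0
    show ?case unfolding evo.simps
    proof (intro conjI ballI impI)
      fix y assume "y \<in> A" "\<exists>l\<in>B. l \<le> y"
      then show "y \<in> A \<inter> B" by (auto dest: AB)
    next
      fix y assume "y \<in> B" "\<exists>r\<in>A. y \<le> r"
      then show "y \<in> A \<inter> B" by (auto dest: BA)
    qed
  next
    case (Suc j)
    let ?A = "evo \<omega> m A j" and ?B = "evo \<omega> m B j" and ?C = "evo \<omega> m (A \<inter> B) j"
    have parA: "even (y + m + int j)" if "y \<in> ?A" for y by (rule evo_parity[OF that pA])
    have parB: "even (y + m + int j)" if "y \<in> ?B" for y by (rule evo_parity[OF that pB])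
    have C: "y \<in> evo \<omega> m (A \<inter> B) (Suc j)"
      if "z \<in> ?C" "((z, m + int j), (y, m + int j + 1)) \<in> edges" "\<omega> ((z, m + int j), (y, m + int j + 1))" for y z
      using that by (auto simp: step_def)
    obtain l' r' where lr: "l' \<in> ?B" "r' \<in> ?A" "l' \<le> r'" using cross[of j] by blast
    show ?case
    proof (intro conjI ballI impI)
      fix y assume "y \<in> evo \<omega> m A (Suc j)" and "\<exists>l\<in>evo \<omega> m B (Suc j). l \<le> y"
      then obtain l z w where l: "l \<le> y"
        and z: "z \<in> ?A" "((z, m + int j), (y, m + int j + 1)) \<in> edges" "\<omega> ((z, m + int j), (y, m + int j + 1))"
        and w: "w \<in> ?B" "((w, m + int j), (l, m + int j + 1)) \<in> edges" "\<omega> ((w, m + int j), (l, m + int j + 1))"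
        by (auto simp: step_def)
      show "y \<in> evo \<omega> m (A \<inter> B) (Suc j)"
      proof (cases "\<exists>b\<in>?B. b \<le> z")
        case True
        with Suc z have "z \<in> ?C" by blast
        then show ?thesis using z C by blast
      next
        case False
        then have gt: "b \<ge> z + 2" if "b \<in> ?B" for b
        proof -
          have "b > z" using False that by force
          moreover have "even (b - z)" using parA[OF z(1)] parB[OF that] by presburger
          ultimately show ?thesis by presburger
        qed
        have zy: "y = z + 1 \<or> y = z - 1" and wl: "l = w + 1 \<or> l = w - 1"
          using z(2) w(2) by (auto simp: edges_iff)
        with gt[OF w(1)] l have *: "l = y" "w = z + 2" by auto
        have "w \<le> r'" using gt[OF lr(1)] lr(3) * by simp
        with Suc w(1) lr(2) have "w \<in> ?C" by blast
        then show ?thesis using w C * by blast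
      qed
    next
      fix y assume "y \<in> evo \<omega> m B (Suc j)" and "\<exists>r\<in>evo \<omega> m A (Suc j). y \<le> r"
      then obtain r z w where r: "y \<le> r"
        and z: "z \<in> ?B" "((z, m + int j), (y, m + int j + 1)) \<in> edges" "\<omega> ((z, m + int j), (y, m + int j + 1))"
        and w: "w \<in> ?A" "((w, m + int j), (r, m + int j + 1)) \<in> edges" "\<omega> ((w, m + int j), (r, m + int j + 1))"
        by (auto simp: step_def)
      show "y \<in> evo \<omega> m (A \<inter> B) (Suc j)"
      proof (cases "\<exists>b\<in>?A. z \<le> b")
        case True
        with Suc z have "z \<in> ?C" by blast
        then show ?thesis using z C by blast
      next
        case False
        then have gt: "b + 2 \<le> z" if "b \<in> ?A" for b
        proof -
          have "b < z" using False that by force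
          moreover have "even (z - b)" using parB[OF z(1)] parA[OF that] by presburger
          ultimately show ?thesis by presburger
        qed
        have zy: "y = z + 1 \<or> y = z - 1" and wl: "r = w + 1 \<or> r = w - 1"
          using z(2) w(2) by (auto simp: edges_iff)
        with gt[OF w(1)] r have *: "r = y" "w + 2 = z" by auto
        have "l' \<le> w" using gt[OF lr(2)] lr(3) * by simp
        with Suc w(1) lr(1) have "w \<in> ?C" by blast
        then show ?thesis using w C * by blast
      qed
    qed
  qed
  show ?thesis using inv[of j] cross[of j] by blast
qed

text \<open>On level \<open>N\<close> the process from the left half-line is still contained in the
  half-line up to \<open>int N\<close>, and symmetrically on the other side. Restarted there from
  both full half-lines, the right edge is never below 0 and the left edge never above 0, so
  planarity keeps the finite overlap alive.\<close>

lemma survival_from_interval: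
  assumes N: "N \<ge> 1" and r: "\<And>n. n \<ge> N \<Longrightarrow> disp \<omega> 0 0 n > 0"
    and l: "\<And>n. n \<ge> N \<Longrightarrow> disp (reflect_conf \<omega>) 0 0 n > 0"
  obtains x where "x \<in> {-int N..int N}" "even (x + int N)" "\<And>j. evo \<omega> (int N) {x} j \<noteq> {}"
proof -
  define A where "A = half_line (int N) (int N)"
  define B where "B = {y. - int N \<le> y \<and> even (y + int N)}"
  have B: "B = uminus ` half_line (int N) (int N)"
  proof (rule set_eqI)
    fix y show "y \<in> B \<longleftrightarrow> y \<in> uminus ` half_line (int N) (int N)"
      by (auto simp: B_def half_line_def image_iff intro!: exI[of _ "- y"])
  qed
  have cross: "\<exists>l\<in>evo \<omega> (int N) B j. \<exists>r\<in>evo \<omega> (int N) A j. l \<le> r" for j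
  proof -
    have attain: "\<exists>r\<in>evo w (int N) A j. 0 \<le> r" if "disp w 0 0 (N + j) > 0" for w
    proof -
      have "disp w 0 0 (N + j) \<in> evo w 0 (half_line 0 0) (N + j)"
        using disp_attained[of "N + j" w 0 0] that by simp
      also have "\<dots> \<subseteq> evo w (int N) A j"
        unfolding evo_add A_def using evo_half_line_subset[of w 0 0 N] disp_le[of w 0 0 N]
        by (auto intro!: evo_mono_set simp: half_line_def)
      finally show ?thesis using that by (intro bexI) auto
    qed
    obtain r' where r': "r' \<in> evo \<omega> (int N) A j" "0 \<le> r'" using attain[OF r] by auto
    obtain s where s: "s \<in> evo (reflect_conf \<omega>) (int N) A j" "0 \<le> s" using attain[OF l] by auto
    have "evo (reflect_conf \<omega>) (int N) A j = evo (\<omega> \<circ> reflect_edge) (int N) A j"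
      by (rule evo_cong) (simp add: reflect_conf_def)
    also have "\<dots> = uminus ` evo \<omega> (int N) B j"
      using evo_reflect[of \<omega> "int N" B j] by (simp add: B A_def image_image)
    finally have "- s \<in> evo \<omega> (int N) B j" using s(1) by auto
    with r' s show ?thesis by (intro bexI[of _ "- s"] bexI[of _ r']) auto
  qed
  have C: "evo \<omega> (int N) (A \<inter> B) j \<noteq> {}" for j
    by (rule evo_interval_nonempty[OF _ _ _ _ cross]) (auto simp: A_def B_def half_line_def)
  have fin: "finite (A \<inter> B)"
    by (rule finite_subset[of _ "{-int N..int N}"]) (auto simp: A_def B_def half_line_def)
  \<comment> \<open>If every site of the finite overlap died out, the sum of their extinction times
    would be a common one.\<close>
  have "\<exists>x\<in>A \<inter> B. \<forall>j. evo \<omega> (int N) {x} j \<noteq> {}"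
  proof (rule ccontr)
    assume "\<not> ?thesis"
    then obtain d where d: "\<And>x. x \<in> A \<inter> B \<Longrightarrow> evo \<omega> (int N) {x} (d x) = {}" by metis
    have "evo \<omega> (int N) {x} (\<Sum>x\<in>A \<inter> B. d x) = {}" if "x \<in> A \<inter> B" for x
      using evo_empty_mono[OF d[OF that]] member_le_sum[OF that, of d] fin by auto
    then have "evo \<omega> (int N) (A \<inter> B) (\<Sum>x\<in>A \<inter> B. d x) = {}"
      using evo_singleton[of _ \<omega> "int N" "A \<inter> B"] by blast
    with C show False by blast
  qed
  then obtain x where "x \<in> A \<inter> B" "\<forall>j. evo \<omega> (int N) {x} j \<noteq> {}" by blast
  then show thesis by (intro that[of x]) (auto simp: A_def B_def half_line_def)
qed

lemma prob_survival_shift: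
  assumes "even (x + int N)"
  shows "\<P>(u in labels. \<forall>j. evo (hconf p u) (int N) {x} j \<noteq> {}) = theta p"
proof -
  have "evo \<omega> (int N) {x} j = (\<lambda>y. y + x) ` evo (shift_conf x (int N) \<omega>) 0 {0} j" for \<omega> j
    using evo_shift[OF assms, of "shift_conf x (int N) \<omega>" \<omega> 0 "{0}" j] by (simp add: shift_conf_def)
  then have "\<P>(u in labels. \<forall>j. evo (hconf p u) (int N) {x} j \<noteq> {}) =
     \<P>(u in labels. \<forall>j. evo (shift_conf x (int N) (hconf p u)) 0 {0} j \<noteq> {})" by simp
  also have "\<dots> = theta p"
    using prob_shift_conf[OF assms, of "\<lambda>\<omega>. \<forall>j. evo \<omega> 0 {0} j \<noteq> {}" "\<lambda>_. p"] by (simp add: theta_def)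
  finally show ?thesis .
qed

text \<open>If \<open>theta p\<close> vanished, almost surely none of the countably many lattice
  sites would survive, contrary to \<open>survival_from_interval\<close>.\<close>

lemma theta_pos_if_drift_pos:
  assumes "drift p > 0"
  shows "theta p > 0"
proof (rule ccontr)
  assume "\<not> theta p > 0"
  then have theta0: "theta p = 0" 
    using measure_nonneg[of labels "{u \<in> space labels. \<forall>n. evo (hconf p u) 0 {0} n \<noteq> {}}"]
    by (simp add: theta_def)
  let ?P = "\<lambda>\<omega>. \<exists>N. \<forall>n\<ge>N. disp \<omega> 0 0 n > 0"
  have 1: "AE u in labels. ?P (hconf p u)"
    using AE_disp_tendsto[of p]
  proof (rule AE_mp, intro AE_I2 impI)
    fix u assume "(\<lambda>n. real_of_int (disp (hconf p u) 0 0 n) / real n) \<longlonglongrightarrow> drift p"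
    from order_tendstoD(1)[OF this assms]
    obtain N where N: "\<And>n. n \<ge> N \<Longrightarrow> real_of_int (disp (hconf p u) 0 0 n) / real n > 0"
      unfolding eventually_sequentially by blast
    have "disp (hconf p u) 0 0 n > 0" if "n \<ge> N" for n
      using N[OF that] by (simp add: zero_less_divide_iff)
    then show "?P (hconf p u)" by blast
  qed
  have 2: "AE u in labels. ?P (reflect_conf (hconf p u))"
    by (rule AE_reflect[OF _ 1]) measurable
  have 3: "AE u in labels. \<forall>z\<in>{(x, N). even (x + int N)}. \<not> (\<forall>j. evo (hconf p u) (int (snd z)) {fst z} j \<noteq> {})"
  proof (intro AE_ball_countable[THEN iffD2] ballI)
    fix z assume "z \<in> {(x, N). even (x + int N)}"
    then have "\<P>(u in labels. \<forall>j. evo (hconf p u) (int (snd z)) {fst z} j \<noteq> {}) = 0"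
      using prob_survival_shift theta0 by auto
    then show "AE u in labels. \<not> (\<forall>j. evo (hconf p u) (int (snd z)) {fst z} j \<noteq> {})"
      by (subst (asm) labels.prob_Collect_eq_0) auto
  qed auto
  have "AE u in labels. False"
    using 1 2 3
  proof eventually_elim
    case (elim u)
    then obtain N N' where N: "\<And>n. n \<ge> N \<Longrightarrow> disp (hconf p u) 0 0 n > 0"
      "\<And>n. n \<ge> N' \<Longrightarrow> disp (reflect_conf (hconf p u)) 0 0 n > 0" by blast
    obtain x where x: "even (x + int (N + N' + 1))" "\<And>j. evo (hconf p u) (int (N + N' + 1)) {x} j \<noteq> {}"
      by (rule survival_from_interval[of "N + N' + 1" "hconf p u"]) (use N in auto)
    then have "(x, N + N' + 1) \<in> {(x, N). even (x + int N)}" by simp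
    from bspec[OF elim(3) this] x(2) show False by simp
  qed
  then show False by simp
qed

section \<open>Strict increase of the drift where it is nonnegative\<close>

lemma depends_on_conj: "depends_on I P \<Longrightarrow> depends_on J R \<Longrightarrow> depends_on (I \<union> J) (\<lambda>u. P u \<and> R u)"
  unfolding depends_on_def by (metis UnCI)

lemma expectation_indep:
  fixes X :: "(edge \<Rightarrow> real) \<Rightarrow> int" and f :: "int \<Rightarrow> real"
  assumes P: "depends_on I P" and [measurable]: "Measurable.pred labels P"
    and X: "\<And>A. depends_on J (\<lambda>u. X u \<in> A)" and [measurable]: "X \<in> measurable labels (count_space UNIV)"
    and XR: "\<And>u. X u \<in> {-int n..int n}"
    and IJ: "I \<inter> J = {}" "I \<subseteq> edges" "J \<subseteq> edges"
  shows "integrable labels (\<lambda>u. indicator {u \<in> space labels. P u} u * f (X u))" (is ?int)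
    and "labels.expectation (\<lambda>u. indicator {u \<in> space labels. P u} u * f (X u)) =
      \<P>(u in labels. P u) * labels.expectation (\<lambda>u. f (X u))" (is ?eq)
proof -
  let ?I = "\<lambda>c. indicator {u \<in> space labels. P u \<and> X u = c} :: (edge \<Rightarrow> real) \<Rightarrow> real"
  have eq: "indicator {u \<in> space labels. P u} u * f (X u) = (\<Sum>c\<in>{-int n..int n}. ?I c u * f c)"
    if "u \<in> space labels" for u
  proof -
    have "(\<Sum>c\<in>{-int n..int n}. ?I c u * f c) =
        (\<Sum>c\<in>{-int n..int n}. if c = X u then indicator {u \<in> space labels. P u} u * f c else 0)"
      using that by (intro sum.cong) (auto simp: indicator_def)
    also have "\<dots> = indicator {u \<in> space labels. P u} u * f (X u)" using XR[of u] by simp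
    finally show ?thesis ..
  qed
  have int: "integrable labels (\<lambda>u. ?I c u * f c)" for c
    by (intro integrable_mult_left integrable_real_indicator) (auto simp: labels.emeasure_eq_measure)
  have "integrable labels (\<lambda>u. \<Sum>c\<in>{-int n..int n}. ?I c u * f c)"
    using int by (rule Bochner_Integration.integrable_sum)
  then show ?int by (subst Bochner_Integration.integrable_cong[OF refl eq]) auto
  have "labels.expectation (\<lambda>u. indicator {u \<in> space labels. P u} u * f (X u)) =
      labels.expectation (\<lambda>u. \<Sum>c\<in>{-int n..int n}. ?I c u * f c)"
    by (rule Bochner_Integration.integral_cong[OF refl eq])
  also have "\<dots> = (\<Sum>c\<in>{-int n..int n}. labels.expectation (\<lambda>u. ?I c u * f c))"
    using int by (rule Bochner_Integration.integral_sum)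
  also have "\<dots> = (\<Sum>c\<in>{-int n..int n}. \<P>(u in labels. P u) * (\<P>(u in labels. X u = c) * f c))"
  proof (intro sum.cong refl)
    fix c
    have "labels.expectation (\<lambda>u. ?I c u * f c) = \<P>(u in labels. P u \<and> X u = c) * f c"
      by (auto simp: Int_def conj_commute intro!: arg_cong[where f="measure labels"])
    also have "\<P>(u in labels. P u \<and> X u = c) = \<P>(u in labels. P u) * \<P>(u in labels. X u = c)"
      using prob_indep[OF P _ X[of "{c}"] _ IJ] by simp
    finally show "labels.expectation (\<lambda>u. ?I c u * f c) = \<P>(u in labels. P u) * (\<P>(u in labels. X u = c) * f c)"
      by simp
  qed
  also have "\<dots> = \<P>(u in labels. P u) * labels.expectation (\<lambda>u. f (X u))"
    by (subst expectation_finite_range(2)[of X n]) (use XR in \<open>auto simp: sum_distrib_left\<close>)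
  finally show ?eq .
qed

text \<open>The displacement is \<open>- int n\<close> when clipped and at most \<open>int n\<close>
  otherwise, so with P the probability in question its mean is at most 2 n P - n.\<close>

lemma prob_disp_unclipped:
  assumes "mean_disp p n \<ge> 0" "n \<ge> 1"
  shows "\<P>(u in labels. - int n < disp (hconf p u) 0 0 n) \<ge> 1 / 2"
proof -
  let ?E = "{u \<in> space labels. - int n < disp (hconf p u) 0 0 n}"
  have "mean_disp p n \<le> labels.expectation (\<lambda>u. 2 * real n * indicator ?E u - real n)"
    unfolding mean_disp_def
  proof (rule integral_mono)
    fix u assume "u \<in> space labels"
    then show "real_of_int (disp (hconf p u) 0 0 n) \<le> 2 * real n * indicator ?E u - real n"
      using disp_le[of "hconf p u" 0 0 n] by (auto simp: indicator_def)
  qed (auto intro!: expectation_disp simp: labels.emeasure_eq_measure)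
  also have "\<dots> = 2 * real n * measure labels ?E - real n"
    by (subst Bochner_Integration.integral_diff) (auto simp: labels.emeasure_eq_measure labels.prob_space Int_def conj_commute)
  finally have "real n \<le> 2 * real n * measure labels ?E" using assms by linarith
  then have "1 \<le> 2 * measure labels ?E"
    using assms mult_le_cancel_left_pos[of "real n" 1 "2 * measure labels ?E"] by (simp add: mult_ac)
  then show ?thesis by simp
qed

text \<open>Raising the levels from \<open>p\<close> to \<open>p'\<close> one at a time writes the
  difference of the two mean displacements as a telescoping sum over the levels.\<close>

definition hybrid :: "real \<Rightarrow> real \<Rightarrow> nat \<Rightarrow> int \<Rightarrow> real" where
  "hybrid p p' k n = (if n < int k then p' else p)"

lemma hybrid_mono: "p \<le> p' \<Longrightarrow> i \<le> j \<Longrightarrow> hybrid p p' i n \<le> hybrid p p' j n"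
  by (auto simp: hybrid_def)

lemma disp_conf_mono: "(\<And>n. Q n \<le> Q' n) \<Longrightarrow> disp (conf Q u) m x j \<le> disp (conf Q' u) m x j"
proof (rule disp_mono)
  fix e assume "\<And>n. Q n \<le> Q' n" "e \<in> edges" "conf Q u e"
  then show "conf Q' u e" by (auto simp: conf_def intro: order_trans)
qed

text \<open>Raising the density of level \<open>j\<close> can open the edge leading to the right from the right edge
  of the process; this moves the half-line containing the occupied sites by two.\<close>

lemma hybrid_gain:
  fixes u :: "edge \<Rightarrow> real" and p p' :: real and j k n :: nat
  defines "c \<equiv> disp (hconf p' u) 0 0 j"
  assumes pp: "p \<le> p'" and n: "n = j + 1 + k" and c: "- int j < c"
    and e: "p < u ((c, int j), (c + 1, int j + 1))" "u ((c, int j), (c + 1, int j + 1)) \<le> p'"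
  shows "disp (conf (hybrid p p' (Suc j)) u) 0 0 n - disp (conf (hybrid p p' j) u) 0 0 n
    \<ge> 2 * (if - int k < disp (hconf p u) (int j + 1) (c + 1) k then 1 else 0)
      + disp (hconf p u) (int j + 1) (c + 1) k - disp (hconf p u) (int j + 1) (c - 1) k"
proof -
  let ?w = "conf (hybrid p p' j) u" and ?w' = "conf (hybrid p p' (Suc j)) u"
  let ?H = "half_line 0 0" and ?m = "int j + 1"
  let ?\<rho>1 = "disp (hconf p u) ?m (c + 1) k" and ?\<rho>0 = "disp (hconf p u) ?m (c - 1) k"
  have mono: "disp ?w 0 0 n \<le> disp ?w' 0 0 n"
    using pp by (intro disp_conf_mono hybrid_mono) auto
  have A: "evo ?w 0 ?H j = evo (hconf p' u) 0 ?H j" "evo ?w' 0 ?H j = evo (hconf p' u) 0 ?H j"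
    by (auto intro!: evo_cong simp: conf_def hybrid_def)
  have tail: "evo ?w ?m S k = evo (hconf p u) ?m S k" "evo ?w' ?m S k = evo (hconf p u) ?m S k" for S
    by (auto intro!: evo_cong simp: conf_def hybrid_def)
  have split: "evo w 0 ?H n = evo w ?m (step w (int j) (evo w 0 ?H j)) k" for w
    using evo_add[of w 0 ?H "Suc j" k] by (simp add: n ac_simps)
  have cA: "c \<in> evo (hconf p' u) 0 ?H j"
    using disp_attained[of j "hconf p' u" 0 0] c by (simp add: c_def)
  have parA: "even (y + int j)" if "y \<in> evo (hconf p' u) 0 ?H j" for y
    using evo_parity[OF that] by (simp add: half_line_def)
  have leA: "y \<le> c" if "y \<in> evo (hconf p' u) 0 ?H j" for y
    using evo_le_disp[OF that] by (simp add: c_def)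
  have edge: "((c, int j), (c + 1, int j + 1)) \<in> edges" using parA[OF cA] by (simp add: edges_iff)
  have W': "c + 1 \<in> step ?w' (int j) (evo ?w' 0 ?H j)"
    unfolding step_def A using cA edge e by (auto simp: conf_def hybrid_def lev_def)
  have W: "step ?w (int j) (evo ?w 0 ?H j) \<subseteq> half_line ?m (c - 1)"
  proof
    fix y assume "y \<in> step ?w (int j) (evo ?w 0 ?H j)"
    then obtain x where x: "x \<in> evo (hconf p' u) 0 ?H j" "((x, int j), (y, int j + 1)) \<in> edges"
      "?w ((x, int j), (y, int j + 1))" by (auto simp: step_def A)
    have "u ((x, int j), (y, int j + 1)) \<le> p" using x(2,3) by (simp add: conf_def hybrid_def lev_def)
    with e(1) have "\<not> (x = c \<and> y = c + 1)" by auto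
    moreover have "y = x + 1 \<or> y = x - 1" using x(2) by (simp add: edges_iff)
    moreover have "even (x + int j)" "x \<le> c" "even (c + int j)" using parA leA x(1) cA by auto
    ultimately have "y \<le> c - 1" "even (y + ?m)" by presburger+
    then show "y \<in> half_line ?m (c - 1)" by (simp add: half_line_def)
  qed
  have low: "disp ?w 0 0 n \<le> c - 1 + ?\<rho>0"
    unfolding disp_le_iff
  proof (intro conjI ballI)
    show "- int n \<le> c - 1 + ?\<rho>0" using c disp_ge[of k "hconf p u" ?m "c - 1"] n by simp
    fix y assume "y \<in> evo ?w 0 ?H n"
    then have "y \<in> evo (hconf p u) ?m (half_line ?m (c - 1)) k"
      unfolding split tail using evo_mono_set[OF W] by blast
    then show "y \<le> 0 + (c - 1 + ?\<rho>0)" using evo_le_disp by fastforce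
  qed
  show ?thesis
  proof (cases "- int k < ?\<rho>1")
    case False
    then have "?\<rho>1 = - int k" using disp_ge[of k "hconf p u" ?m "c + 1"] by simp
    then show ?thesis using mono disp_ge[of k "hconf p u" ?m "c - 1"] by simp
  next
    case True
    have "half_line ?m (c + 1) = insert (c + 1) (half_line ?m (c - 1))"
    proof (rule set_eqI)
      fix y show "y \<in> half_line ?m (c + 1) \<longleftrightarrow> y \<in> insert (c + 1) (half_line ?m (c - 1))"
        using parA[OF cA] unfolding half_line_def by (simp, presburger)
    qed
    then have "evo (hconf p u) ?m (half_line ?m (c + 1)) k =
        evo (hconf p u) ?m {c + 1} k \<union> evo (hconf p u) ?m (half_line ?m (c - 1)) k"
      using evo_Un[of "hconf p u" ?m "{c + 1}" "half_line ?m (c - 1)" k] by simp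
    with disp_attained[OF True]
    consider "c + 1 + ?\<rho>1 \<in> evo (hconf p u) ?m {c + 1} k"
      | "c + 1 + ?\<rho>1 \<in> evo (hconf p u) ?m (half_line ?m (c - 1)) k" by blast
    then show ?thesis
    proof cases
      case 1
      moreover have "evo (hconf p u) ?m {c + 1} k \<subseteq> evo ?w' 0 ?H n"
        unfolding split tail using W' by (intro evo_mono_set) auto
      ultimately have "c + 1 + ?\<rho>1 \<le> 0 + disp ?w' 0 0 n" by (intro evo_le_disp) auto
      with low True show ?thesis by simp
    next
      case 2
      from evo_le_disp[OF this] mono True show ?thesis by simp
    qed
  qed
qed

lemma prob_label_between:
  assumes e: "e \<in> edges" and p: "0 \<le> p" "p \<le> p'" "p' \<le> 1"
  shows "\<P>(u in labels. p < u e \<and> u e \<le> p') = p' - p"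
proof -
  note [measurable] = measurable_label[OF e]
  have "\<P>(u in labels. u e \<le> p') = \<P>(u in labels. u e \<le> p) + \<P>(u in labels. p < u e \<and> u e \<le> p')"
    using p by (subst labels.finite_measure_Union[symmetric]) (auto intro!: arg_cong[where f="measure labels"])
  then show ?thesis using prob_label_le[OF e, of p] prob_label_le[OF e, of p'] p by simp
qed

lemma expectation_disp_shift:
  fixes f :: "int \<Rightarrow> real"
  assumes "even (x + m)"
  shows "labels.expectation (\<lambda>u. f (disp (hconf p u) m x k)) = labels.expectation (\<lambda>u. f (disp (hconf p u) 0 0 k))"
  unfolding expectation_disp(2)[of f] by (simp add: law_shift[OF assms] law_shift[of 0 0])

text \<open>That the label at the right end falls between \<open>p\<close> and \<open>p'\<close> is
  independent of past and future, and the futures from \<open>c + 1\<close> and \<open>c - 1\<close>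
  have the same mean, so only the gain 2 of \<open>hybrid_gain\<close> remains. It comes with the
  factor \<open>p' - p\<close> and with two probabilities of being unclipped, before and after level
  \<open>j\<close>, each at least 1/2.\<close>

lemma mean_hybrid_step:
  assumes p: "0 \<le> p" "p \<le> p'" "p' \<le> 1" and j: "j \<ge> 1" "mean_disp p j \<ge> 0"
    and k: "k \<ge> 1" "mean_disp p k \<ge> 0" and n: "n = j + 1 + k"
  shows "labels.expectation (\<lambda>u. real_of_int (disp (conf (hybrid p p' (Suc j)) u) 0 0 n))
    - labels.expectation (\<lambda>u. real_of_int (disp (conf (hybrid p p' j) u) 0 0 n)) \<ge> (p' - p) / 2"
proof -
  define ed where "ed c = ((c, int j), (c + 1, int j + 1))" for c :: int
  \<comment> \<open>At the clipped value \<open>- int j\<close> the site need not be occupied, so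
    the gain is claimed only above it.\<close>
  define C where "C = {c \<in> {-int j..int j}. - int j < c \<and> even (c + int j)}"
  define G where "G c u \<longleftrightarrow> disp (hconf p' u) 0 0 j = c \<and> p < u (ed c) \<and> u (ed c) \<le> p'" for c and u :: "edge \<Rightarrow> real"
  define r where "r c u = disp (hconf p u) (int j + 1) c k" for c u
  define f where "f x = 2 * (if - int k < x then 1 else 0) + real_of_int x" for x
  let ?ind = "\<lambda>c. indicator {u \<in> space labels. G c u} :: (edge \<Rightarrow> real) \<Rightarrow> real"
  have finC: "finite C" by (rule finite_subset[of _ "{-int j..int j}"]) (auto simp: C_def)
  have ed: "ed c \<in> edges" if "c \<in> C" for c using that by (simp add: ed_def C_def edges_iff)
  have G [measurable]: "Measurable.pred labels (G c)" if "c \<in> C" for c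
  proof -
    note [measurable] = measurable_label[OF ed[OF that]]
    show ?thesis unfolding G_def[abs_def] by measurable
  qed
  have "real_of_int (disp (conf (hybrid p p' (Suc j)) u) 0 0 n) - real_of_int (disp (conf (hybrid p p' j) u) 0 0 n)
      \<ge> (\<Sum>c\<in>C. ?ind c u * f (r (c + 1) u) - ?ind c u * real_of_int (r (c - 1) u))" if u: "u \<in> space labels" for u
  proof -
    define c where "c = disp (hconf p' u) 0 0 j"
    have "(\<Sum>d\<in>C. ?ind d u * f (r (d + 1) u) - ?ind d u * real_of_int (r (d - 1) u)) =
        (\<Sum>d\<in>C. if d = c then ?ind c u * f (r (c + 1) u) - ?ind c u * real_of_int (r (c - 1) u) else 0)"
      by (intro sum.cong refl) (auto simp: G_def c_def)
    also have "\<dots> = (if c \<in> C then ?ind c u * f (r (c + 1) u) - ?ind c u * real_of_int (r (c - 1) u) else 0)"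
      using finC by simp
    also have "\<dots> \<le> real_of_int (disp (conf (hybrid p p' (Suc j)) u) 0 0 n) - real_of_int (disp (conf (hybrid p p' j) u) 0 0 n)"
    proof (cases "c \<in> C \<and> G c u")
      case True
      with hybrid_gain[of p p' n j k u] p n
      have "disp (conf (hybrid p p' (Suc j)) u) 0 0 n - disp (conf (hybrid p p' j) u) 0 0 n
          \<ge> 2 * (if - int k < r (c + 1) u then 1 else 0) + r (c + 1) u - r (c - 1) u"
        by (auto simp: C_def G_def ed_def r_def c_def)
      then have "real_of_int (2 * (if - int k < r (c + 1) u then 1 else 0) + r (c + 1) u - r (c - 1) u) \<le>
          real_of_int (disp (conf (hybrid p p' (Suc j)) u) 0 0 n - disp (conf (hybrid p p' j) u) 0 0 n)"
        by (simp only: of_int_le_iff)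
      with True u show ?thesis by (auto simp: f_def split: if_splits)
    next
      case False
      have "disp (conf (hybrid p p' j) u) 0 0 n \<le> disp (conf (hybrid p p' (Suc j)) u) 0 0 n"
        using p by (intro disp_conf_mono hybrid_mono) auto
      with False show ?thesis by (auto simp: indicator_def)
    qed
    finally show ?thesis .
  qed
  moreover
  have "integrable labels (\<lambda>u. ?ind c u * h (r (c + i) u)) \<and>
      labels.expectation (\<lambda>u. ?ind c u * h (r (c + i) u)) =
      law p' j c * (p' - p) * labels.expectation (\<lambda>u. h (disp (hconf p u) 0 0 k))"
    if c: "c \<in> C" and i: "odd i" for c i and h :: "int \<Rightarrow> real"
  proof -
    let ?I = "{e \<in> edges. 0 \<le> lev e \<and> lev e < 0 + int j}"
    let ?J = "{e \<in> edges. int j + 1 \<le> lev e \<and> lev e < int j + 1 + int k}"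
    have d1: "depends_on ?I (\<lambda>u. disp (hconf p' u) 0 0 j = c)"
      using depends_on_disp[of 0 j "\<lambda>_. p'" 0 "{c}"] by simp
    have d2: "depends_on {ed c} (\<lambda>u. p < u (ed c) \<and> u (ed c) \<le> p')" by (simp add: depends_on_def)
    note [measurable] = measurable_label[OF ed[OF c]]
    have ev: "even (c + i + (int j + 1))" using c i by (simp add: C_def)
    have dG: "depends_on (?I \<union> {ed c}) (G c)"
      using depends_on_conj[OF d1 d2] by (simp add: G_def[abs_def])
    have dr: "depends_on ?J (\<lambda>u. r (c + i) u \<in> A)" for A
      unfolding r_def by (rule depends_on_disp)
    have mr: "r (c + i) \<in> measurable labels (count_space UNIV)" unfolding r_def[abs_def] by measurable
    have rr: "r (c + i) u \<in> {-int k..int k}" for u unfolding r_def by (rule disp_range)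
    have disj: "(?I \<union> {ed c}) \<inter> ?J = {}" by (auto simp: ed_def lev_def)
    note ind = expectation_indep[OF dG G[OF c] dr mr rr disj, where f=h]
    have "\<P>(u in labels. G c u) = law p' j c * (p' - p)"
    proof -
      have "?I \<inter> {ed c} = {}" by (auto simp: ed_def lev_def)
      from prob_indep[OF d1 _ d2 _ this] ed[OF c]
      have "\<P>(u in labels. G c u) = law p' j c * \<P>(u in labels. p < u (ed c) \<and> u (ed c) \<le> p')"
        by (simp add: G_def law_def)
      then show ?thesis using prob_label_between[OF ed[OF c] p] by simp
    qed
    moreover have "labels.expectation (\<lambda>u. h (r (c + i) u)) = labels.expectation (\<lambda>u. h (disp (hconf p u) 0 0 k))"
      unfolding r_def by (rule expectation_disp_shift[OF ev])
    ultimately show ?thesis using ind ed[OF c] by auto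
  qed
  note E = this[where i = 1] this[where i = "-1", where h = real_of_int]
  have "(\<Sum>c\<in>C. law p' j c * (p' - p) * (labels.expectation (\<lambda>u. f (disp (hconf p u) 0 0 k)) - mean_disp p k)) =
      labels.expectation (\<lambda>u. \<Sum>c\<in>C. ?ind c u * f (r (c + 1) u) - ?ind c u * real_of_int (r (c - 1) u))"
    using E by (subst Bochner_Integration.integral_sum)
      (auto simp: mean_disp_def right_diff_distrib intro!: sum.cong Bochner_Integration.integrable_diff)
  moreover have "integrable labels (\<lambda>u. \<Sum>c\<in>C. ?ind c u * f (r (c + 1) u) - ?ind c u * real_of_int (r (c - 1) u))"
    using E by (intro Bochner_Integration.integrable_sum Bochner_Integration.integrable_diff) auto
  ultimately have "(\<Sum>c\<in>C. law p' j c * (p' - p) * (labels.expectation (\<lambda>u. f (disp (hconf p u) 0 0 k)) - mean_disp p k)) \<le>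
     labels.expectation (\<lambda>u. real_of_int (disp (conf (hybrid p p' (Suc j)) u) 0 0 n) - real_of_int (disp (conf (hybrid p p' j) u) 0 0 n))"
    by (simp only:) (intro integral_mono Bochner_Integration.integrable_diff expectation_disp, auto)
  also have "\<dots> = labels.expectation (\<lambda>u. real_of_int (disp (conf (hybrid p p' (Suc j)) u) 0 0 n))
    - labels.expectation (\<lambda>u. real_of_int (disp (conf (hybrid p p' j) u) 0 0 n))"
    by (intro Bochner_Integration.integral_diff expectation_disp)
  also have "labels.expectation (\<lambda>u. f (disp (hconf p u) 0 0 k)) - mean_disp p k =
     2 * \<P>(u in labels. - int k < disp (hconf p u) 0 0 k)"
  proof -
    have "labels.expectation (\<lambda>u. f (disp (hconf p u) 0 0 k)) =
      labels.expectation (\<lambda>u. 2 * indicator {u \<in> space labels. - int k < disp (hconf p u) 0 0 k} u + real_of_int (disp (hconf p u) 0 0 k))"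
      by (intro Bochner_Integration.integral_cong) (auto simp: f_def)
    also have "\<dots> = 2 * \<P>(u in labels. - int k < disp (hconf p u) 0 0 k) + mean_disp p k"
      unfolding mean_disp_def
      by (subst Bochner_Integration.integral_add)
         (auto intro!: expectation_disp simp: labels.emeasure_eq_measure Int_def conj_commute)
    finally show ?thesis by simp
  qed
  finally have step: "(\<Sum>c\<in>C. law p' j c) * ((p' - p) * (2 * \<P>(u in labels. - int k < disp (hconf p u) 0 0 k))) \<le>
      labels.expectation (\<lambda>u. real_of_int (disp (conf (hybrid p p' (Suc j)) u) 0 0 n))
    - labels.expectation (\<lambda>u. real_of_int (disp (conf (hybrid p p' j) u) 0 0 n))"
    by (simp add: sum_distrib_right mult.assoc)
  moreover have "(\<Sum>c\<in>C. law p' j c) \<ge> 1 / 2"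
  proof -
    have "(\<Sum>c\<in>C. law p' j c) = (\<Sum>c\<in>{-int j..int j}. law p' j c * (if - int j < c then 1 else 0))"
      unfolding C_def using law_odd[of _ j p'] by (subst sum.inter_filter) (auto intro!: sum.cong)
    also have "\<dots> = labels.expectation (\<lambda>u. if - int j < disp (hconf p' u) 0 0 j then 1 else 0)"
      unfolding law_def by (rule expectation_disp(2)[symmetric])
    also have "\<dots> = labels.expectation (indicator {u \<in> space labels. - int j < disp (hconf p' u) 0 0 j})"
      by (intro Bochner_Integration.integral_cong) auto
    also have "\<dots> = \<P>(u in labels. - int j < disp (hconf p' u) 0 0 j)"
      by (simp add: Int_def conj_commute)
    also have "\<dots> \<ge> 1 / 2"
      using mean_disp_mono[OF p(2), of j] j by (intro prob_disp_unclipped) auto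
    finally show ?thesis .
  qed
  moreover have P: "\<P>(u in labels. - int k < disp (hconf p u) 0 0 k) \<ge> 1 / 2"
    by (rule prob_disp_unclipped[OF k(2,1)])
  ultimately have "1 / 2 * ((p' - p) * (2 * (1 / 2))) \<le>
      (\<Sum>c\<in>C. law p' j c) * ((p' - p) * (2 * \<P>(u in labels. - int k < disp (hconf p u) 0 0 k)))"
    using p by (intro mult_mono mult_left_mono P) (auto simp: sum_nonneg law_nonneg)
  with step show ?thesis by simp
qed

text \<open>Each of the \<open>n - 2\<close> inner levels contributes at least
  \<open>(p' - p) / 2\<close>, so the total gain is linear in \<open>n\<close> and survives division
  by \<open>n\<close>.\<close>

lemma drift_pos_if_larger:
  assumes p: "0 \<le> p" "p < p'" "p' \<le> 1" and d: "drift p \<ge> 0"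
  shows "drift p' > 0"
proof -
  have m: "mean_disp p n \<ge> 0" if "n \<ge> 1" for n
    using drift_le[OF that, of p] d that by (smt (verit) divide_neg_pos of_nat_0_less_iff less_le_trans zero_less_one)
  have "mean_disp p' n \<ge> (real n - 2) * ((p' - p) / 2)" if n: "n \<ge> 2" for n
  proof -
    define X where "X j = labels.expectation (\<lambda>u. real_of_int (disp (conf (hybrid p p' j) u) 0 0 n))" for j
    have "disp (conf (hybrid p p' 0) u) 0 0 n = disp (hconf p u) 0 0 n" for u
      by (rule disp_cong) (auto simp: conf_def hybrid_def)
    then have X0: "X 0 = mean_disp p n" by (simp add: X_def mean_disp_def)
    have "disp (conf (hybrid p p' n) u) 0 0 n = disp (hconf p' u) 0 0 n" for u
      by (rule disp_cong) (auto simp: conf_def hybrid_def)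
    then have Xn: "X n = mean_disp p' n" by (simp add: X_def mean_disp_def)
    \<comment> \<open>The lowest and the highest level are left out because
      \<open>mean_hybrid_step\<close> needs at least one level on either side; monotonicity gives 0
      for them.\<close>
    have X: "X (Suc j) - X j \<ge> (if j \<in> {1..<n - 1} then (p' - p) / 2 else 0)" for j
    proof (cases "j \<in> {1..<n - 1}")
      case True
      then have "1 \<le> j" "1 \<le> n - 1 - j" "n = j + 1 + (n - 1 - j)" by auto
      with mean_hybrid_step[of p p' j "n - 1 - j" n] m p True show ?thesis by (simp add: X_def)
    next
      case False
      have "X j \<le> X (Suc j)"
        unfolding X_def
      proof (intro integral_mono expectation_disp)
        fix u
        have "disp (conf (hybrid p p' j) u) 0 0 n \<le> disp (conf (hybrid p p' (Suc j)) u) 0 0 n"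
          using p by (intro disp_conf_mono hybrid_mono) auto
        then show "real_of_int (disp (conf (hybrid p p' j) u) 0 0 n) \<le> real_of_int (disp (conf (hybrid p p' (Suc j)) u) 0 0 n)"
          by simp
      qed
      then show ?thesis unfolding if_not_P[OF False] by simp
    qed
    have "(real n - 2) * ((p' - p) / 2) = (\<Sum>j<n. if j \<in> {1..<n - 1} then (p' - p) / 2 else 0)"
    proof -
      have "(\<Sum>j<n. if j \<in> {1..<n - 1} then (p' - p) / 2 else 0) = (\<Sum>j\<in>{..<n} \<inter> {1..<n - 1}. (p' - p) / 2)"
        by (rule sum.inter_restrict[symmetric]) simp
      also have "{..<n} \<inter> {1..<n - 1} = {1..<n - 1}" by auto
      finally show ?thesis using n by (simp add: of_nat_diff)
    qed
    also have "\<dots> \<le> (\<Sum>j<n. X (Suc j) - X j)" by (rule sum_mono) (rule X)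
    also have "\<dots> = mean_disp p' n - mean_disp p n" by (simp add: sum_lessThan_telescope X0 Xn)
    finally show ?thesis using m[of n] n by simp
  qed
  then have "(real n - 2) * ((p' - p) / 2) / real n \<le> mean_disp p' n / real n" if "n \<ge> 2" for n
    using that by (intro divide_right_mono) auto
  moreover have "(real n - 2) * ((p' - p) / 2) / real n = (1 - 2 / real n) * ((p' - p) / 2)" if "n \<ge> 2" for n
    using that by (simp add: field_simps)
  ultimately have "(1 - 2 / real n) * ((p' - p) / 2) \<le> mean_disp p' n / real n" if "n \<ge> 2" for n
    using that by metis
  then have "\<forall>\<^sub>F n in sequentially. (1 - 2 / real n) * ((p' - p) / 2) \<le> mean_disp p' n / real n"
    by (auto simp: eventually_sequentially)
  moreover have "(\<lambda>n. (1 - 2 / real n) * ((p' - p) / 2)) \<longlonglongrightarrow> (1 - 0) * ((p' - p) / 2)"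
    by (intro tendsto_intros tendsto_divide_0[OF tendsto_const] filterlim_at_top_imp_at_infinity filterlim_real_sequentially)
  ultimately have "(1 - 0) * ((p' - p) / 2) \<le> drift p'"
    by (intro tendsto_le[OF sequentially_bot mean_disp_tendsto])
  with p show ?thesis by simp
qed

section \<open>The sign of the drift on the two sides of \<open>p_c\<close>\<close>

lemma homogeneous_percolation_eq:
  "0 \<le> p \<Longrightarrow> p \<le> 1 \<Longrightarrow> homogeneous_percolation p = distr labels configs (hconf p)"
  unfolding homogeneous_percolation_def conf_def[abs_def] by (rule percolation_eq_distr) simp

lemma prob_infinite_cluster:
  assumes "0 \<le> p" "p \<le> 1"
  shows "\<P>(\<omega> in homogeneous_percolation p. infinite (cluster \<omega>)) = theta p"
proof -
  have *: "infinite (cluster \<omega>) \<longleftrightarrow> (\<forall>n. evo \<omega> 0 {0} n \<noteq> {})" for \<omega> :: "edge \<Rightarrow> bool"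
    by (rule infinite_cluster_iff)
  show ?thesis
    unfolding * homogeneous_percolation_eq[OF assms] theta_def
    by (subst measure_distr)
       (auto intro!: arg_cong[where f="measure labels"] dest: measurable_space[OF measurable_conf])
qed

lemma p_c_eq: "p_c = Inf {p \<in> {0..1}. theta p > 0}"
  unfolding p_c_def by (rule arg_cong[where f=Inf]) (auto simp: prob_infinite_cluster)

lemma drift_nonneg_above_p_c:
  assumes "p_c < p" and "p0 \<in> {0..1}" "theta p0 > 0"
  shows "drift p \<ge> 0"
proof -
  have "\<exists>q\<in>{p \<in> {0..1}. theta p > 0}. q < p"
    using assms by (subst (asm) p_c_eq, subst (asm) cInf_less_iff) auto
  then obtain q where "theta q > 0" "q < p" by auto
  then show ?thesis
    using drift_nonneg_if_theta_pos[of q] drift_mono[of q p] by simp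
qed

lemma p_c_le: "p \<in> {0..1} \<Longrightarrow> theta p > 0 \<Longrightarrow> p_c \<le> p"
  unfolding p_c_eq by (rule cInf_lower) auto

text \<open>A drift that is nonnegative at \<open>p\<close> would be positive midway between
  \<open>p\<close> and \<open>p_c\<close>, and there would be percolation below
  \<open>p_c\<close>.\<close>

lemma drift_neg_below_p_c:
  assumes "0 \<le> p" "p < p_c" "p_c \<le> 1"
  shows "drift p < 0"
proof (rule ccontr)
  assume "\<not> drift p < 0"
  define q where "q = (p + p_c) / 2"
  have q: "p < q" "q < p_c" "q \<le> 1" using assms by (auto simp: q_def)
  have "drift q > 0" using \<open>\<not> drift p < 0\<close> assms q by (intro drift_pos_if_larger[of p q]) auto
  then have "theta q > 0" by (rule theta_pos_if_drift_pos)
  then have "p_c \<le> q" using assms q by (intro p_c_le) auto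
  with q show False by simp
qed

lemma mean_disp_1:
  assumes "0 \<le> p" "p \<le> 1"
  shows "mean_disp p 1 = 2 * p - 1"
proof -
  let ?e = "((0, 0), (1, 1)) :: edge"
  have e: "?e \<in> edges" by (simp add: edges_iff)
  note [measurable] = measurable_label[OF e]
  have "real_of_int (disp (hconf p u) 0 0 1) = 2 * indicator {u \<in> space labels. u ?e \<le> p} u - 1"
    if u: "u \<in> space labels" for u
  proof (cases "u ?e \<le> p")
    case True
    then have "1 \<in> evo (hconf p u) 0 (half_line 0 0) 1"
      using e by (auto simp: step_def half_line_def conf_def lev_def intro!: bexI[of _ 0])
    from evo_le_disp[OF this] disp_le[of "hconf p u" 0 0 1] True u show ?thesis by simp
  next
    case False
    have "disp (hconf p u) 0 0 1 \<le> -1"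
      unfolding disp_le_iff
    proof (intro conjI ballI)
      fix y assume "y \<in> evo (hconf p u) 0 (half_line 0 0) 1"
      then obtain x where x: "x \<le> 0" "even x" "((x, 0), (y, 1)) \<in> edges" "hconf p u ((x, 0), (y, 1))"
        by (auto simp: step_def half_line_def)
      then have "\<not> (x = 0 \<and> y = 1)" using False by (auto simp: conf_def)
      moreover have "y = x + 1 \<or> y = x - 1" using x(3) by (simp add: edges_iff)
      ultimately show "y \<le> 0 + - 1" using x(1,2) by presburger
    qed simp
    with disp_ge[of 1 "hconf p u" 0 0] False show ?thesis by simp
  qed
  then have "mean_disp p 1 = labels.expectation (\<lambda>u. 2 * indicator {u \<in> space labels. u ?e \<le> p} u - 1)"
    unfolding mean_disp_def by (intro Bochner_Integration.integral_cong) auto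
  also have "\<dots> = 2 * \<P>(u in labels. u ?e \<le> p) - 1"
    by (subst Bochner_Integration.integral_diff)
       (auto simp: labels.emeasure_eq_measure labels.prob_space Int_def conj_commute)
  finally show ?thesis using prob_label_le[OF e, of p] assms by simp
qed

text \<open>Percolation forces a nonnegative drift, which is at most the mean
  \<open>2 * p - 1\<close> of one truncated step. The resulting positivity of \<open>p_c\<close>
  makes the height \<open>y_c\<close> exist.\<close>

lemma p_c_ge_half:
  assumes "p0 \<in> {0..1}" "theta p0 > 0"
  shows "p_c \<ge> 1 / 2"
  unfolding p_c_eq
proof (rule cInf_greatest)
  fix p assume "p \<in> {p \<in> {0..1}. theta p > 0}"
  then show "1 / 2 \<le> p"
    using drift_nonneg_if_theta_pos[of p] drift_le[of 1 p] mean_disp_1[of p] by simp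
qed (use assms in auto)

section \<open>Percolation at high density\<close>

text \<open>The square in the denominator makes the convolution square of the weight comparable to the weight
  itself, and the factor \<open>24\<close> makes the ratio a third.\<close>

definition wgt :: "int \<Rightarrow> real" where
  "wgt n = (1 / 4) ^ nat n / (24 * (real_of_int n)\<^sup>2)"

lemma wgt_nonneg [simp]: "0 \<le> wgt n"
  by (simp add: wgt_def)

lemma sum_inverse_squares: "n \<ge> 1 \<Longrightarrow> (\<Sum>j\<in>{1..n}. 1 / (real j)\<^sup>2) \<le> 2 - 1 / real n"
proof (induction n rule: nat_induct_at_least)
  case (Suc n)
  have "1 / (real (Suc n))\<^sup>2 \<le> 1 / (real n * real (Suc n))"
    using Suc by (intro divide_left_mono) (auto simp: power2_eq_square)
  also have "\<dots> = 1 / real n - 1 / real (Suc n)" using Suc by (simp add: field_simps)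
  finally show ?case using Suc by simp
qed simp

text \<open>The powers multiply to \<open>(1 / 4) ^ n\<close>. With x + y = n one has 1/(xy) = (1/x
  + 1/y)/n, so 1/(xy)^2 is at most 2(1/x^2 + 1/y^2)/n^2, and each sum of inverse squares is at most
  2. This gives 8/(576 n^2), and 8/576 is a third of 1/24.\<close>

lemma wgt_conv_nat:
  assumes n: "n \<ge> 2"
  shows "(\<Sum>j\<in>{1..n - 1}. wgt (int j) * wgt (int (n - j))) \<le> wgt (int n) / 3"
proof -
  have "wgt (int j) * wgt (int (n - j)) \<le> wgt (int n) * (1 / 12 * (1 / (real j)\<^sup>2 + 1 / (real (n - j))\<^sup>2))"
    if j: "j \<in> {1..n - 1}" for j
  proof -
    define x y where "x = real j" and "y = real (n - j)"
    have xy: "x > 0" "y > 0" "x + y = real n" using j n by (auto simp: x_def y_def)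
    have "(1 / x + 1 / y)\<^sup>2 \<le> 2 * (1 / x\<^sup>2 + 1 / y\<^sup>2)"
      using sum_squares_bound[of "1 / x" "1 / y"] by (simp add: power2_sum power_divide)
    also have "1 / x + 1 / y = (x + y) / (x * y)" using xy by (simp add: field_simps)
    finally have "(x + y)\<^sup>2 / (x * y)\<^sup>2 \<le> 2 * (1 / x\<^sup>2 + 1 / y\<^sup>2)" by (simp add: power_divide)
    then have *: "1 / (x * y)\<^sup>2 \<le> 2 * (1 / x\<^sup>2 + 1 / y\<^sup>2) / (x + y)\<^sup>2"
      using xy by (simp add: pos_le_divide_eq)
    have "(1 / 4 :: real) ^ j * (1 / 4) ^ (n - j) = (1 / 4) ^ n"
    proof -
      have "j + (n - j) = n" using j n by auto
      then show ?thesis by (simp only: power_add[symmetric])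
    qed
    then have "wgt (int j) * wgt (int (n - j)) = (1 / 4) ^ n / 576 * (1 / (x * y)\<^sup>2)"
      unfolding wgt_def x_def y_def by (simp add: power_mult_distrib del: power_one_over)
    also have "\<dots> \<le> (1 / 4) ^ n / 576 * (2 * (1 / x\<^sup>2 + 1 / y\<^sup>2) / (x + y)\<^sup>2)"
      using * by (intro mult_left_mono) auto
    also have "\<dots> = wgt (int n) * (1 / 12 * (1 / x\<^sup>2 + 1 / y\<^sup>2))"
    proof -
      have "z / 576 * (2 * S / N) = z / (24 * N) * (1 / 12 * S)" for z S N :: real by simp
      then show ?thesis unfolding xy(3) wgt_def of_int_of_nat_eq nat_int .
    qed
    finally show ?thesis by (simp add: x_def y_def)
  qed
  then have "(\<Sum>j\<in>{1..n - 1}. wgt (int j) * wgt (int (n - j))) \<le>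
      (\<Sum>j\<in>{1..n - 1}. wgt (int n) * (1 / 12 * (1 / (real j)\<^sup>2 + 1 / (real (n - j))\<^sup>2)))"
    by (rule sum_mono)
  also have "\<dots> = wgt (int n) * (1 / 12 * ((\<Sum>j\<in>{1..n - 1}. 1 / (real j)\<^sup>2) + (\<Sum>j\<in>{1..n - 1}. 1 / (real (n - j))\<^sup>2)))"
    by (simp only: sum_distrib_left sum.distrib distrib_left)
  also have "(\<Sum>j\<in>{1..n - 1}. 1 / (real (n - j))\<^sup>2) = (\<Sum>j\<in>{1..n - 1}. 1 / (real j)\<^sup>2)"
    by (rule sum.reindex_bij_witness[of _ "\<lambda>j. n - j" "\<lambda>j. n - j"]) auto
  also have "wgt (int n) * (1 / 12 * ((\<Sum>j\<in>{1..n - 1}. 1 / (real j)\<^sup>2) + (\<Sum>j\<in>{1..n - 1}. 1 / (real j)\<^sup>2))) \<le>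
      wgt (int n) * (1 / 12 * (2 + 2))"
  proof (intro mult_left_mono add_mono)
    have "(\<Sum>j\<in>{1..n - 1}. 1 / (real j)\<^sup>2) \<le> 2 - 1 / real (n - 1)" using n by (intro sum_inverse_squares) auto
    then show "(\<Sum>j\<in>{1..n - 1}. 1 / (real j)\<^sup>2) \<le> 2" "(\<Sum>j\<in>{1..n - 1}. 1 / (real j)\<^sup>2) \<le> 2"
      using n by (auto intro: order_trans)
  qed auto
  finally show ?thesis by simp
qed

lemma wgt_conv:
  assumes "c \<le> b"
  shows "(\<Sum>y\<in>{c..b}. wgt (y - c + 1) * wgt (b - y + 1)) \<le> wgt (b - c + 2) / 3"
proof -
  define n where "n = nat (b - c + 2)"
  have n: "n \<ge> 2" "int n = b - c + 2" using assms by (auto simp: n_def)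
  have "(\<Sum>y\<in>{c..b}. wgt (y - c + 1) * wgt (b - y + 1)) = (\<Sum>j\<in>{1..n - 1}. wgt (int j) * wgt (int (n - j)))"
    by (rule sum.reindex_bij_witness[of _ "\<lambda>j. c + int j - 1" "\<lambda>y. nat (y - c + 1)"]) (use n in \<open>auto simp: algebra_simps\<close>)
  with wgt_conv_nat[OF n(1)] n show ?thesis by simp
qed

lemma wgt_Suc:
  assumes m: "m \<ge> 1"
  shows "wgt (m + 1) \<le> wgt m / 4"
proof -
  have "nat (m + 1) = Suc (nat m)" using m by simp
  then have "wgt (m + 1) = (1 / 4) ^ nat m / 4 / (24 * (real_of_int (m + 1))\<^sup>2)" by (simp add: wgt_def)
  also have "\<dots> \<le> (1 / 4) ^ nat m / 4 / (24 * (real_of_int m)\<^sup>2)"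
    using m by (intro divide_left_mono mult_left_mono power_mono mult_pos_pos) auto
  finally show ?thesis by (simp add: wgt_def)
qed

text \<open>Here \<open>c\<close> is the first and \<open>d\<close> the last element so far of the
  block being built. The next element \<open>b\<close> either closes it, paying its weight, and
  opens a new block, or extends it.\<close>

primrec part_sum_from :: "int \<Rightarrow> int \<Rightarrow> int list \<Rightarrow> real" where
  "part_sum_from c d [] = wgt (d - c + 1)"
| "part_sum_from c d (b # bs) = wgt (d - c + 1) * part_sum_from b b bs + part_sum_from c b bs"

text \<open>The sum over all partitions of a strictly increasing list into blocks of consecutive elements of
  the product of the weights of the spans of the blocks.\<close>

definition part_sum :: "int list \<Rightarrow> real" where
  "part_sum l = (case l of [] \<Rightarrow> 1 | b # bs \<Rightarrow> part_sum_from b b bs)"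

lemma part_sum_simps [simp]: "part_sum [] = 1" "part_sum (b # bs) = part_sum_from b b bs"
  by (simp_all add: part_sum_def)

text \<open>Sum over the element \<open>b\<close> at which a block begun earlier ends:
  \<open>g b\<close> is the weight of that block, and \<open>part_sum\<close> takes care of the
  elements after it.\<close>

primrec tail_sum :: "(int \<Rightarrow> real) \<Rightarrow> int list \<Rightarrow> real" where
  "tail_sum g [] = 0"
| "tail_sum g (b # bs) = g b * part_sum bs + tail_sum g bs"

lemma part_sum_from_eq: "part_sum_from c d bs = wgt (d - c + 1) * part_sum bs + tail_sum (\<lambda>b. wgt (b - c + 1)) bs"
  by (induction bs arbitrary: d) (simp_all add: algebra_simps)

lemma part_sum_eq: "part_sum (b # bs) = tail_sum (\<lambda>y. wgt (y - b + 1)) (b # bs)"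
  using part_sum_from_eq[of b b bs] by simp

lemma part_sum_from_nonneg [simp]: "0 \<le> part_sum_from c d l"
  by (induction l arbitrary: c d) auto

lemma part_sum_nonneg [simp]: "0 \<le> part_sum l"
  by (simp add: part_sum_def split: list.split)

lemma tail_sum_mono: "(\<And>y. y \<in> set l \<Longrightarrow> g y \<le> h y) \<Longrightarrow> tail_sum g l \<le> tail_sum h l"
  by (induction l) (auto intro!: add_mono mult_right_mono)

lemma tail_sum_nonneg: "(\<And>y. 0 \<le> g y) \<Longrightarrow> 0 \<le> tail_sum g l"
  by (induction l) auto

lemma tail_sum_add: "tail_sum (\<lambda>y. g y + h y) l = tail_sum g l + tail_sum h l"
  by (induction l) (auto simp: algebra_simps)

lemma tail_sum_cmult: "tail_sum (\<lambda>y. k * g y) l = k * tail_sum g l"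
  by (induction l) (auto simp: algebra_simps)

text \<open>Bounds the mean, over the random children of the list, of the partition sums whose first
  block starts at \<open>c\<close> and ends at one of these children. The terms of a parent
  \<open>a\<close> belong to a block ending at the child \<open>a\<close> or at the child
  \<open>a + 1\<close>; the factor 3 bounds what follows after the child \<open>a\<close>.\<close>

primrec tail_bound :: "int \<Rightarrow> int list \<Rightarrow> real" where
  "tail_bound c [] = 0"
| "tail_bound c (a # as) = wgt (a - c + 1) * tail_sum (\<lambda>b. 3 * wgt (b - a + 1)) (a # as) + wgt (a - c + 2) * part_sum as + tail_bound c as"

lemma tail_bound_nonneg [simp]: "0 \<le> tail_bound c l"
  by (induction l) (auto simp: tail_sum_nonneg)

text \<open>Collecting the terms by the end \<open>b\<close> of the second block gives a convolution
  of weights. The sum over the list elements is enlarged to all integers from \<open>x\<close> on,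
  and \<open>x\<close> moves along in the induction.\<close>

lemma tail_bound_le_aux:
  assumes "sorted_wrt (<) as" "\<And>a. a \<in> set as \<Longrightarrow> x \<le> a" "c \<le> x"
  shows "tail_bound c as \<le> tail_sum (\<lambda>b. wgt (b - c + 2) + (\<Sum>y\<in>{x..b}. wgt (y - c + 1) * (3 * wgt (b - y + 1)))) as"
  using assms
proof (induction as arbitrary: x)
  case (Cons a as)
  have ca: "c \<le> a + 1" using Cons.prems(2)[of a] Cons.prems(3) by simp
  define S where "S z b = (\<Sum>y\<in>{z..b}. wgt (y - c + 1) * (3 * wgt (b - y + 1)))" for z b :: int
  have S_nonneg: "0 \<le> S z b" for z b by (auto simp: S_def intro!: sum_nonneg)
  have Smono: "S a b \<le> S x b" for b
    unfolding S_def using Cons.prems(2)[of a] by (intro sum_mono2) auto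
  have Sa: "S a b = wgt (a - c + 1) * (3 * wgt (b - a + 1)) + S (a + 1) b" if "a \<le> b" for b
  proof -
    have "{a..b} = insert a {a + 1..b}" using that by auto
    then show ?thesis by (simp add: S_def)
  qed
  have "tail_bound c as \<le> tail_sum (\<lambda>b. wgt (b - c + 2) + S (a + 1) b) as"
    unfolding S_def using Cons.prems(1) ca by (intro Cons.IH) auto
  then have "tail_bound c (a # as) \<le> wgt (a - c + 1) * tail_sum (\<lambda>b. 3 * wgt (b - a + 1)) (a # as) + wgt (a - c + 2) * part_sum as
      + tail_sum (\<lambda>b. wgt (b - c + 2) + S (a + 1) b) as" by simp
  also have "\<dots> = (wgt (a - c + 1) * (3 * wgt 1) + wgt (a - c + 2)) * part_sum as
      + tail_sum (\<lambda>b. wgt (a - c + 1) * (3 * wgt (b - a + 1)) + (wgt (b - c + 2) + S (a + 1) b)) as"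
    by (simp only: tail_sum_add tail_sum_cmult tail_sum.simps) (simp add: tail_sum_add tail_sum_cmult algebra_simps)
  also have "\<dots> \<le> (wgt (a - c + 2) + S x a) * part_sum as + tail_sum (\<lambda>b. wgt (b - c + 2) + S x b) as"
  proof (rule add_mono[OF mult_right_mono[OF _ part_sum_nonneg] tail_sum_mono])
    have "S (a + 1) a = 0" by (simp add: S_def)
    then show "wgt (a - c + 1) * (3 * wgt 1) + wgt (a - c + 2) \<le> wgt (a - c + 2) + S x a"
      using Smono[of a] Sa[of a] by simp
    fix b assume "b \<in> set as"
    then have "a \<le> b" using Cons.prems(1) by auto
    then show "wgt (a - c + 1) * (3 * wgt (b - a + 1)) + (wgt (b - c + 2) + S (a + 1) b) \<le> wgt (b - c + 2) + S x b"
      using Smono[of b] Sa[of b] by simp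
  qed
  finally show ?case by (simp add: S_def)
qed simp

text \<open>The factor 1/3 in \<open>wgt_conv\<close> cancels the factor 3 in
  \<open>tail_bound\<close>, so the convolution costs just one more copy of
  \<open>wgt (b - c + 2)\<close>.\<close>

lemma tail_bound_le:
  assumes "sorted_wrt (<) as" "\<And>a. a \<in> set as \<Longrightarrow> c \<le> a"
  shows "tail_bound c as \<le> tail_sum (\<lambda>b. 2 * wgt (b - c + 2)) as"
proof -
  have "tail_bound c as \<le> tail_sum (\<lambda>b. wgt (b - c + 2) + (\<Sum>y\<in>{c..b}. wgt (y - c + 1) * (3 * wgt (b - y + 1)))) as"
    using assms by (intro tail_bound_le_aux) auto
  also have "\<dots> \<le> tail_sum (\<lambda>b. 2 * wgt (b - c + 2)) as"
  proof (rule tail_sum_mono)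
    fix b assume "b \<in> set as"
    then have "(\<Sum>y\<in>{c..b}. wgt (y - c + 1) * wgt (b - y + 1)) \<le> wgt (b - c + 2) / 3"
      using assms by (intro wgt_conv) auto
    moreover have "(\<Sum>y\<in>{c..b}. wgt (y - c + 1) * (3 * wgt (b - y + 1))) = 3 * (\<Sum>y\<in>{c..b}. wgt (y - c + 1) * wgt (b - y + 1))"
      by (simp add: sum_distrib_left algebra_simps)
    ultimately show "wgt (b - c + 2) + (\<Sum>y\<in>{c..b}. wgt (y - c + 1) * (3 * wgt (b - y + 1))) \<le> 2 * wgt (b - c + 2)"
      by simp
  qed
  finally show ?thesis .
qed

text \<open>One step of the process started from the list, scanned from left to right, in coordinates where the
  children of \<open>a\<close> are \<open>a\<close> and \<open>a + 1\<close>; \<open>d\<close> is the last occupied child so far.\<close>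

fun scan :: "real \<Rightarrow> int \<Rightarrow> int list \<Rightarrow> (int list \<Rightarrow> real) \<Rightarrow> real" where
  "scan q d [] f = f []"
| "scan q d (a # as) f = (if a = d then q * scan q d as f + (1 - q) * scan q (a + 1) as (\<lambda>l. f ((a + 1) # l))
     else q * (q * scan q d as f + (1 - q) * scan q (a + 1) as (\<lambda>l. f ((a + 1) # l)))
       + (1 - q) * (q * scan q a as (\<lambda>l. f (a # l)) + (1 - q) * scan q (a + 1) as (\<lambda>l. f (a # (a + 1) # l))))"

lemma scan_lin: "scan q d as (\<lambda>l. k * f l + g l) = k * scan q d as f + scan q d as g"
proof (induction q d as f arbitrary: g rule: scan.induct)
  case (2 q d a as f)
  show ?case
    using 2(1)[of g] 2(2)[of "\<lambda>l. g ((a + 1) # l)"] 2(3)[of g] 2(4)[of "\<lambda>l. g ((a + 1) # l)"]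
      2(5)[of "\<lambda>l. g (a # l)"] 2(6)[of "\<lambda>l. g (a # (a + 1) # l)"]
    by (cases "a = d") (simp_all add: algebra_simps)
qed simp

text \<open>The scan produces only strictly increasing lists to the right of \<open>d\<close>, so
  the functions are compared on those alone.\<close>

lemma scan_mono:
  assumes "0 \<le> q" "q \<le> 1" "sorted_wrt (<) as" "\<And>a. a \<in> set as \<Longrightarrow> d \<le> a"
    and "\<And>l. sorted_wrt (<) l \<Longrightarrow> (\<And>x. x \<in> set l \<Longrightarrow> d < x) \<Longrightarrow> f l \<le> g l"
  shows "scan q d as f \<le> scan q d as g"
  using assms
proof (induction as arbitrary: d f g)
  case (Cons a as)
  have as: "sorted_wrt (<) as" "\<And>x. x \<in> set as \<Longrightarrow> a + 1 \<le> x" using Cons.prems(3) by auto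
  have da: "d \<le> a" using Cons.prems(4) by simp
  have 1: "scan q d as f \<le> scan q d as g"
    using Cons.prems as da by (intro Cons.IH) auto
  have 2: "scan q (a + 1) as (\<lambda>l. f ((a + 1) # l)) \<le> scan q (a + 1) as (\<lambda>l. g ((a + 1) # l))"
    using Cons.prems(1,2) as da by (intro Cons.IH Cons.prems(5)) fastforce+
  show ?case
  proof (cases "a = d")
    case True
    then show ?thesis using 1 2 Cons.prems(1,2) by (auto intro!: add_mono mult_left_mono)
  next
    case False
    then have da: "d < a" using da by simp
    have 3: "scan q a as (\<lambda>l. f (a # l)) \<le> scan q a as (\<lambda>l. g (a # l))"
      using Cons.prems(1,2) as da by (intro Cons.IH Cons.prems(5)) force+
    have 4: "scan q (a + 1) as (\<lambda>l. f (a # (a + 1) # l)) \<le> scan q (a + 1) as (\<lambda>l. g (a # (a + 1) # l))"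
      using Cons.prems(1,2) as da by (intro Cons.IH Cons.prems(5)) force+
    show ?thesis using 1 2 3 4 Cons.prems(1,2) False by (auto intro!: add_mono mult_left_mono)
  qed
next
  case Nil
  then show ?case using Nil.prems(5)[of "[]"] by simp
qed

lemma scan_part_sum_from: "scan q e as (\<lambda>l. part_sum_from c d (b # l)) = wgt (d - c + 1) * scan q e as (part_sum_from b b) + scan q e as (part_sum_from c b)"
  using scan_lin[of q e as "wgt (d - c + 1)" "part_sum_from b b" "part_sum_from c b"] by simp

lemma wgt_1: "wgt 1 = 1 / 96" and wgt_2: "wgt 2 = 1 / 1536"
  by (simp_all add: wgt_def power2_eq_square)

text \<open>The three terms stand for no occupied child of \<open>a\<close>, only the right one, and
  the left one. Lengthening a span by one divides its weight by at least 4, so the last term takes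
  at most half of \<open>part_sum (a # as)\<close>. The other half contains
  \<open>part_sum as\<close> with coefficient 1/192, which exceeds the coefficients 1/2500 and
  1/4800 of the first two terms together.\<close>

lemma part_sum_step:
  assumes as: "sorted_wrt (<) (a # as)" and q: "0 \<le> q" "q \<le> 1 / 50"
  shows "q * q * part_sum as + q * (1 - q) * (wgt 1 * part_sum as + tail_bound (a + 1) as) + (1 - q) * tail_bound a (a # as) \<le> part_sum (a # as)"
proof -
  have "tail_bound (a + 1) as \<le> tail_sum (\<lambda>b. 2 * wgt (b - (a + 1) + 2)) as"
    using as by (intro tail_bound_le) force+
  also have "\<dots> = 2 * tail_sum (\<lambda>b. wgt (b - a + 1)) as"
    by (simp add: tail_sum_cmult algebra_simps)
  finally have B1: "tail_bound (a + 1) as \<le> 2 * tail_sum (\<lambda>b. wgt (b - a + 1)) as" .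
  have "tail_bound a (a # as) \<le> tail_sum (\<lambda>b. 2 * wgt (b - a + 2)) (a # as)"
    using as by (intro tail_bound_le) force+
  also have "\<dots> \<le> tail_sum (\<lambda>b. 1 / 2 * wgt (b - a + 1)) (a # as)"
  proof (rule tail_sum_mono)
    fix b assume "b \<in> set (a # as)"
    then have "a \<le> b" using as by auto
    then have "wgt (b - a + 1 + 1) \<le> wgt (b - a + 1) / 4" by (intro wgt_Suc) simp
    then show "2 * wgt (b - a + 2) \<le> 1 / 2 * wgt (b - a + 1)" by (simp add: algebra_simps)
  qed
  also have "\<dots> = 1 / 2 * part_sum (a # as)" by (simp only: tail_sum_cmult part_sum_eq)
  finally have B2: "tail_bound a (a # as) \<le> 1 / 2 * part_sum (a # as)" .
  define T where "T = tail_sum (\<lambda>b. wgt (b - a + 1)) as"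
  have T: "0 \<le> T" by (simp add: T_def tail_sum_nonneg)
  have F: "part_sum (a # as) = wgt 1 * part_sum as + T" by (simp add: part_sum_from_eq T_def)
  have "q * q * part_sum as + q * (1 - q) * (wgt 1 * part_sum as + tail_bound (a + 1) as) + (1 - q) * tail_bound a (a # as) \<le>
     (1 / 50 * (1 / 50)) * part_sum as + (1 / 50 * 1) * (wgt 1 * part_sum as + 2 * T) + 1 * (1 / 2 * part_sum (a # as))"
    using q B1 B2 T by (intro add_mono mult_mono mult_left_mono mult_right_mono) (auto simp: T_def[symmetric] simp del: tail_bound.simps)
  also have "\<dots> \<le> part_sum (a # as)"
    unfolding F wgt_1 by (simp add: algebra_simps) (use T part_sum_nonneg[of as] in linarith)
  finally show ?thesis .
qed

text \<open>Two situations go through one induction: the last occupied child \<open>d\<close> lies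
  to the left of all remaining parents, or it coincides with the left child of the next parent.
  \<open>IH'\<close> merges them for the recursive calls.\<close>

lemma scan_part_sum_from_le:
  assumes q: "0 \<le> q" "q \<le> 1 / 50"
  shows "sorted_wrt (<) as \<Longrightarrow>
    (c \<le> d \<longrightarrow> (\<forall>a\<in>set as. d < a) \<longrightarrow> scan q d as (part_sum_from c d) \<le> wgt (d - c + 1) * part_sum as + tail_bound c as) \<and>
    (as \<noteq> [] \<longrightarrow> c \<le> hd as \<longrightarrow> scan q (hd as) as (part_sum_from c (hd as)) \<le> tail_bound c as)"
proof (induction as arbitrary: c d)
  case (Cons a as)
  have as: "sorted_wrt (<) as" "\<And>x. x \<in> set as \<Longrightarrow> a < x" using Cons.prems by auto
  note IH = Cons.IH[OF as(1)]
  have IH': "scan q d as (part_sum_from c d) \<le> wgt (d - c + 1) * part_sum as + tail_bound c as" if "c \<le> d" "\<forall>x\<in>set as. d \<le> x" for c d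
  proof (cases "as \<noteq> [] \<and> hd as = d")
    case True
    then have "scan q d as (part_sum_from c d) \<le> tail_bound c as" using IH[of c] that by auto
    moreover have "0 \<le> wgt (d - c + 1) * part_sum as" by simp
    ultimately show ?thesis by linarith
  next
    case False
    have "\<forall>x\<in>set as. d < x"
    proof
      fix x assume x: "x \<in> set as"
      then obtain y ys where "as = y # ys" by (cases as) auto
      with x as(1) that(2) False show "d < x" by force
    qed
    then show ?thesis using IH[of c d] that by auto
  qed
  have II: "scan q a (a # as) (part_sum_from c a) \<le> tail_bound c (a # as)" if c: "c \<le> a" for c
  proof -
    let ?w = "wgt (a - c + 1)"
    have 1: "scan q a as (part_sum_from c a) \<le> ?w * part_sum as + tail_bound c as" using IH'[OF c] as(2) by force
    have 2: "scan q (a + 1) as (part_sum_from (a + 1) (a + 1)) \<le> wgt 1 * part_sum as + tail_bound (a + 1) as"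
      using IH'[of "a + 1" "a + 1"] as(2) by force
    have 3: "scan q (a + 1) as (part_sum_from c (a + 1)) \<le> wgt (a - c + 2) * part_sum as + tail_bound c as"
      using IH'[of c "a + 1"] as(2) c by (force simp: algebra_simps)
    have "scan q a (a # as) (part_sum_from c a) = q * scan q a as (part_sum_from c a)
        + (1 - q) * (?w * scan q (a + 1) as (part_sum_from (a + 1) (a + 1)) + scan q (a + 1) as (part_sum_from c (a + 1)))"
      by (simp add: scan_part_sum_from del: part_sum_from.simps)
    also have "\<dots> \<le> q * (?w * part_sum as + tail_bound c as)
        + (1 - q) * (?w * (wgt 1 * part_sum as + tail_bound (a + 1) as) + (wgt (a - c + 2) * part_sum as + tail_bound c as))"
      using q 1 2 3 by (intro add_mono mult_left_mono) auto
    also have "\<dots> = ?w * (q * part_sum as + (1 - q) * (wgt 1 * part_sum as + tail_bound (a + 1) as))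
        + (1 - q) * (wgt (a - c + 2) * part_sum as) + tail_bound c as"
      by (simp add: algebra_simps)
    also have "\<dots> \<le> ?w * (q * part_sum as + 1 * (wgt 1 * part_sum as + tail_bound (a + 1) as)) + 1 * (wgt (a - c + 2) * part_sum as) + tail_bound c as"
      using q by (intro add_mono mult_left_mono mult_right_mono) auto
    also have "\<dots> \<le> ?w * tail_sum (\<lambda>b. 3 * wgt (b - a + 1)) (a # as) + wgt (a - c + 2) * part_sum as + tail_bound c as"
    proof -
      have "tail_bound (a + 1) as \<le> tail_sum (\<lambda>b. 2 * wgt (b - (a + 1) + 2)) as"
        using as by (intro tail_bound_le) force+
      also have "\<dots> \<le> tail_sum (\<lambda>b. 3 * wgt (b - a + 1)) as"
        by (rule tail_sum_mono) (simp add: algebra_simps)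
      finally have "tail_bound (a + 1) as \<le> tail_sum (\<lambda>b. 3 * wgt (b - a + 1)) as" .
      moreover have "(q + wgt 1) * part_sum as \<le> 3 * wgt 1 * part_sum as"
        using q by (intro mult_right_mono) (auto simp: wgt_1)
      ultimately have "q * part_sum as + 1 * (wgt 1 * part_sum as + tail_bound (a + 1) as) \<le> tail_sum (\<lambda>b. 3 * wgt (b - a + 1)) (a # as)"
        by (simp add: algebra_simps)
      then show ?thesis by (simp add: mult_left_mono)
    qed
    finally show ?thesis by simp
  qed
  have I: "scan q d (a # as) (part_sum_from c d) \<le> wgt (d - c + 1) * part_sum (a # as) + tail_bound c (a # as)" if c: "c \<le> d" and d: "d < a"
  proof -
    let ?w = "wgt (d - c + 1)"
    have 1: "scan q d as (part_sum_from c d) \<le> ?w * part_sum as + tail_bound c (a # as)"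
    proof -
      have "scan q d as (part_sum_from c d) \<le> ?w * part_sum as + tail_bound c as" using IH'[OF c] as(2) d by force
      moreover have "tail_bound c as \<le> tail_bound c (a # as)" by (simp add: tail_sum_nonneg)
      ultimately show ?thesis by linarith
    qed
    have 2: "scan q (a + 1) as (part_sum_from (a + 1) (a + 1)) \<le> wgt 1 * part_sum as + tail_bound (a + 1) as"
      using IH'[of "a + 1" "a + 1"] as(2) by force
    have 3: "scan q (a + 1) as (part_sum_from c (a + 1)) \<le> tail_bound c (a # as)"
    proof -
      have "scan q (a + 1) as (part_sum_from c (a + 1)) \<le> wgt (a - c + 2) * part_sum as + tail_bound c as"
        using IH'[of c "a + 1"] as(2) c d by (force simp: algebra_simps)
      also have "\<dots> \<le> tail_bound c (a # as)" by (simp add: tail_sum_nonneg)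
      finally show ?thesis .
    qed
    have 4: "scan q a (a # as) (part_sum_from a a) \<le> tail_bound a (a # as)" by (rule II) simp
    have 5: "scan q a (a # as) (part_sum_from c a) \<le> tail_bound c (a # as)" by (rule II) (use c d in simp)
    have "scan q d (a # as) (part_sum_from c d) = q * (q * scan q d as (part_sum_from c d)
         + (1 - q) * (?w * scan q (a + 1) as (part_sum_from (a + 1) (a + 1)) + scan q (a + 1) as (part_sum_from c (a + 1))))
         + (1 - q) * (?w * scan q a (a # as) (part_sum_from a a) + scan q a (a # as) (part_sum_from c a))"
    proof -
      \<comment> \<open>With the left child occupied, going on to the right child is the same as
        scanning \<open>a # as\<close> with last child \<open>a\<close>, so the bound
        \<open>II\<close> applies.\<close>
      have "scan q a (a # as) (\<lambda>l. part_sum_from c d (a # l)) = ?w * scan q a (a # as) (part_sum_from a a) + scan q a (a # as) (part_sum_from c a)"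
        by (rule scan_part_sum_from)
      moreover have "scan q a (a # as) (\<lambda>l. part_sum_from c d (a # l)) =
         q * scan q a as (\<lambda>l. part_sum_from c d (a # l)) + (1 - q) * scan q (a + 1) as (\<lambda>l. part_sum_from c d (a # (a + 1) # l))" by simp
      ultimately show ?thesis using d by (simp add: scan_part_sum_from del: part_sum_from.simps)
    qed
    also have "\<dots> \<le> q * (q * (?w * part_sum as + tail_bound c (a # as))
         + (1 - q) * (?w * (wgt 1 * part_sum as + tail_bound (a + 1) as) + tail_bound c (a # as)))
         + (1 - q) * (?w * tail_bound a (a # as) + tail_bound c (a # as))"
      using q 1 2 3 4 5 by (intro add_mono mult_left_mono) auto
    also have "\<dots> = ?w * (q * q * part_sum as + q * (1 - q) * (wgt 1 * part_sum as + tail_bound (a + 1) as) + (1 - q) * tail_bound a (a # as))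
        + tail_bound c (a # as)"
      by (simp add: algebra_simps)
    also have "\<dots> \<le> ?w * part_sum (a # as) + tail_bound c (a # as)"
      using part_sum_step[OF Cons.prems q] by (intro add_mono mult_left_mono) auto
    finally show ?thesis .
  qed
  show ?case using I II by simp
qed simp

text \<open>The supermartingale property. Either the first parent has no occupied child and
  induction applies, or the first block starts at one of its children and
  \<open>scan_part_sum_from_le\<close> bounds the rest; \<open>part_sum_step\<close> adds up the
  cases.\<close>

lemma scan_part_sum_le:
  assumes q: "0 \<le> q" "q \<le> 1 / 50"
  shows "sorted_wrt (<) as \<Longrightarrow> (\<And>a. a \<in> set as \<Longrightarrow> d < a) \<Longrightarrow> scan q d as part_sum \<le> part_sum as"
proof (induction as)
  case (Cons a as)
  have as: "sorted_wrt (<) as" "\<And>x. x \<in> set as \<Longrightarrow> a < x" using Cons.prems by auto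
  have d: "d < a" using Cons.prems by simp
  have 1: "scan q d as part_sum \<le> part_sum as" using Cons as by auto
  have 2: "scan q (a + 1) as (part_sum_from (a + 1) (a + 1)) \<le> wgt 1 * part_sum as + tail_bound (a + 1) as"
  proof (cases "as \<noteq> [] \<and> hd as = a + 1")
    case True
    then have "scan q (a + 1) as (part_sum_from (a + 1) (a + 1)) \<le> tail_bound (a + 1) as"
      using scan_part_sum_from_le[OF q as(1), of "a + 1"] by auto
    moreover have "0 \<le> wgt 1 * part_sum as" by simp
    ultimately show ?thesis by linarith
  next
    case False
    have "\<forall>x\<in>set as. a + 1 < x"
    proof
      fix x assume x: "x \<in> set as"
      then obtain y ys where "as = y # ys" by (cases as) auto
      with x as False show "a + 1 < x" by force
    qed
    then show ?thesis using scan_part_sum_from_le[OF q as(1), of "a + 1" "a + 1"] by simp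
  qed
  have 3: "scan q a (a # as) (part_sum_from a a) \<le> tail_bound a (a # as)"
    using scan_part_sum_from_le[OF q Cons.prems(1), of a] by simp
  have "scan q d (a # as) part_sum = q * (q * scan q d as part_sum + (1 - q) * scan q (a + 1) as (part_sum_from (a + 1) (a + 1)))
         + (1 - q) * scan q a (a # as) (part_sum_from a a)"
    using d by simp
  also have "\<dots> \<le> q * (q * part_sum as + (1 - q) * (wgt 1 * part_sum as + tail_bound (a + 1) as)) + (1 - q) * tail_bound a (a # as)"
    using q 1 2 3 by (intro add_mono mult_left_mono) auto
  also have "\<dots> = q * q * part_sum as + q * (1 - q) * (wgt 1 * part_sum as + tail_bound (a + 1) as) + (1 - q) * tail_bound a (a # as)"
    by (simp add: algebra_simps)
  also have "\<dots> \<le> part_sum (a # as)" by (rule part_sum_step[OF Cons.prems(1) q])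
  finally show ?case .
qed simp

section \<open>Extinction probabilities bounded by partition sums\<close>

definition dead :: "real \<Rightarrow> nat \<Rightarrow> int set \<Rightarrow> real" where
  "dead p n B = \<P>(u in labels. evo (hconf p u) 0 ((\<lambda>a. 2 * a) ` B) n = {})"

text \<open>Index \<open>a\<close> stands for the site \<open>2 * a\<close> on level 0 and index
  \<open>t\<close> for the site \<open>2 * t - 1\<close> on level 1, so that the children of
  \<open>a\<close> have the indices \<open>a\<close> and \<open>a + 1\<close> used by
  \<open>scan\<close>.\<close>

definition child_edge :: "int \<times> int \<Rightarrow> edge" where
  "child_edge z = ((2 * fst z, 0), (2 * snd z - 1, 1))"

definition open_children :: "real \<Rightarrow> (int \<times> int) list \<Rightarrow> (edge \<Rightarrow> real) \<Rightarrow> int set" where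
  "open_children p E u = {t. \<exists>a. (a, t) \<in> set E \<and> u (child_edge (a, t)) \<le> p}"

text \<open>A stage in revealing the edges of level 0: \<open>B\<close> holds the children known to
  be occupied, \<open>E\<close> the edges still to be revealed.\<close>

definition dead_children :: "real \<Rightarrow> nat \<Rightarrow> (int \<times> int) list \<Rightarrow> int set \<Rightarrow> real" where
  "dead_children p n E B =
     \<P>(u in labels. evo (hconf p u) 1 ((\<lambda>a. 2 * a - 1) ` (B \<union> open_children p E u)) n = {})"

lemma child_edge_in_edges: "t = a \<or> t = a + 1 \<Longrightarrow> child_edge (a, t) \<in> edges"
  by (auto simp: child_edge_def edges_iff)

lemma child_edge_eq_iff: "child_edge z = child_edge z' \<longleftrightarrow> z = z'"
  by (auto simp: child_edge_def prod_eq_iff)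

lemma dead_children_Nil: "dead_children p n [] B = dead p n B"
proof -
  have "evo \<omega> 1 ((\<lambda>a. 2 * a - 1) ` B) n = {} \<longleftrightarrow> evo (shift_conf (- 1) 1 \<omega>) 0 ((\<lambda>a. 2 * a) ` B) n = {}" for \<omega>
    using evo_shift[of "-1" 1 "shift_conf (- 1) 1 \<omega>" \<omega> 0 "(\<lambda>a. 2 * a) ` B" n]
    by (simp add: shift_conf_def image_image)
  then show ?thesis
    using prob_shift_conf[of "-1" 1 "\<lambda>\<omega>. evo \<omega> 0 ((\<lambda>a. 2 * a) ` B) n = {}" "\<lambda>_. p"]
    by (simp add: dead_children_def dead_def open_children_def)
qed

lemma dead_children_event:
  "evo w 1 ((\<lambda>a. 2 * a - 1) ` (B \<union> open_children p E u)) n = {} \<longleftrightarrow>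
    (\<forall>t y. (t \<in> B \<or> (\<exists>a. (a, t) \<in> set E \<and> u (child_edge (a, t)) \<le> p)) \<longrightarrow> \<not> y \<in> evo w 1 {2 * t - 1} n)"
proof -
  have "evo w 1 ((\<lambda>a. 2 * a - 1) ` (B \<union> open_children p E u)) n = {} \<longleftrightarrow>
     (\<forall>y. \<forall>t\<in>B \<union> open_children p E u. \<not> y \<in> evo w 1 {2 * t - 1} n)"
    using evo_singleton[of _ w 1 "(\<lambda>a. 2 * a - 1) ` (B \<union> open_children p E u)" n] by auto
  then show ?thesis unfolding open_children_def by blast
qed

lemma measurable_dead_children:
  assumes E: "\<And>a t. (a, t) \<in> set E \<Longrightarrow> t = a \<or> t = a + 1"
  shows "Measurable.pred labels (\<lambda>u. evo (hconf p u) 1 ((\<lambda>a. 2 * a - 1) ` (B \<union> open_children p E u)) n = {})"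
proof -
  have [measurable]: "Measurable.pred labels (\<lambda>u. (a, t) \<in> set E \<and> u (child_edge (a, t)) \<le> p)" for a t
  proof (cases "(a, t) \<in> set E")
    case True
    note [measurable] = measurable_label[OF child_edge_in_edges[OF E[OF this]]]
    show ?thesis by measurable
  qed simp
  show ?thesis unfolding dead_children_event by measurable
qed

text \<open>The remaining event depends on the edges of \<open>E\<close> and those from level 1 on,
  hence is independent of the label of the head edge; the two terms are its two outcomes.\<close>

lemma dead_children_Cons:
  assumes p: "0 \<le> p" "p \<le> 1" and notin: "(a, t) \<notin> set E"
    and E: "\<And>b s. (b, s) \<in> set ((a, t) # E) \<Longrightarrow> s = b \<or> s = b + 1"
  shows "dead_children p n ((a, t) # E) B = (1 - p) * dead_children p n E B + p * dead_children p n E (insert t B)"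
proof -
  define R where "R B u \<longleftrightarrow> evo (hconf p u) 1 ((\<lambda>a. 2 * a - 1) ` (B \<union> open_children p E u)) n = {}" for B u
  have DR: "dead_children p n E B = \<P>(u in labels. R B u)" for B
    by (simp add: dead_children_def R_def)
  let ?e = "child_edge (a, t)"
  have e: "?e \<in> edges" using E[of a t] by (intro child_edge_in_edges) simp
  have [measurable]: "Measurable.pred labels (R B)" for B
    unfolding R_def[abs_def] by (rule measurable_dead_children) (use E in auto)
  note [measurable] = measurable_label[OF e]
  have dR: "depends_on (edges - {?e}) (R B)" for B
    unfolding depends_on_def
  proof (intro allI impI)
    fix u v :: "edge \<Rightarrow> real" assume uv: "\<forall>e\<in>edges - {?e}. u e = v e"
    have "u (child_edge (b, s)) = v (child_edge (b, s))" if "(b, s) \<in> set E" for b s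
    proof -
      have "child_edge (b, s) \<in> edges" using E[of b s] that by (intro child_edge_in_edges) auto
      moreover have "child_edge (b, s) \<noteq> ?e" using that notin by (auto simp: child_edge_eq_iff)
      ultimately show ?thesis using uv by blast
    qed
    then have "open_children p E u = open_children p E v" by (auto simp: open_children_def)
    moreover have "evo (hconf p u) 1 S n = evo (hconf p v) 1 S n" for S
    proof (rule evo_cong)
      fix e assume "e \<in> edges" "1 \<le> lev e"
      then have "u e = v e" using uv by (auto simp: child_edge_def lev_def)
      then show "hconf p u e = hconf p v e" by (simp add: conf_def)
    qed
    ultimately show "R B u = R B v" by (simp add: R_def)
  qed
  have de: "depends_on {?e} (\<lambda>u. u ?e \<le> p)" "depends_on {?e} (\<lambda>u. \<not> u ?e \<le> p)" by (simp_all add: depends_on_def)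
  have "evo (hconf p u) 1 ((\<lambda>a. 2 * a - 1) ` (B \<union> open_children p ((a, t) # E) u)) n = {} \<longleftrightarrow>
      (u ?e \<le> p \<and> R (insert t B) u) \<or> (\<not> u ?e \<le> p \<and> R B u)" for u
  proof -
    have "open_children p ((a, t) # E) u = (if u ?e \<le> p then insert t (open_children p E u) else open_children p E u)"
      by (auto simp: open_children_def)
    then show ?thesis by (simp add: R_def)
  qed
  then have "dead_children p n ((a, t) # E) B =
      \<P>(u in labels. (u ?e \<le> p \<and> R (insert t B) u) \<or> (\<not> u ?e \<le> p \<and> R B u))"
    by (simp add: dead_children_def)
  also have "\<dots> = \<P>(u in labels. u ?e \<le> p \<and> R (insert t B) u) + \<P>(u in labels. \<not> u ?e \<le> p \<and> R B u)"
    by (subst labels.finite_measure_Union[symmetric]) (auto intro!: arg_cong[where f="measure labels"])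
  also have "\<P>(u in labels. u ?e \<le> p \<and> R (insert t B) u) = p * dead_children p n E (insert t B)"
    using prob_indep[OF de(1) _ dR] e prob_label_le[OF e p] by (simp add: DR)
  also have "\<P>(u in labels. \<not> u ?e \<le> p \<and> R B u) = (1 - p) * dead_children p n E B"
  proof -
    have "\<P>(u in labels. \<not> u ?e \<le> p) = 1 - p"
      using labels.prob_neg[of "\<lambda>u. u ?e \<le> p"] prob_label_le[OF e p] by simp
    then show ?thesis
      using prob_indep[OF de(2) _ dR] e by (simp add: DR)
  qed
  finally show ?thesis by simp
qed

definition both_children :: "int list \<Rightarrow> (int \<times> int) list" where
  "both_children A = concat (map (\<lambda>a. [(a, a), (a, a + 1)]) A)"

lemma set_both_children: "set (both_children A) = {(a, t). a \<in> set A \<and> (t = a \<or> t = a + 1)}"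
  by (auto simp: both_children_def)

lemma dead_Suc: "dead p (Suc n) (set A) = dead_children p n (both_children A) {}"
proof -
  have "step (hconf p u) 0 ((\<lambda>a. 2 * a) ` set A) = (\<lambda>a. 2 * a - 1) ` open_children p (both_children A) u" for u
  proof (rule set_eqI)
    fix y
    have "y \<in> step (hconf p u) 0 ((\<lambda>a. 2 * a) ` set A) \<longleftrightarrow>
        (\<exists>a\<in>set A. ((2 * a, 0), (y, 1)) \<in> edges \<and> hconf p u ((2 * a, 0), (y, 1)))"
      by (simp add: step_def)
    also have "\<dots> \<longleftrightarrow> (\<exists>a\<in>set A. (y = 2 * a - 1 \<or> y = 2 * a + 1) \<and> u ((2 * a, 0), (y, 1)) \<le> p)"
      by (rule bex_cong[OF refl]) (auto simp: edges_iff conf_def)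
    also have "\<dots> \<longleftrightarrow> (\<exists>a\<in>set A. \<exists>t\<in>{a, a + 1}. y = 2 * t - 1 \<and> u (child_edge (a, t)) \<le> p)"
      by (rule bex_cong[OF refl]) (auto simp: child_edge_def ac_simps)
    also have "\<dots> \<longleftrightarrow> y \<in> (\<lambda>a. 2 * a - 1) ` open_children p (both_children A) u"
      unfolding open_children_def set_both_children image_iff by blast
    finally show "y \<in> step (hconf p u) 0 ((\<lambda>a. 2 * a) ` set A) \<longleftrightarrow>
        y \<in> (\<lambda>a. 2 * a - 1) ` open_children p (both_children A) u" .
  qed
  then have "evo (hconf p u) 0 ((\<lambda>a. 2 * a) ` set A) (Suc n) =
      evo (hconf p u) 1 ((\<lambda>a. 2 * a - 1) ` ({} \<union> open_children p (both_children A) u)) n" for u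
    using evo_add[of "hconf p u" 0 "(\<lambda>a. 2 * a) ` set A" 1 n] by simp
  then show ?thesis by (simp add: dead_def dead_children_def)
qed

text \<open>Revealing the edges from left to right is the recursion of \<open>scan\<close>. A parent
  can share with earlier ones only its left child; when \<open>a = d\<close> that child is already
  occupied, which the assumption on \<open>B\<close> records.\<close>

lemma dead_children_scan:
  assumes p: "0 \<le> p" "p \<le> 1"
  shows "sorted_wrt (<) A \<Longrightarrow> d \<in> set A \<longrightarrow> d \<in> B \<Longrightarrow> (\<And>a. a \<in> set A \<Longrightarrow> d \<le> a) \<Longrightarrow>
    dead_children p n (both_children A) B = scan (1 - p) d A (\<lambda>l. dead p n (B \<union> set l))"
proof (induction A arbitrary: d B)
  case Nil
  then show ?case by (simp add: both_children_def dead_children_Nil)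
next
  case (Cons a as)
  have as: "sorted_wrt (<) as" "\<And>x. x \<in> set as \<Longrightarrow> a + 1 \<le> x" using Cons.prems(1) by auto
  have da: "d \<le> a" using Cons.prems(3) by simp
  have notin: "a \<notin> set as" using as(2)[of a] by auto
  have E: "both_children (a # as) = (a, a) # (a, a + 1) # both_children as"
    by (simp add: both_children_def)
  have 1: "dead_children p n ((a, a + 1) # both_children as) B' =
      (1 - p) * dead_children p n (both_children as) B' + p * dead_children p n (both_children as) (insert (a + 1) B')" for B'
    using notin by (intro dead_children_Cons[OF p]) (auto simp: set_both_children)
  have 2: "dead_children p n ((a, a) # (a, a + 1) # both_children as) B' =
      (1 - p) * dead_children p n ((a, a + 1) # both_children as) B' + p * dead_children p n ((a, a + 1) # both_children as) (insert a B')" for B'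
    using notin by (intro dead_children_Cons[OF p]) (auto simp: set_both_children)
  have IHd: "dead_children p n (both_children as) B = scan (1 - p) d as (\<lambda>l. dead p n (B \<union> set l))"
    using as da Cons.prems(2) by (intro Cons.IH) force+
  have IHa: "dead_children p n (both_children as) (insert a B) = scan (1 - p) a as (\<lambda>l. dead p n (insert a B \<union> set l))"
    using as by (intro Cons.IH) force+
  have IH1: "dead_children p n (both_children as) (insert (a + 1) B') = scan (1 - p) (a + 1) as (\<lambda>l. dead p n (insert (a + 1) B' \<union> set l))" for B'
    using as by (intro Cons.IH) auto
  show ?case
  proof (cases "a = d")
    case True
    \<comment> \<open>Both outcomes of the edge \<open>(a, a)\<close> lead to the same set, so its
      two terms merge.\<close>
    then have "insert a B = B" using Cons.prems(2) by auto
    then have "dead_children p n (both_children (a # as)) B = dead_children p n ((a, a + 1) # both_children as) B"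
      unfolding E 2 by (simp add: algebra_simps)
    then show ?thesis using True unfolding 1 IHd IH1 by simp
  next
    case False
    then show ?thesis unfolding E 2 1 IHd IHa IH1 by (simp add: insert_commute)
  qed
qed

text \<open>At time 0 only the empty set is dead, and its partition sum is 1. Each further step is
  the supermartingale property with \<open>1 - p \<le> 1 / 50\<close>.\<close>

lemma dead_le_part_sum:
  assumes p: "49 / 50 \<le> p" "p \<le> 1"
  shows "sorted_wrt (<) A \<Longrightarrow> dead p n (set A) \<le> part_sum A"
proof (induction n arbitrary: A)
  case 0
  show ?case
  proof (cases A)
    case Nil
    then show ?thesis by (simp add: dead_def)
  next
    case (Cons a as)
    then show ?thesis by (simp add: dead_def)
  qed
next
  case (Suc n)
  define d where "d = (case A of [] \<Rightarrow> 0 | a # _ \<Rightarrow> a - 1)"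
  have d: "d < a" if "a \<in> set A" for a
    using that Suc.prems by (cases A) (auto simp: d_def)
  have "dead p (Suc n) (set A) = scan (1 - p) d A (\<lambda>l. dead p n ({} \<union> set l))"
    unfolding dead_Suc using p Suc.prems d by (intro dead_children_scan) force+
  also have "\<dots> \<le> scan (1 - p) d A part_sum"
    using p Suc d by (intro scan_mono) (force intro: less_imp_le)+
  also have "\<dots> \<le> part_sum A" using p Suc.prems d by (intro scan_part_sum_le) auto
  finally show ?case .
qed

text \<open>Extinction of a single site by any given time has probability at most
  \<open>wgt 1\<close>; the survival events decrease, so the bound 95/96 passes to their
  intersection.\<close>

lemma theta_pos_near_1:
  assumes "49 / 50 \<le> p" "p \<le> 1"
  shows "theta p > 0"
proof -
  have "dead p n {0} \<le> 1 / 96" for n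
    using dead_le_part_sum[OF assms, of "[0]" n] by (simp add: wgt_1)
  moreover have "\<P>(u in labels. evo (hconf p u) 0 {0} n \<noteq> {}) = 1 - dead p n {0}" for n
    using labels.prob_neg[of "\<lambda>u. evo (hconf p u) 0 {0} n = {}"] by (simp add: dead_def)
  ultimately have "\<P>(u in labels. evo (hconf p u) 0 {0} n \<noteq> {}) \<ge> 1 - 1 / 96" for n
    by (metis diff_left_mono)
  then have ge: "\<P>(u in labels. evo (hconf p u) 0 {0} n \<noteq> {}) \<ge> 95 / 96" for n by simp
  have "(\<lambda>n. \<P>(u in labels. evo (hconf p u) 0 {0} n \<noteq> {})) \<longlonglongrightarrow>
      measure labels (\<Inter>n. {u \<in> space labels. evo (hconf p u) 0 {0} n \<noteq> {}})"
  proof (rule labels.finite_Lim_measure_decseq)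
    show "range (\<lambda>n. {u \<in> space labels. evo (hconf p u) 0 {0} n \<noteq> {}}) \<subseteq> labels.events" by auto
    show "decseq (\<lambda>n. {u \<in> space labels. evo (hconf p u) 0 {0} n \<noteq> {}})"
      by (rule decseq_SucI) (auto simp: step_def)
  qed
  then have "measure labels (\<Inter>n. {u \<in> space labels. evo (hconf p u) 0 {0} n \<noteq> {}}) \<ge> 95 / 96"
    by (rule LIMSEQ_le_const) (use ge in auto)
  also have "(\<Inter>n. {u \<in> space labels. evo (hconf p u) 0 {0} n \<noteq> {}}) = {u \<in> space labels. \<forall>n. evo (hconf p u) 0 {0} n \<noteq> {}}"
    by auto
  finally show ?thesis by (simp add: theta_def)
qed

lemma p_c_bounds: "1 / 2 \<le> p_c" "p_c < 1"
proof -
  have *: "theta (49 / 50) > 0" by (rule theta_pos_near_1) auto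
  show "1 / 2 \<le> p_c" using * by (intro p_c_ge_half[of "49 / 50"]) auto
  have "p_c \<le> 49 / 50" using * by (intro p_c_le) auto
  then show "p_c < 1" by simp
qed

lemma drift_nonneg: "p_c < p \<Longrightarrow> drift p \<ge> 0"
  using theta_pos_near_1[of 1] by (intro drift_nonneg_above_p_c[of p 1]) auto

lemma drift_neg: "0 \<le> p \<Longrightarrow> p < p_c \<Longrightarrow> drift p < 0"
  using p_c_bounds by (intro drift_neg_below_p_c) auto

section \<open>The speed at densities close to one\<close>

text \<open>A copy of the lattice with edges of length \<open>M\<close>: a macroscopic step to the right is \<open>M\<close> steps to the
  right, a macroscopic step to the left is one step to the left, \<open>M - 2\<close> to the right and one to the left.
  These paths are edge disjoint, so the macroscopic edges are open independently with probability
  \<open>p ^ M\<close>, and at that scale even speed zero means speed \<open>(M - 2) / M\<close> in the original lattice.\<close>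

definition macro_site :: "nat \<Rightarrow> int \<Rightarrow> int \<Rightarrow> int" where
  "macro_site M x n = n * (int M - 2) + 2 * x"

text \<open>On a left path the offset is \<open>int i - 2\<close> after the initial step to the left
  and \<open>int M - 4\<close> after the final one.\<close>

definition macro_pos :: "nat \<Rightarrow> edge \<Rightarrow> nat \<Rightarrow> int" where
  "macro_pos M e i = macro_site M (fst (fst e)) (lev e) +
     (if fst (snd e) = fst (fst e) + 1 then int i
      else if i = 0 then 0 else if i < M then int i - 2 else int i - 4)"

definition macro_edge :: "nat \<Rightarrow> edge \<Rightarrow> nat \<Rightarrow> edge" where
  "macro_edge M e i = ((macro_pos M e i, lev e * int M + int i), (macro_pos M e (Suc i), lev e * int M + int i + 1))"

definition macro_conf :: "nat \<Rightarrow> (edge \<Rightarrow> bool) \<Rightarrow> edge \<Rightarrow> bool" where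
  "macro_conf M \<omega> = (\<lambda>e\<in>edges. \<forall>i<M. \<omega> (macro_edge M e i))"

lemma macro_edge_in_edges:
  assumes "M \<ge> 2" "e \<in> edges" "i < M"
  shows "macro_edge M e i \<in> edges"
proof -
  have "macro_pos M e (Suc i) = macro_pos M e i + 1 \<or> macro_pos M e (Suc i) = macro_pos M e i - 1"
    using assms by (auto simp: macro_pos_def)
  moreover have "even (macro_pos M e i + (lev e * int M + int i))"
    using assms(3) by (auto simp: macro_pos_def macro_site_def algebra_simps)
  ultimately show ?thesis by (simp add: macro_edge_def edges_iff)
qed

text \<open>The fine level determines the coarse level and \<open>i\<close>. Coarse sites of one
  level are at distances divisible by 4, while right and left paths have offsets that differ by 2 at
  inner positions, so distinct paths can meet only at end points.\<close>

lemma macro_edge_inj: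
  assumes M: "M \<ge> 2" and e: "e \<in> edges" "e' \<in> edges" and i: "i < M" "i' < M"
    and eq: "macro_edge M e i = macro_edge M e' i'"
  shows "e = e' \<and> i = i'"
proof -
  obtain x n y where e1: "e = ((x, n), (y, n + 1))" "even (x + n)" "y = x + 1 \<or> y = x - 1" "lev e = n"
    using e(1) by (rule edgesE)
  obtain x' n' y' where e2: "e' = ((x', n'), (y', n' + 1))" "even (x' + n')" "y' = x' + 1 \<or> y' = x' - 1" "lev e' = n'"
    using e(2) by (rule edgesE)
  have l: "n * int M + int i = n' * int M + int i'" using eq e1 e2 by (simp add: macro_edge_def)
  have "n = (n * int M + int i) div int M" using i M by simp
  also have "\<dots> = n'" unfolding l using i M by simp
  finally have n: "n = n'" .
  with l have ii: "i = i'" by simp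
  have p: "macro_pos M e i = macro_pos M e' i" "macro_pos M e (Suc i) = macro_pos M e' (Suc i)"
    using eq ii by (auto simp: macro_edge_def)
  have par: "even (x - x')" using e1(2) e2(2) n by presburger
  have "x = x' \<and> y = y'"
    using p par i M e1 e2 n by (auto simp: macro_pos_def macro_site_def split: if_splits) presburger+
  then show ?thesis using e1 e2 n ii by simp
qed

lemma prob_all_open:
  assumes p: "0 \<le> p" "p \<le> 1"
  shows "finite S \<Longrightarrow> S \<subseteq> edges \<Longrightarrow> \<P>(u in labels. \<forall>e\<in>S. u e \<le> p) = p ^ card S"
proof (induction S rule: finite_induct)
  case empty
  then show ?case by (simp add: labels.prob_space)
next
  case (insert e S)
  have e: "e \<in> edges" using insert by auto
  note [measurable] = measurable_label[OF e]
  have m: "Measurable.pred labels (\<lambda>u. \<forall>e\<in>S. u e \<le> p)"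
  proof (rule pred_intros_finite(3)[OF insert(1)])
    fix f assume "f \<in> S"
    then have "f \<in> edges" using insert by auto
    note [measurable] = measurable_label[OF this]
    show "Measurable.pred labels (\<lambda>u. u f \<le> p)" by measurable
  qed
  have "\<P>(u in labels. u e \<le> p \<and> (\<forall>e\<in>S. u e \<le> p)) = \<P>(u in labels. u e \<le> p) * \<P>(u in labels. \<forall>e\<in>S. u e \<le> p)"
    using insert e m by (intro prob_indep[of "{e}" _ S]) (auto simp: depends_on_def)
  then show ?case using insert prob_label_le[OF e p] by simp
qed

lemma macro_percolation:
  assumes M: "M \<ge> 2" and p: "0 \<le> p" "p \<le> 1"
  shows "distr labels configs (\<lambda>u. macro_conf M (hconf p u)) = distr labels configs (hconf (p ^ M))"
proof -
  define X where "X e u \<longleftrightarrow> (\<forall>f\<in>macro_edge M e ` {..<M}. u f \<le> p)" for e :: edge and u :: "edge \<Rightarrow> real"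
  have K: "macro_edge M e ` {..<M} \<subseteq> edges" if "e \<in> edges" for e
    using macro_edge_in_edges[OF M that] by auto
  have "labels.indep_vars (\<lambda>e. Pi\<^sub>M (macro_edge M e ` {..<M}) (\<lambda>_. unif))
      (\<lambda>e u. \<lambda>f\<in>macro_edge M e ` {..<M}. u f) edges"
    using K macro_edge_inj[OF M]
    by (intro labels.indep_vars_restrict[OF indep_vars_labels]) (force simp: disjoint_family_on_def)+
  then have "labels.indep_vars (\<lambda>_. count_space UNIV)
      (\<lambda>e u. \<forall>f\<in>macro_edge M e ` {..<M}. (\<lambda>f\<in>macro_edge M e ` {..<M}. u f) f \<le> p) edges"
  proof (rule labels.indep_vars_compose2)
    fix e assume "e \<in> edges"
    have [measurable]: "(\<lambda>v. v f) \<in> borel_measurable (Pi\<^sub>M (macro_edge M e ` {..<M}) (\<lambda>_. unif))"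
      if "f \<in> macro_edge M e ` {..<M}" for f
      using measurable_component_singleton[OF that, of "\<lambda>_. unif"] by (simp cong: measurable_cong_sets)
    show "Measurable.pred (Pi\<^sub>M (macro_edge M e ` {..<M}) (\<lambda>_. unif)) (\<lambda>v. \<forall>f\<in>macro_edge M e ` {..<M}. v f \<le> p)"
      by (rule pred_intros_finite(3)) (simp, measurable)
  qed
  also have "(\<lambda>e u. \<forall>f\<in>macro_edge M e ` {..<M}. (\<lambda>f\<in>macro_edge M e ` {..<M}. u f) f \<le> p) = X"
    by (auto simp: X_def fun_eq_iff)
  finally have ind: "labels.indep_vars (\<lambda>_. count_space UNIV) X edges" .
  have prob: "\<P>(u in labels. X e u) = p ^ M" if "e \<in> edges" for e
  proof -
    have "inj_on (macro_edge M e) {..<M}" using macro_edge_inj[OF M that that] by (auto simp: inj_on_def)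
    then show ?thesis
      unfolding X_def using K[OF that] by (subst prob_all_open[OF p]) (auto simp: card_image)
  qed
  have "macro_conf M (hconf p u) = (\<lambda>e\<in>edges. X e u)" for u
    using macro_edge_in_edges[OF M] by (auto simp: macro_conf_def X_def conf_def fun_eq_iff)
  then have "distr labels configs (\<lambda>u. macro_conf M (hconf p u)) = percolation (\<lambda>_. p ^ M)"
    using percolation_eq_distr_indep[OF ind prob] by simp
  also have "\<dots> = distr labels configs (hconf (p ^ M))"
    using percolation_eq_distr[of "\<lambda>_. p ^ M"] p by (simp add: conf_def[abs_def] power_le_one)
  finally show ?thesis .
qed

lemma measurable_macro_conf:
  assumes "M \<ge> 2"
  shows "macro_conf M \<in> measurable configs configs"
  unfolding macro_conf_def[abs_def]
proof (subst (2) configs_def, rule measurable_restrict)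
  fix e assume e: "e \<in> edges"
  have "Measurable.pred configs (\<lambda>\<omega>. \<forall>i\<in>{..<M}. \<omega> (macro_edge M e i))"
  proof (rule pred_intros_finite(3))
    fix i assume "i \<in> {..<M}"
    then show "Measurable.pred configs (\<lambda>\<omega>. \<omega> (macro_edge M e i))"
      using macro_edge_in_edges[OF assms e] by (intro measurable_config) simp
  qed simp
  then show "Measurable.pred configs (\<lambda>\<omega>. \<forall>i<M. \<omega> (macro_edge M e i))"
    unfolding Ball_def lessThan_iff .
qed

lemma macro_evo_edge:
  assumes M: "M \<ge> 2" and e: "e \<in> edges" and op: "macro_conf M \<omega> e"
  shows "i \<le> M \<Longrightarrow> macro_pos M e i \<in> evo \<omega> (lev e * int M) {macro_pos M e 0} i"
proof (induction i)
  case (Suc i)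
  then have i: "i < M" by simp
  have "\<omega> (macro_edge M e i)" using op e i by (simp add: macro_conf_def)
  moreover have "macro_edge M e i \<in> edges" by (rule macro_edge_in_edges[OF M e i])
  ultimately show ?case using Suc by (auto simp: step_def macro_edge_def)
qed simp

lemma macro_evo:
  assumes M: "M \<ge> 2"
  shows "y \<in> evo (macro_conf M \<omega>) 0 S k \<Longrightarrow>
    macro_site M y (int k) \<in> evo \<omega> 0 ((\<lambda>x. macro_site M x 0) ` S) (k * M)"
proof (induction k arbitrary: y)
  case (Suc k)
  then obtain x where x: "x \<in> evo (macro_conf M \<omega>) 0 S k" and e: "((x, int k), (y, int k + 1)) \<in> edges"
    and op: "macro_conf M \<omega> ((x, int k), (y, int k + 1))" by (auto simp: step_def)
  let ?e = "((x, int k), (y, int k + 1))"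
  have l: "lev ?e = int k" by (simp add: lev_def)
  have p0: "macro_pos M ?e 0 = macro_site M x (int k)" by (simp add: macro_pos_def l)
  have pM: "macro_pos M ?e M = macro_site M y (int (Suc k))"
    using e M by (auto simp: macro_pos_def lev_def macro_site_def edges_iff algebra_simps)
  have "macro_site M y (int (Suc k)) \<in> evo \<omega> (int k * int M) {macro_site M x (int k)} M"
    using macro_evo_edge[OF M e op, of M] by (simp only: l p0 pM)
  also have "\<dots> \<subseteq> evo \<omega> (int k * int M) (evo \<omega> 0 ((\<lambda>x. macro_site M x 0) ` S) (k * M)) M"
    using Suc.IH[OF x] by (intro evo_mono_set) auto
  also have "\<dots> = evo \<omega> 0 ((\<lambda>x. macro_site M x 0) ` S) (Suc k * M)"
    using evo_add[of \<omega> 0 _ "k * M" M] by (simp add: add.commute)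
  finally show ?case .
qed simp

lemma disp_macro:
  assumes M: "M \<ge> 2" and d: "- int k < disp (macro_conf M \<omega>) 0 0 k"
  shows "int k * (int M - 2) + 2 * disp (macro_conf M \<omega>) 0 0 k \<le> disp \<omega> 0 0 (k * M)"
proof -
  have "disp (macro_conf M \<omega>) 0 0 k \<in> evo (macro_conf M \<omega>) 0 (half_line 0 0) k"
    using disp_attained[OF d] by simp
  from macro_evo[OF M this]
  have "macro_site M (disp (macro_conf M \<omega>) 0 0 k) (int k) \<in>
      evo \<omega> 0 ((\<lambda>x. macro_site M x 0) ` half_line 0 0) (k * M)" .
  also have "\<dots> \<subseteq> evo \<omega> 0 (half_line 0 0) (k * M)"
    by (intro evo_mono_set) (auto simp: half_line_def macro_site_def)
  finally show ?thesis using evo_le_disp by (fastforce simp: macro_site_def)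
qed

text \<open>As the coarse drift is nonnegative, the coarse displacement is eventually at least
  \<open>- real k / 2\<close>. It counts twice on the fine scale, so \<open>k * M\<close> fine steps
  advance the edge by at least k (M - 2) - k, whence the 3.\<close>

lemma drift_ge_macro:
  assumes M: "M \<ge> 2" and p: "0 \<le> p" "p \<le> 1" and pM: "p_c < p ^ M"
  shows "drift p \<ge> 1 - 3 / real M"
proof -
  let ?P = "\<lambda>\<omega>. \<exists>K. \<forall>k\<ge>K. - real k / 2 \<le> real_of_int (disp \<omega> 0 0 k)"
  have "AE u in labels. ?P (hconf (p ^ M) u)"
    using AE_disp_tendsto[of "p ^ M"]
  proof (rule AE_mp, intro AE_I2 impI)
    fix u assume lim: "(\<lambda>n. real_of_int (disp (hconf (p ^ M) u) 0 0 n) / real n) \<longlonglongrightarrow> drift (p ^ M)"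
    have "- 1 / 2 < drift (p ^ M)" using drift_nonneg[OF pM] by simp
    from order_tendstoD(1)[OF lim this] obtain K where K: "\<And>n. n \<ge> K \<Longrightarrow> - 1 / 2 < real_of_int (disp (hconf (p ^ M) u) 0 0 n) / real n"
      unfolding eventually_sequentially by blast
    have "- real k / 2 \<le> real_of_int (disp (hconf (p ^ M) u) 0 0 k)" if "k \<ge> K" for k
      using K[OF that] by (cases "k = 0") (auto simp: field_simps)
    then show "?P (hconf (p ^ M) u)" by blast
  qed
  \<comment> \<open>The coarse configuration is homogeneous in law only, so the almost sure
    statement has to pass through the distribution on \<open>configs\<close>.\<close>
  then have "AE \<omega> in distr labels configs (hconf (p ^ M)). ?P \<omega>"
    by (subst AE_distr_iff) auto
  then have "AE \<omega> in distr labels configs (\<lambda>u. macro_conf M (hconf p u)). ?P \<omega>"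
    by (simp only: macro_percolation[OF M p])
  then have "AE u in labels. ?P (macro_conf M (hconf p u))"
    by (rule AE_distrD[OF measurable_compose[OF measurable_conf measurable_macro_conf[OF M]]])
  then have "AE u in labels. 1 - 3 / real M \<le> drift p"
    using AE_disp_tendsto[of p]
  proof eventually_elim
    case (elim u)
    then obtain K where K: "\<And>k. k \<ge> K \<Longrightarrow> - real k / 2 \<le> real_of_int (disp (macro_conf M (hconf p u)) 0 0 k)" by blast
    have "1 - 3 / real M \<le> real_of_int (disp (hconf p u) 0 0 (k * M)) / real (k * M)" if k: "k \<ge> K" "k \<ge> 1" for k
    proof -
      let ?d = "disp (macro_conf M (hconf p u)) 0 0 k"
      have "- int k < ?d" using K[OF k(1)] k(2) by linarith
      from disp_macro[OF M this]
      have "real_of_int (int k * (int M - 2) + 2 * ?d) \<le> real_of_int (disp (hconf p u) 0 0 (k * M))"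
        by (simp only: of_int_le_iff)
      then have "real k * (real M - 2) + 2 * real_of_int ?d \<le> real_of_int (disp (hconf p u) 0 0 (k * M))" by simp
      then have "real k * (real M - 3) \<le> real_of_int (disp (hconf p u) 0 0 (k * M))"
        using K[OF k(1)] by (simp add: algebra_simps)
      moreover have "real k * (real M - 3) = (1 - 3 / real M) * real (k * M)" using M by (simp add: field_simps)
      moreover have "real (k * M) > 0" using k M by simp
      ultimately show ?thesis by (simp add: pos_le_divide_eq del: of_nat_mult)
    qed
    then have ev: "\<forall>\<^sub>F k in sequentially. 1 - 3 / real M \<le> real_of_int (disp (hconf p u) 0 0 (k * M)) / real (k * M)"
      unfolding eventually_sequentially by (intro exI[of _ "max K 1"]) auto
    have "strict_mono (\<lambda>k. k * M)" using M by (simp add: strict_mono_def)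
    from LIMSEQ_subseq_LIMSEQ[OF elim(2) this]
    have "(\<lambda>k. real_of_int (disp (hconf p u) 0 0 (k * M)) / real (k * M)) \<longlonglongrightarrow> drift p" by (simp add: comp_def)
    from tendsto_lowerbound[OF this ev] show ?case by simp
  qed
  then show ?thesis by simp
qed

lemma drift_near_1:
  assumes "\<epsilon> > 0"
  obtains q where "p_c < q" "q < 1" "\<And>p. q < p \<Longrightarrow> p \<le> 1 \<Longrightarrow> drift p \<ge> 1 - \<epsilon>"
proof -
  obtain M0 :: nat where M0: "3 / \<epsilon> < real M0" using reals_Archimedean2 by blast
  define M where "M = max M0 2"
  have M: "M \<ge> 2" "3 / real M \<le> \<epsilon>"
  proof -
    show "M \<ge> 2" by (simp add: M_def)
    have "real M > 3 / \<epsilon>" using M0 by (auto simp: M_def)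
    then show "3 / real M \<le> \<epsilon>" using assms \<open>M \<ge> 2\<close> by (simp add: field_simps)
  qed
  \<comment> \<open>Every density above the \<open>M\<close>-th root \<open>q\<close> of
    \<open>s\<close> is supercritical on the coarse lattice.\<close>
  define s where "s = (1 + p_c) / 2"
  have s: "p_c < s" "0 < s" "s < 1" using p_c_bounds by (auto simp: s_def)
  define q where "q = root M s"
  have q: "0 < q" "q < 1" "q ^ M = s" using s M by (auto simp: q_def real_root_gt_zero)
  have "s \<le> q" 
    using power_decreasing[of 1 M q] q M by simp
  show thesis
  proof (rule that[of q])
    show "p_c < q" using s \<open>s \<le> q\<close> by simp
    fix p assume p: "q < p" "p \<le> 1"
    then have "s < p ^ M" using q power_strict_mono[of q p M] M by auto
    then show "drift p \<ge> 1 - \<epsilon>"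
      using drift_ge_macro[of M p] M s p q by force
  qed (use q in auto)
qed

section \<open>Speed and drift agree above \<open>p_c\<close>\<close>

lemma right_edge_eq:
  "right_edge \<omega> (int k) = (SUP x\<in>evo \<omega> 0 (half_line 0 0) k. ereal (real_of_int x))"
proof -
  have "{x. \<exists>y\<le>0. (y, 0) \<in> lattice_sites \<and> path_to \<omega> (y, 0) (x, int k)} = evo \<omega> 0 (half_line 0 0) k"
    using evo_singleton[of _ \<omega> 0 "half_line 0 0" k] by (auto simp: path_to_iff lattice_sites_def half_line_def)
  then show ?thesis by (simp add: right_edge_def)
qed

lemma right_edge_eq_disp:
  assumes "- int k < disp \<omega> 0 0 k"
  shows "right_edge \<omega> (int k) = ereal (real_of_int (disp \<omega> 0 0 k))"
  unfolding right_edge_eq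
proof (rule antisym)
  show "(SUP x\<in>evo \<omega> 0 (half_line 0 0) k. ereal (real_of_int x)) \<le> ereal (real_of_int (disp \<omega> 0 0 k))"
    using evo_le_disp by (fastforce intro: SUP_least)
  show "ereal (real_of_int (disp \<omega> 0 0 k)) \<le> (SUP x\<in>evo \<omega> 0 (half_line 0 0) k. ereal (real_of_int x))"
    using disp_attained[OF assms] by (intro SUP_upper) simp
qed

lemma AE_right_edge:
  assumes p: "p_c < p" "p \<le> 1"
  shows "AE \<omega> in homogeneous_percolation p. (\<lambda>k. right_edge \<omega> (int k) / ereal (real k)) \<longlonglongrightarrow> ereal (drift p)"
proof -
  \<comment> \<open>Convergence written with countable quantifiers, to have a measurable predicate
    that can be transferred to the image measure.\<close>
  let ?P = "\<lambda>\<omega>. \<forall>m::nat. \<exists>N. \<forall>n\<ge>N. \<bar>real_of_int (disp \<omega> 0 0 n) / real n - drift p\<bar> < inverse (real (Suc m))"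
  have P: "?P \<omega> \<longleftrightarrow> (\<lambda>n. real_of_int (disp \<omega> 0 0 n) / real n) \<longlonglongrightarrow> drift p" for \<omega>
  proof
    assume *: "?P \<omega>"
    show "(\<lambda>n. real_of_int (disp \<omega> 0 0 n) / real n) \<longlonglongrightarrow> drift p"
    proof (rule LIMSEQ_I)
      fix r :: real assume "0 < r"
      then obtain m where "inverse (real (Suc m)) < r" using reals_Archimedean by blast
      with * show "\<exists>N. \<forall>n\<ge>N. norm (real_of_int (disp \<omega> 0 0 n) / real n - drift p) < r"
        by (metis less_trans real_norm_def)
    qed
  next
    assume *: "(\<lambda>n. real_of_int (disp \<omega> 0 0 n) / real n) \<longlonglongrightarrow> drift p"
    show "?P \<omega>"
    proof
      fix m
      show "\<exists>N. \<forall>n\<ge>N. \<bar>real_of_int (disp \<omega> 0 0 n) / real n - drift p\<bar> < inverse (real (Suc m))"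
        using LIMSEQ_D[OF *, of "inverse (real (Suc m))"] by simp
    qed
  qed
  have p0: "0 \<le> p" using p p_c_bounds by simp
  have "AE u in labels. ?P (hconf p u)"
    unfolding P by (rule AE_disp_tendsto)
  then have "AE \<omega> in distr labels configs (hconf p). ?P \<omega>"
    by (subst AE_distr_iff) auto
  then have "AE \<omega> in homogeneous_percolation p. (\<lambda>n. real_of_int (disp \<omega> 0 0 n) / real n) \<longlonglongrightarrow> drift p"
    unfolding P homogeneous_percolation_eq[OF p0 p(2)] .
  then show ?thesis
  proof (rule AE_mp, intro AE_I2 impI)
    fix \<omega> assume lim: "(\<lambda>n. real_of_int (disp \<omega> 0 0 n) / real n) \<longlonglongrightarrow> drift p"
    \<comment> \<open>Hence the truncation is eventually inactive and \<open>disp\<close> is the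
      true right edge.\<close>
    have "- 1 < drift p" using drift_nonneg[OF p(1)] by simp
    from order_tendstoD(1)[OF lim this]
    have "\<forall>\<^sub>F k in sequentially. ereal (real_of_int (disp \<omega> 0 0 k) / real k) = right_edge \<omega> (int k) / ereal (real k)"
      using eventually_gt_at_top[of 0]
    proof eventually_elim
      case (elim k)
      then have "- real k < real_of_int (disp \<omega> 0 0 k)" by (simp add: field_simps)
      then have "- int k < disp \<omega> 0 0 k" by linarith
      from right_edge_eq_disp[OF this] show ?case by simp
    qed
    with tendsto_ereal[OF lim]
    show "(\<lambda>k. right_edge \<omega> (int k) / ereal (real k)) \<longlonglongrightarrow> ereal (drift p)"
      by (rule Lim_transform_eventually)
  qed
qed

lemma speed_eq_drift:
  assumes p: "p_c < p" "p \<le> 1"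
  shows "speed p = drift p"
  unfolding speed_def
proof (rule the_equality)
  show "AE \<omega> in homogeneous_percolation p. (\<lambda>k. right_edge \<omega> (int k) / ereal (real k)) \<longlonglongrightarrow> ereal (drift p)"
    by (rule AE_right_edge[OF p])
  fix a assume "AE \<omega> in homogeneous_percolation p. (\<lambda>k. right_edge \<omega> (int k) / ereal (real k)) \<longlonglongrightarrow> ereal a"
  then have "AE \<omega> in homogeneous_percolation p. a = drift p"
    using AE_right_edge[OF p]
  proof eventually_elim
    case (elim \<omega>)
    from LIMSEQ_unique[OF elim] show ?case by simp
  qed
  moreover have "prob_space (homogeneous_percolation p)"
    using p p_c_bounds by (subst homogeneous_percolation_eq) (auto intro: labels.prob_space_distr)
  ultimately show "a = drift p"
    using prob_space.AE_const by blast
qed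

section \<open>Extinction above the critical height\<close>

lemma disp_conf_mono_levels:
  assumes "\<And>n. m \<le> n \<Longrightarrow> n < m + int j \<Longrightarrow> Q n \<le> Q' n"
  shows "disp (conf Q u) m x j \<le> disp (conf Q' u) m x j"
proof -
  have "disp (conf Q u) m x j = disp (conf (\<lambda>n. if m \<le> n \<and> n < m + int j then Q n else Q' n) u) m x j"
    by (rule disp_cong) (simp add: conf_def)
  also have "\<dots> \<le> disp (conf Q' u) m x j"
    by (rule disp_conf_mono) (use assms in auto)
  finally show ?thesis .
qed

text \<open>By the law of large numbers almost every point leaves \<open>A n\<close> for good, so
  the tail unions \<open>B N\<close> decrease to a null set.\<close>

lemma prob_disp_tail:
  assumes "\<epsilon> > 0"
  shows "(\<lambda>n. \<P>(u in labels. (drift p + \<epsilon>) * real n < real_of_int (disp (hconf p u) 0 0 n))) \<longlonglongrightarrow> 0"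
proof -
  define A where "A n = {u \<in> space labels. (drift p + \<epsilon>) * real n < real_of_int (disp (hconf p u) 0 0 n)}" for n
  define B where "B N = (\<Union>n\<in>{N..}. A n)" for N
  have [measurable]: "A n \<in> sets labels" for n unfolding A_def by measurable
  have B: "B N \<in> sets labels" for N unfolding B_def by measurable
  have "(\<lambda>N. measure labels (B N)) \<longlonglongrightarrow> measure labels (\<Inter>N. B N)"
    using B by (intro labels.finite_Lim_measure_decseq) (auto simp: decseq_def B_def intro: order_trans)
  also have "measure labels (\<Inter>N. B N) = 0"
  proof -
    have "AE u in labels. u \<notin> (\<Inter>N. B N)"
      using AE_disp_tendsto[of p]
    proof (rule AE_mp, intro AE_I2 impI)
      fix u assume lim: "(\<lambda>n. real_of_int (disp (hconf p u) 0 0 n) / real n) \<longlonglongrightarrow> drift p"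
      have "drift p < drift p + \<epsilon>" using assms by simp
      from order_tendstoD(2)[OF lim this] obtain N where
        N: "\<And>n. n \<ge> N \<Longrightarrow> real_of_int (disp (hconf p u) 0 0 n) / real n < drift p + \<epsilon>"
        unfolding eventually_sequentially by blast
      have "u \<notin> A n" if "n \<ge> Suc N" for n
        using N[of n] that by (simp add: A_def divide_less_eq)
      then have "u \<notin> B (Suc N)" by (auto simp: B_def)
      then show "u \<notin> (\<Inter>N. B N)" by blast
    qed
    then have "(\<Inter>N. B N) \<in> null_sets labels"
      using B by (intro AE_iff_null_sets[THEN iffD2]) auto
    then show ?thesis by (simp add: measure_eq_0_null_sets)
  qed
  finally have B0: "(\<lambda>N. measure labels (B N)) \<longlonglongrightarrow> 0" .
  have "(\<lambda>n. measure labels (A n)) \<longlonglongrightarrow> 0"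
  proof (rule tendsto_sandwich[OF _ _ tendsto_const B0])
    show "\<forall>\<^sub>F n in sequentially. 0 \<le> measure labels (A n)" by simp
    show "\<forall>\<^sub>F n in sequentially. measure labels (A n) \<le> measure labels (B n)"
      using B by (intro always_eventually allI labels.finite_measure_mono) (auto simp: B_def)
  qed
  then show ?thesis by (simp add: A_def)
qed

section \<open>Scaled densities and the critical height\<close>

definition density_inv :: "real \<Rightarrow> real \<Rightarrow> real" where
  "density_inv \<beta> q = (- ln (1 - q)) powr (- 1 / \<beta>)"

lemma density_inv:
  assumes "\<beta> > 0" "0 < q" "q < 1"
  shows "density_inv \<beta> q > 0" "scaled_density \<beta> (density_inv \<beta> q) = q"
proof -
  have pos: "- ln (1 - q) > 0" using assms by (simp add: ln_less_zero)
  then show *: "density_inv \<beta> q > 0" by (simp add: density_inv_def)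
  have "density_inv \<beta> q powr (- \<beta>) = (- ln (1 - q)) powr ((- 1 / \<beta>) * (- \<beta>))"
    unfolding density_inv_def by (rule powr_powr)
  also have "(- 1 / \<beta>) * (- \<beta>) = 1" using assms by simp
  finally have "density_inv \<beta> q powr (- \<beta>) = - ln (1 - q)" using pos by simp
  then show "scaled_density \<beta> (density_inv \<beta> q) = q"
    using * assms by (simp add: scaled_density_def)
qed

lemma scaled_density_strict_antimono:
  assumes "\<beta> > 0" "0 \<le> y" "y < y'"
  shows "scaled_density \<beta> y' < scaled_density \<beta> y"
proof (cases "y = 0")
  case False
  then have "y' powr (- \<beta>) < y powr (- \<beta>)" using assms by (intro powr_less_mono2_neg) auto
  with False assms show ?thesis by (simp add: scaled_density_def)
qed (use assms in \<open>simp add: scaled_density_def\<close>)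

lemma scaled_density_le_1: "scaled_density \<beta> y \<le> 1"
  by (simp add: scaled_density_def)

lemma y_c:
  assumes "\<beta> > 0"
  shows "y_c \<beta> > 0" "scaled_density \<beta> (y_c \<beta>) = p_c"
proof -
  let ?y = "density_inv \<beta> p_c"
  have y: "?y > 0" "scaled_density \<beta> ?y = p_c"
    using density_inv[OF assms, of p_c] p_c_bounds by auto
  have "y_c \<beta> = ?y"
    unfolding y_c_def
  proof (rule the_equality)
    fix y assume "0 \<le> y \<and> scaled_density \<beta> y = p_c"
    then show "y = ?y"
      using scaled_density_strict_antimono[OF assms, of y ?y] scaled_density_strict_antimono[OF assms, of ?y y] y
      by (cases y ?y rule: linorder_cases) auto
  qed (use y in auto)
  then show "y_c \<beta> > 0" "scaled_density \<beta> (y_c \<beta>) = p_c" using y by auto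
qed

lemma density_height_eq:
  assumes "\<beta> > 0" "t > 0"
  shows "density_height \<beta> p_c t = y_c \<beta> * t powr (1 / \<beta>)"
  unfolding density_height_def
proof (rule Greatest_equality)
  let ?T = "t powr (1 / \<beta>)"
  have T: "?T > 0" using assms by simp
  show "0 < y_c \<beta> * ?T \<and> p_c \<le> rho \<beta> (y_c \<beta> * ?T) t"
    using y_c[OF assms(1)] T scaled_density_eq_rho[OF assms, of "y_c \<beta>"] by simp
  fix y assume y: "0 < y \<and> p_c \<le> rho \<beta> y t"
  have "scaled_density \<beta> (y / ?T) = rho \<beta> y t"
    using scaled_density_eq_rho[OF assms, of "y / ?T"] y T by simp
  then have "\<not> y_c \<beta> < y / ?T"
    using scaled_density_strict_antimono[OF assms(1), of "y_c \<beta>" "y / ?T"] y_c[OF assms(1)] y by auto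
  then show "y \<le> y_c \<beta> * ?T" using T by (simp add: not_less pos_divide_le_eq)
qed

definition poisson_density :: "real \<Rightarrow> real \<Rightarrow> int \<Rightarrow> real" where
  "poisson_density \<beta> t n = (if n \<ge> 0 then rho \<beta> (real_of_int n + 1 / 2) t else 0)"

lemma poisson_percolation_eq:
  assumes "t > 0"
  shows "poisson_percolation \<beta> t = distr labels configs (conf (poisson_density \<beta> t))"
proof -
  have "poisson_percolation \<beta> t = percolation (\<lambda>e. poisson_density \<beta> t (lev e))"
    unfolding poisson_percolation_def percolation_def
  proof (intro PiM_cong refl)
    fix e assume "e \<in> edges"
    then obtain x n y where e: "e = ((x, n), (y, n + 1))" "lev e = n" by (rule edgesE)
    have "mid_height e = real_of_int n + 1 / 2" by (simp add: mid_height_def e(1))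
    moreover have "real_of_int n + 1 / 2 > 0 \<longleftrightarrow> n \<ge> 0" by linarith
    ultimately show "measure_pmf (bernoulli_pmf (if mid_height e > 0 then rho \<beta> (mid_height e) t else 0)) =
        measure_pmf (bernoulli_pmf (poisson_density \<beta> t (lev e)))"
      by (simp add: poisson_density_def e(2))
  qed
  also have "\<dots> = distr labels configs (conf (poisson_density \<beta> t))"
    unfolding conf_def[abs_def]
    by (rule percolation_eq_distr) (use assms in \<open>auto simp: poisson_density_def rho_def\<close>)
  finally show ?thesis .
qed

text \<open>The density decreases with the height, so its value at the bottom of a block dominates
  that block and everything above it.\<close>

lemma poisson_density_le:
  assumes "\<beta> > 0" "t > 0" "a > 0" "a * t powr (1 / \<beta>) \<le> real_of_int n"
  shows "poisson_density \<beta> t n \<le> scaled_density \<beta> a"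
proof -
  let ?T = "t powr (1 / \<beta>)"
  have T: "?T > 0" using assms by simp
  have n: "real_of_int n > 0" using assms T by (smt (verit) mult_pos_pos)
  then have "poisson_density \<beta> t n = rho \<beta> (real_of_int n + 1 / 2) t" by (simp add: poisson_density_def)
  also have "\<dots> = scaled_density \<beta> ((real_of_int n + 1 / 2) / ?T)"
    using scaled_density_eq_rho[OF assms(1,2), of "(real_of_int n + 1 / 2) / ?T"] n T by simp
  also have "\<dots> \<le> scaled_density \<beta> a"
  proof -
    have "a < (real_of_int n + 1 / 2) / ?T" using assms T by (simp add: pos_less_divide_eq)
    from scaled_density_strict_antimono[OF assms(1) _ this] assms show ?thesis by simp
  qed
  finally show ?thesis .
qed

lemma prob_poisson:
  assumes "t > 0" and [measurable]: "Measurable.pred configs P"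
  shows "\<P>(\<omega> in poisson_percolation \<beta> t. P \<omega>) = \<P>(u in labels. P (conf (poisson_density \<beta> t) u))"
  unfolding poisson_percolation_eq[OF assms(1)]
  by (subst measure_distr)
     (auto intro!: arg_cong[where f="measure labels"] dest: measurable_space[OF measurable_conf])

lemma prob_disp_le_homogeneous:
  assumes "\<And>n. m \<le> n \<Longrightarrow> Q n \<le> p" and "even (x + m)"
  shows "\<P>(u in labels. c < real_of_int (disp (conf Q u) m x n)) \<le>
    \<P>(u in labels. c < real_of_int (disp (hconf p u) 0 0 n))"
proof -
  have "\<P>(u in labels. c < real_of_int (disp (conf Q u) m x n)) \<le>
      \<P>(u in labels. disp (hconf p u) m x n \<in> {z. c < real_of_int z})"
  proof (rule labels.finite_measure_mono)
    have "disp (conf Q u) m x n \<le> disp (hconf p u) m x n" for u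
      by (rule disp_conf_mono_levels) (use assms in auto)
    then show "{u \<in> space labels. c < real_of_int (disp (conf Q u) m x n)} \<subseteq>
        {u \<in> space labels. disp (hconf p u) m x n \<in> {z. c < real_of_int z}}"
      by (auto intro: less_le_trans)
  qed measurable
  also have "\<dots> = \<P>(u in labels. c < real_of_int (disp (hconf p u) 0 0 n))"
    using prob_disp_shift[OF assms(2), of "\<lambda>_. p" n "{z. c < real_of_int z}"] by simp
  finally show ?thesis .
qed

lemma prob_reflect_disp:
  "\<P>(u in labels. c < real_of_int (disp (reflect_conf (conf Q u)) m x n)) =
   \<P>(u in labels. c < real_of_int (disp (conf Q u) m x n))"
  by (rule prob_reflect_conf) measurable

text \<open>Subcritical densities above level \<open>m\<close>: the sites of level \<open>m\<close> are divided into boundedly many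
  intervals of length less than \<open>2 c n\<close>, and in each of them the right edge moves left and the left edge
  moves right by \<open>c n\<close>.\<close>

lemma dead_interval:
  assumes x: "z \<le> x" "x \<le> z + w" "even (x + m)" and y: "y \<in> evo \<omega> m {x} n"
    and w: "real_of_int w < 2 * c"
    and r: "real_of_int (disp \<omega> m (z + w) n) \<le> - c" and l: "real_of_int (disp (reflect_conf \<omega>) m (- z) n) \<le> - c"
  shows False
proof -
  have "evo \<omega> m {x} n \<subseteq> evo \<omega> m (half_line m (z + w)) n"
    using x by (intro evo_mono_set) (auto simp: half_line_def)
  then have "y \<le> z + w + disp \<omega> m (z + w) n" using y evo_le_disp by blast
  moreover have "z - disp (reflect_conf \<omega>) m (- z) n \<le> y"
    using evo_ge_reflect_disp[OF y, of z] x by (simp add: disp_reflect_conf)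
  ultimately have "real_of_int (z - disp (reflect_conf \<omega>) m (- z) n) \<le> real_of_int (z + w + disp \<omega> m (z + w) n)"
    by (simp only: of_int_le_iff)
  with r l w show False by simp
qed

text \<open>On level \<open>m\<close> the cluster lies in \<open>{- int m..int m}\<close>, which
  \<open>G + 1\<close> intervals of length \<open>w\<close> cover; in each of them the right or the
  left edge could fail, hence the factor \<open>2 * (real G + 1)\<close>. An even \<open>w\<close>
  keeps the ends of the intervals on the lattice.\<close>

lemma prob_survival_subcritical:
  fixes c :: real and w :: int
  assumes Q: "\<And>k. int m \<le> k \<Longrightarrow> Q k \<le> p" and w: "even w" "w > 0" "real_of_int w < 2 * c" "2 * int m \<le> int G * w"
  shows "\<P>(u in labels. evo (conf Q u) 0 {0} (m + n) \<noteq> {}) \<le>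
    2 * (real G + 1) * \<P>(u in labels. - c < real_of_int (disp (hconf p u) 0 0 n))"
proof -
  define z where "z g = - int m + int g * w" for g
  define R where "R g = {u \<in> space labels. - c < real_of_int (disp (conf Q u) (int m) (z g + w) n)}" for g
  define L where "L g = {u \<in> space labels. - c < real_of_int (disp (reflect_conf (conf Q u)) (int m) (- z g) n)}" for g
  have [measurable]: "R g \<in> sets labels" "L g \<in> sets labels" for g unfolding R_def L_def by measurable
  have "{u \<in> space labels. evo (conf Q u) 0 {0} (m + n) \<noteq> {}} \<subseteq> (\<Union>g\<in>{..G}. R g \<union> L g)"
  proof (rule subsetI, rule ccontr)
    fix u assume u: "u \<in> {u \<in> space labels. evo (conf Q u) 0 {0} (m + n) \<noteq> {}}" and *: "u \<notin> (\<Union>g\<in>{..G}. R g \<union> L g)"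
    then obtain y where "y \<in> evo (conf Q u) (int m) (evo (conf Q u) 0 {0} m) n"
      using evo_add[of "conf Q u" 0 "{0}" m n] by auto
    then obtain x where x: "x \<in> evo (conf Q u) 0 {0} m" "y \<in> evo (conf Q u) (int m) {x} n"
      using evo_singleton by blast
    have xm: "- int m \<le> x" "x \<le> int m" using evo_bounds[OF x(1)] by auto
    have par: "even (x + int m)" using evo_parity[OF x(1)] by simp
    define g where "g = nat ((x + int m) div w)"
    have g: "int g = (x + int m) div w" using xm w by (simp add: g_def pos_imp_zdiv_nonneg_iff)
    have 1: "int g * w \<le> x + int m" "x + int m < int g * w + w"
      unfolding g using w(2) by (simp_all add: mult.commute minus_mod_eq_mult_div[symmetric] algebra_simps)
    have "int g * w \<le> int G * w" using 1(1) xm w by linarith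
    then have gG: "g \<le> G" using w(2) by simp
    with * u have "real_of_int (disp (conf Q u) (int m) (z g + w) n) \<le> - c"
      "real_of_int (disp (reflect_conf (conf Q u)) (int m) (- z g) n) \<le> - c"
      by (auto simp: R_def L_def not_less)
    with dead_interval[of "z g" x w "int m" y "conf Q u" n c] x(2) par w(3) 1 show False
      by (simp add: z_def)
  qed
  then have "\<P>(u in labels. evo (conf Q u) 0 {0} (m + n) \<noteq> {}) \<le> measure labels (\<Union>g\<in>{..G}. R g \<union> L g)"
    by (intro labels.finite_measure_mono) auto
  also have "\<dots> \<le> (\<Sum>g\<in>{..G}. measure labels (R g \<union> L g))"
    by (rule labels.finite_measure_subadditive_finite) auto
  also have "\<dots> \<le> (\<Sum>g\<in>{..G}. 2 * \<P>(u in labels. - c < real_of_int (disp (hconf p u) 0 0 n)))"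
  proof (rule sum_mono)
    fix g
    have "measure labels (R g \<union> L g) \<le> measure labels (R g) + measure labels (L g)"
      by (rule measure_Un_le) auto
    moreover have "measure labels (R g) \<le> \<P>(u in labels. - c < real_of_int (disp (hconf p u) 0 0 n))"
      unfolding R_def using w(1) by (intro prob_disp_le_homogeneous Q) (auto simp: z_def)
    moreover have "measure labels (L g) \<le> \<P>(u in labels. - c < real_of_int (disp (hconf p u) 0 0 n))"
      unfolding L_def prob_reflect_disp using w(1) by (intro prob_disp_le_homogeneous Q) (auto simp: z_def)
    ultimately show "measure labels (R g \<union> L g) \<le> 2 * \<P>(u in labels. - c < real_of_int (disp (hconf p u) 0 0 n))"
      by linarith
  qed
  finally show ?thesis by (simp add: algebra_simps)
qed

definition dies_by :: "real \<Rightarrow> (edge \<Rightarrow> bool) \<Rightarrow> bool" where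
  "dies_by h \<omega> \<longleftrightarrow> (\<forall>n. h < real n \<longrightarrow> evo \<omega> 0 {0} n = {})"

lemma measurable_dies_by [measurable]: "Measurable.pred configs (dies_by h)"
  unfolding dies_by_def[abs_def] by measurable

lemma filterlim_powr_at_top: "a > 0 \<Longrightarrow> filterlim (\<lambda>t::real. t powr a) at_top at_top"
proof (subst filterlim_at_top, safe)
  fix Z :: real assume a: "a > 0"
  have "Z \<le> t powr a" if t: "t \<ge> max Z 1 powr (1 / a)" for t
  proof -
    have "(max Z 1 powr (1 / a)) powr a \<le> t powr a" using t a by (intro powr_mono2) auto
    then show ?thesis using a by (simp add: powr_powr)
  qed
  then show "\<forall>\<^sub>F t in at_top. Z \<le> t powr a"
    by (rule eventually_at_top_linorderI)
qed

lemma prob_dies_by: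
  fixes \<beta> \<eta> :: real
  assumes \<beta>: "\<beta> > 0" and \<eta>: "\<eta> > 0"
  shows "((\<lambda>t. \<P>(u in labels. dies_by ((1 + \<eta>) * (y_c \<beta> * t powr (1 / \<beta>))) (conf (poisson_density \<beta> t) u))) \<longlongrightarrow> 1) at_top"
proof -
  define N where "N t = y_c \<beta> * t powr (1 / \<beta>)" for t
  \<comment> \<open>One half of \<open>\<eta>\<close> is spent on reaching a strictly subcritical
    density, the other half on dying out.\<close>
  define a where "a = (1 + \<eta> / 2) * y_c \<beta>"
  define p where "p = scaled_density \<beta> a"
  define m where "m t = nat \<lceil>(1 + \<eta> / 2) * N t\<rceil>" for t
  \<comment> \<open>The 1 subtracted here pays for the ceiling in \<open>m t\<close>, so that
    \<open>m t + n t\<close> does not exceed \<open>(1 + \<eta>) * N t\<close>.\<close>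
  define n where "n t = nat \<lfloor>\<eta> / 2 * N t\<rfloor> - 1" for t
  \<comment> \<open>Half of the drift, so that \<open>drift p + c = - c\<close>: outside the tail
    event each edge moves inwards at rate \<open>c\<close>.\<close>
  define c where "c = - drift p / 2"
  \<comment> \<open>An even integer of size about \<open>c * n t\<close>, well below the limit
    \<open>2 * c * n t\<close> of \<open>dead_interval\<close>.\<close>
  define w where "w t = 2 * \<lfloor>c * real (n t) / 2\<rfloor>" for t
  have yc: "y_c \<beta> > 0" using y_c[OF \<beta>] by simp
  have a: "y_c \<beta> < a" using yc \<eta> by (simp add: a_def)
  have p: "p < p_c" using scaled_density_strict_antimono[OF \<beta> _ a] y_c[OF \<beta>] by (simp add: p_def)
  have p0: "0 \<le> p" by (simp add: p_def scaled_density_def)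
  have c: "c > 0" using drift_neg[OF p0 p] by (simp add: c_def)
  have ce: "drift p + c = - c" by (simp add: c_def)
  \<comment> \<open>Both \<open>m t\<close> and \<open>w t\<close> grow linearly in
    \<open>N t\<close>, so a number of intervals independent of \<open>t\<close> suffices; the
    summand 1 absorbs the rounding.\<close>
  obtain G :: nat where G: "real G > (2 * (1 + \<eta> / 2) + 1) / (c * \<eta> / 2)" using reals_Archimedean2 by blast
  then have G: "real G * (c * \<eta> / 2) > 2 * (1 + \<eta> / 2) + 1" using c \<eta> by (simp add: pos_divide_less_eq)
  have Ninf: "filterlim N at_top at_top"
    unfolding N_def using filterlim_powr_at_top[of "1 / \<beta>"] \<beta> yc
    by (intro filterlim_tendsto_pos_mult_at_top[OF tendsto_const]) auto
  have ninf: "filterlim n at_top at_top"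
  proof (subst filterlim_at_top, safe)
    fix Z
    have "\<forall>\<^sub>F t in at_top. N t \<ge> (real Z + 2) / (\<eta> / 2)" using Ninf by (simp add: filterlim_at_top)
    then show "\<forall>\<^sub>F t in at_top. Z \<le> n t"
    proof eventually_elim
      case (elim t)
      then have "\<eta> / 2 * N t \<ge> real Z + 2" using \<eta> by (simp add: field_simps)
      then show ?case unfolding n_def by linarith
    qed
  qed
  have "(\<lambda>n. \<P>(u in labels. - c * real n < real_of_int (disp (hconf p u) 0 0 n))) \<longlonglongrightarrow> 0"
    using prob_disp_tail[OF c, of p] by (simp only: ce)
  then have b0: "((\<lambda>t. 1 - 2 * (real G + 1) * \<P>(u in labels. - c * real (n t) < real_of_int (disp (hconf p u) 0 0 (n t)))) \<longlongrightarrow> 1 - 2 * (real G + 1) * 0) at_top"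
    by (intro tendsto_intros filterlim_compose[OF _ ninf])
  have "\<forall>\<^sub>F t in at_top. 1 - 2 * (real G + 1) * \<P>(u in labels. - c * real (n t) < real_of_int (disp (hconf p u) 0 0 (n t)))
      \<le> \<P>(u in labels. dies_by ((1 + \<eta>) * N t) (conf (poisson_density \<beta> t) u))"
  proof -
    have "\<forall>\<^sub>F t in at_top. N t \<ge> real G * (2 * c + 2) + 2" "\<forall>\<^sub>F t in at_top. N t \<ge> (2 / c + 3) / (\<eta> / 2)"
      using Ninf by (simp_all add: filterlim_at_top)
    then show ?thesis
      using eventually_gt_at_top[of "0::real"]
    proof eventually_elim
      case (elim t)
      define Q where "Q = poisson_density \<beta> t"
      have Npos: "N t > 0" using yc elim(3) by (simp add: N_def)
      have \<eta>N: "\<eta> / 2 * N t \<ge> 2 / c + 3" using elim(2) \<eta> by (simp add: field_simps)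
      have "2 / c > 0" using c by simp
      have m: "(1 + \<eta> / 2) * N t \<le> real (m t)" "real (m t) \<le> (1 + \<eta> / 2) * N t + 1"
        using Npos \<eta> by (auto simp: m_def of_nat_nat)
      have n: "\<eta> / 2 * N t - 2 \<le> real (n t)" "real (n t) \<le> \<eta> / 2 * N t - 1"
        unfolding n_def using \<eta>N \<open>2 / c > 0\<close> by linarith+
      have w: "c * real (n t) - 2 < real_of_int (w t)" "real_of_int (w t) \<le> c * real (n t)"
        unfolding w_def by linarith+
      have cn: "c * real (n t) \<ge> c * (2 / c + 1)"
        using n \<eta>N c by (intro mult_left_mono) linarith+
      then have cn2: "c * real (n t) > 2" using c by (simp add: distrib_left)
      have wpos: "w t > 0" using w cn2 by linarith
      have "2 * real (m t) \<le> real G * real_of_int (w t)"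
      proof -
        have "c * (\<eta> / 2 * N t - 2) \<le> c * real (n t)" using n c by (intro mult_left_mono) auto
        then have "c * \<eta> / 2 * N t - (2 * c + 2) \<le> real_of_int (w t)" using w by (simp add: algebra_simps)
        then have "real G * (c * \<eta> / 2 * N t - (2 * c + 2)) \<le> real G * real_of_int (w t)" by (intro mult_left_mono) auto
        moreover have "(2 * (1 + \<eta> / 2) + 1) * N t \<le> real G * (c * \<eta> / 2) * N t"
          using G Npos by (intro mult_right_mono) auto
        ultimately show ?thesis using m(2) elim(1) by (simp add: algebra_simps)
      qed
      then have "real_of_int (2 * int (m t)) \<le> real_of_int (int G * w t)" by simp
      then have cover: "2 * int (m t) \<le> int G * w t" by (simp only: of_int_le_iff)
      have Q: "Q k \<le> p" if "int (m t) \<le> k" for k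
        unfolding Q_def p_def
      proof (rule poisson_density_le[OF \<beta> elim(3)])
        show "0 < a" using a yc by simp
        have "a * t powr (1 / \<beta>) = (1 + \<eta> / 2) * N t" by (simp add: a_def N_def)
        also have "\<dots> \<le> real_of_int k" using m(1) that by linarith
        finally show "a * t powr (1 / \<beta>) \<le> real_of_int k" .
      qed
      have "\<P>(u in labels. evo (conf Q u) 0 {0} (m t + n t) \<noteq> {}) \<le>
          2 * (real G + 1) * \<P>(u in labels. - (c * real (n t)) < real_of_int (disp (hconf p u) 0 0 (n t)))"
        by (rule prob_survival_subcritical[where w="w t"]) (use Q wpos cover w cn2 in \<open>auto simp: w_def\<close>)
      moreover have "\<P>(u in labels. evo (conf Q u) 0 {0} (m t + n t) \<noteq> {}) = 1 - \<P>(u in labels. evo (conf Q u) 0 {0} (m t + n t) = {})"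
        by (rule labels.prob_neg) measurable
      moreover have "\<P>(u in labels. evo (conf Q u) 0 {0} (m t + n t) = {}) \<le> \<P>(u in labels. dies_by ((1 + \<eta>) * N t) (conf Q u))"
      proof (rule labels.finite_measure_mono)
        show "{u \<in> space labels. evo (conf Q u) 0 {0} (m t + n t) = {}} \<subseteq> {u \<in> space labels. dies_by ((1 + \<eta>) * N t) (conf Q u)}"
        proof (clarsimp simp: dies_by_def)
          fix u k assume u: "evo (conf Q u) 0 {0} (m t + n t) = {}" and k: "(1 + \<eta>) * N t < real k"
          have "real (m t + n t) \<le> (1 + \<eta>) * N t" using m(2) n(2) by (simp add: algebra_simps)
          then have "m t + n t \<le> k" using k by linarith
          then show "evo (conf Q u) 0 {0} k = {}" by (rule evo_empty_mono[OF u])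
        qed
      qed measurable
      ultimately show ?case by (simp add: Q_def)
    qed
  qed
  moreover have "\<forall>\<^sub>F t in at_top. \<P>(u in labels. dies_by ((1 + \<eta>) * N t) (conf (poisson_density \<beta> t) u)) \<le> 1"
    by (intro always_eventually allI labels.prob_le_1)
  moreover note b0[unfolded mult_zero_right diff_zero]
  ultimately have "((\<lambda>t. \<P>(u in labels. dies_by ((1 + \<eta>) * N t) (conf (poisson_density \<beta> t) u))) \<longlongrightarrow> 1) at_top"
    by (rule tendsto_sandwich[OF _ _ _ tendsto_const])
  then show ?thesis by (simp only: N_def)
qed

section \<open>The right edge below the critical height\<close>

text \<open>On the domain of integration in \<open>shape\<close> this differs from the integrand
  there at most at the point \<open>y_c\<close>. It is decreasing on the whole half-line, which
  yields integrability.\<close>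

definition local_drift :: "real \<Rightarrow> real \<Rightarrow> real" where
  "local_drift \<beta> s = (if s < y_c \<beta> then drift (scaled_density \<beta> s) else 0)"

lemma density_above_p_c:
  assumes "\<beta> > 0" "0 \<le> s" "s < y_c \<beta>"
  shows "p_c < scaled_density \<beta> s"
  using scaled_density_strict_antimono[OF assms] y_c[OF assms(1)] by simp

lemma local_drift_bounds:
  assumes "\<beta> > 0" "0 \<le> s"
  shows "0 \<le> local_drift \<beta> s" "local_drift \<beta> s \<le> 1"
  using drift_nonneg[OF density_above_p_c[OF assms]] drift_le_1 by (auto simp: local_drift_def)

lemma local_drift_antimono:
  assumes "\<beta> > 0" "0 \<le> s" "s \<le> s'"
  shows "local_drift \<beta> s' \<le> local_drift \<beta> s"
proof (cases "s' < y_c \<beta>")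
  case True
  have "scaled_density \<beta> s' \<le> scaled_density \<beta> s"
    using scaled_density_strict_antimono[OF assms(1,2), of s'] assms by (cases "s = s'") auto
  with True assms show ?thesis by (simp add: local_drift_def drift_mono)
next
  case False
  then show ?thesis using local_drift_bounds(1)[OF assms(1,2)] by (simp add: local_drift_def)
qed

lemma local_drift_integrable:
  assumes "\<beta> > 0" "0 \<le> a"
  shows "local_drift \<beta> integrable_on {a..b}"
proof -
  have "mono_on {a..b} (\<lambda>s. - local_drift \<beta> s)"
    using assms local_drift_antimono[OF assms(1)] by (auto simp: mono_on_def)
  from integrable_neg[OF integrable_on_mono_on[OF this]] show ?thesis by simp
qed

lemma shape_eq:
  assumes "\<beta> > 0"
  shows "shape \<beta> y = integral {0..min y (y_c \<beta>)} (local_drift \<beta>)"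
  unfolding shape_def
proof (rule integral_spike[of "{y_c \<beta>}"])
  fix s assume "s \<in> {0..min y (y_c \<beta>)} - {y_c \<beta>}"
  then have "0 \<le> s" "s < y_c \<beta>" by auto
  then show "local_drift \<beta> s = speed (scaled_density \<beta> s)"
    using speed_eq_drift[OF density_above_p_c[OF assms] scaled_density_le_1] by (simp add: local_drift_def)
qed simp

text \<open>A decreasing function is at least its value at the right end. This fits the blocks: the
  drift inside a block is bounded by its value at the bottom, and the integral over the block
  beneath pays for it.\<close>

lemma integral_local_drift_step:
  assumes "\<beta> > 0" "0 \<le> a" "a \<le> b"
  shows "integral {0..a} (local_drift \<beta>) + local_drift \<beta> b * (b - a) \<le> integral {0..b} (local_drift \<beta>)"
proof -
  have "integral {a..b} (\<lambda>_. local_drift \<beta> b) \<le> integral {a..b} (local_drift \<beta>)"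
    using assms by (intro integral_le local_drift_integrable local_drift_antimono) auto
  then have "local_drift \<beta> b * (b - a) \<le> integral {a..b} (local_drift \<beta>)" using assms by (simp add: mult.commute)
  moreover have "integral {0..a} (local_drift \<beta>) + integral {a..b} (local_drift \<beta>) = integral {0..b} (local_drift \<beta>)"
    using assms by (intro Henstock_Kurzweil_Integration.integral_combine local_drift_integrable) auto
  ultimately show ?thesis by simp
qed

lemma integral_local_drift_mono:
  assumes "\<beta> > 0" "0 \<le> a" "a \<le> b"
  shows "integral {0..a} (local_drift \<beta>) \<le> integral {0..b} (local_drift \<beta>)"
proof -
  have "0 \<le> local_drift \<beta> b * (b - a)" using assms local_drift_bounds[of \<beta> b] by simp
  with integral_local_drift_step[OF assms] show ?thesis by linarith
qed

lemma shape_mono: "\<beta> > 0 \<Longrightarrow> 0 \<le> y \<Longrightarrow> y \<le> y' \<Longrightarrow> shape \<beta> y \<le> shape \<beta> y'"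
  unfolding shape_eq using y_c(1)[of \<beta>] by (intro integral_local_drift_mono) auto

text \<open>Near 0 the density is near 1, so \<open>drift_near_1\<close> makes the slope of
  \<open>shape\<close> at least \<open>1 - \<eta> / (1 + \<eta>) = 1 / (1 + \<eta>)\<close>. In this
  range one unit per step is a good enough bound for the edge.\<close>

lemma shape_near_0:
  assumes \<beta>: "\<beta> > 0" and \<eta>: "\<eta> > 0"
  obtains d where "0 < d" "d < y_c \<beta>" "\<And>y. 0 \<le> y \<Longrightarrow> y \<le> d \<Longrightarrow> y \<le> (1 + \<eta>) * shape \<beta> y"
proof -
  obtain q where q: "p_c < q" "q < 1" "\<And>p. q < p \<Longrightarrow> p \<le> 1 \<Longrightarrow> drift p \<ge> 1 - \<eta> / (1 + \<eta>)"
    using drift_near_1[of "\<eta> / (1 + \<eta>)"] \<eta> by (auto simp: divide_pos_pos)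
  have q0: "0 < q" using q p_c_bounds by simp
  note inv = density_inv[OF \<beta> q0 q(2)]
  have lt: "density_inv \<beta> q < y_c \<beta>"
  proof (rule ccontr)
    assume "\<not> ?thesis"
    then have "scaled_density \<beta> (density_inv \<beta> q) \<le> scaled_density \<beta> (y_c \<beta>)"
      using scaled_density_strict_antimono[OF \<beta>, of "y_c \<beta>" "density_inv \<beta> q"] y_c[OF \<beta>]
      by (cases "y_c \<beta> = density_inv \<beta> q") auto
    then show False using inv y_c[OF \<beta>] q by simp
  qed
  show thesis
  proof (rule that[of "density_inv \<beta> q / 2"])
    show "0 < density_inv \<beta> q / 2" "density_inv \<beta> q / 2 < y_c \<beta>" using inv lt by auto
    fix y assume y: "0 \<le> y" "y \<le> density_inv \<beta> q / 2"
    then have yl: "y < density_inv \<beta> q" "y < y_c \<beta>" using inv lt by auto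
    have "q < scaled_density \<beta> y"
      using scaled_density_strict_antimono[OF \<beta> y(1) yl(1)] inv by simp
    then have "1 - \<eta> / (1 + \<eta>) \<le> local_drift \<beta> y"
      using q(3)[OF _ scaled_density_le_1] yl by (simp add: local_drift_def)
    then have "(1 - \<eta> / (1 + \<eta>)) * y \<le> local_drift \<beta> y * y" using y by (intro mult_right_mono) auto
    also have "\<dots> \<le> integral {0..y} (local_drift \<beta>)"
      using integral_local_drift_step[OF \<beta> order_refl y(1)] by simp
    also have "\<dots> = shape \<beta> y" using yl by (simp add: shape_eq[OF \<beta>])
    finally have "(1 + \<eta>) * ((1 - \<eta> / (1 + \<eta>)) * y) \<le> (1 + \<eta>) * shape \<beta> y" using \<eta> by (intro mult_left_mono) auto
    moreover have "(1 + \<eta>) * ((1 - \<eta> / (1 + \<eta>)) * y) = y" using \<eta> by (simp add: field_simps)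
    ultimately show "y \<le> (1 + \<eta>) * shape \<beta> y" by simp
  qed
qed

text \<open>The start is the random position of the edge, determined by the levels below
  \<open>m\<close>. So each term factorises, and the probabilities of the possible starts add up to
  1.\<close>

lemma prob_disp_random_start:
  assumes Q: "\<And>k. int m \<le> k \<Longrightarrow> Q k \<le> p"
  shows "measure labels (\<Union>x\<in>{- int m..int m}. {u \<in> space labels. disp (conf Q u) 0 0 m = x \<and> c < real_of_int (disp (conf Q u) (int m) x n)}) \<le>
    \<P>(u in labels. c < real_of_int (disp (hconf p u) 0 0 n))"
proof -
  let ?b = "\<P>(u in labels. c < real_of_int (disp (hconf p u) 0 0 n))"
  let ?E = "\<lambda>x. {u \<in> space labels. disp (conf Q u) 0 0 m = x \<and> c < real_of_int (disp (conf Q u) (int m) x n)}"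
  have "measure labels (\<Union>x\<in>{- int m..int m}. ?E x) \<le> (\<Sum>x\<in>{- int m..int m}. measure labels (?E x))"
    by (rule labels.finite_measure_subadditive_finite) auto
  also have "\<dots> \<le> (\<Sum>x\<in>{- int m..int m}. \<P>(u in labels. disp (conf Q u) 0 0 m = x) * ?b)"
  proof (rule sum_mono)
    fix x
    have E: "measure labels (?E x) = \<P>(u in labels. disp (conf Q u) 0 0 m = x) * \<P>(u in labels. c < real_of_int (disp (conf Q u) (int m) x n))"
      using prob_disp_chain[of Q 0 0 m "{x}" Q x n "{z. c < real_of_int z}"] by simp
    show "measure labels (?E x) \<le> \<P>(u in labels. disp (conf Q u) 0 0 m = x) * ?b"
    proof (cases "even (x + int m)")
      case True
      then show ?thesis unfolding E by (intro mult_left_mono prob_disp_le_homogeneous Q) auto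
    next
      case False
      then have "disp (conf Q u) 0 0 m \<noteq> x" for u using disp_parity[of 0 0 "conf Q u" m] by auto
      then show ?thesis unfolding E by simp
    qed
  qed
  also have "\<dots> = ?b"
    using expectation_disp(2)[of "\<lambda>_. 1" Q 0 0 m] by (simp add: sum_distrib_right[symmetric] labels.prob_space)
  finally show ?thesis .
qed

section \<open>Blocks below the critical height\<close>

definition block_level :: "real \<Rightarrow> real \<Rightarrow> nat \<Rightarrow> nat" where
  "block_level T \<delta> i = nat \<lceil>real i * \<delta> * T\<rceil>"

lemma block_level_bounds:
  assumes "0 \<le> \<delta>" "0 \<le> T"
  shows "real i * \<delta> * T \<le> real (block_level T \<delta> i)" "real (block_level T \<delta> i) < real i * \<delta> * T + 1"
proof -
  have "0 \<le> real i * \<delta> * T" using assms by simp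
  then show "real i * \<delta> * T \<le> real (block_level T \<delta> i)" "real (block_level T \<delta> i) < real i * \<delta> * T + 1"
    unfolding block_level_def by linarith+
qed

lemma block_level_mono:
  assumes "0 \<le> \<delta>" "0 \<le> T" "i \<le> j"
  shows "block_level T \<delta> i \<le> block_level T \<delta> j"
  unfolding block_level_def using assms by (intro nat_mono ceiling_mono mult_right_mono) auto

text \<open>The block starts from the right edge itself, so that good blocks can be chained by
  \<open>disp_subadd\<close>.\<close>

definition block_good :: "real \<Rightarrow> real \<Rightarrow> real \<Rightarrow> real \<Rightarrow> nat \<Rightarrow> (edge \<Rightarrow> bool) \<Rightarrow> bool" where
  "block_good \<beta> \<epsilon> T \<delta> i \<omega> \<longleftrightarrow>
     real_of_int (disp \<omega> (int (block_level T \<delta> i)) (disp \<omega> 0 0 (block_level T \<delta> i)) (block_level T \<delta> (Suc i) - block_level T \<delta> i))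
     \<le> (local_drift \<beta> (real i * \<delta>) + \<epsilon>) * real (block_level T \<delta> (Suc i) - block_level T \<delta> i)"

text \<open>The lowest block is bounded by its length, which costs \<open>\<delta>\<close>; each
  later one is paid for by the integral over the block beneath it. Rounding the levels costs at most
  2 per block, since \<open>local_drift\<close> and \<open>\<epsilon>\<close> are at most 1.\<close>

lemma disp_block_level:
  assumes \<beta>: "\<beta> > 0" and \<delta>: "0 \<le> \<delta>" and T: "0 \<le> T" and \<epsilon>: "0 \<le> \<epsilon>" "\<epsilon> \<le> 1"
    and good: "\<And>i. 1 \<le> i \<Longrightarrow> i \<le> j \<Longrightarrow> block_good \<beta> \<epsilon> T \<delta> i \<omega>"
  shows "real_of_int (disp \<omega> 0 0 (block_level T \<delta> (Suc j))) \<le>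
    T * (\<delta> + integral {0..real j * \<delta>} (local_drift \<beta>) + \<epsilon> * real j * \<delta>) + 2 * real j + 1"
  using good
proof (induction j)
  case 0
  have "real_of_int (disp \<omega> 0 0 (block_level T \<delta> (Suc 0))) \<le> real (block_level T \<delta> (Suc 0))"
    using disp_le[of \<omega> 0 0 "block_level T \<delta> (Suc 0)"] by linarith
  then show ?case using block_level_bounds(2)[OF \<delta> T, of "Suc 0"] by (simp add: algebra_simps)
next
  case (Suc j)
  let ?m = "block_level T \<delta> (Suc j)" and ?m' = "block_level T \<delta> (Suc (Suc j))"
  let ?s = "real (Suc j) * \<delta>"
  define n where "n = ?m' - ?m"
  have mm: "?m' = ?m + n" using block_level_mono[OF \<delta> T, of "Suc j" "Suc (Suc j)"] by (simp add: n_def)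
  have n: "real n \<le> \<delta> * T + 1"
  proof -
    have "real ?m' = real ?m + real n" by (simp add: mm)
    then show ?thesis using block_level_bounds(1)[OF \<delta> T, of "Suc j"] block_level_bounds(2)[OF \<delta> T, of "Suc (Suc j)"]
      by (simp add: algebra_simps)
  qed
  have v: "0 \<le> local_drift \<beta> ?s" "local_drift \<beta> ?s \<le> 1"
    using local_drift_bounds[OF \<beta>, of ?s] \<delta> by auto
  have "real_of_int (disp \<omega> 0 0 ?m') \<le> real_of_int (disp \<omega> 0 0 ?m) + real_of_int (disp \<omega> (int ?m) (disp \<omega> 0 0 ?m) n)"
    using disp_subadd[of \<omega> 0 0 ?m n] unfolding mm by simp
  also have "real_of_int (disp \<omega> (int ?m) (disp \<omega> 0 0 ?m) n) \<le> (local_drift \<beta> ?s + \<epsilon>) * real n"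
    using Suc.prems[of "Suc j"] by (simp only: block_good_def n_def)
  also have "\<dots> \<le> (local_drift \<beta> ?s + \<epsilon>) * (\<delta> * T + 1)"
    using n v \<epsilon> by (intro mult_left_mono) auto
  also have "\<dots> = T * (local_drift \<beta> ?s * \<delta>) + T * (\<epsilon> * \<delta>) + (local_drift \<beta> ?s + \<epsilon>)"
    by (simp add: algebra_simps)
  also have "\<dots> \<le> T * (integral {0..?s} (local_drift \<beta>) - integral {0..real j * \<delta>} (local_drift \<beta>)) + T * (\<epsilon> * \<delta>) + 2"
  proof (intro add_mono mult_left_mono T order_refl)
    show "local_drift \<beta> ?s * \<delta> \<le> integral {0..?s} (local_drift \<beta>) - integral {0..real j * \<delta>} (local_drift \<beta>)"
      using integral_local_drift_step[OF \<beta>, of "real j * \<delta>" ?s] \<delta> by (simp add: algebra_simps)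
    show "local_drift \<beta> ?s + \<epsilon> \<le> 2" using v \<epsilon> by simp
  qed (rule \<epsilon>)
  also have "real_of_int (disp \<omega> 0 0 ?m) \<le> T * (\<delta> + integral {0..real j * \<delta>} (local_drift \<beta>) + \<epsilon> * real j * \<delta>) + 2 * real j + 1"
    using Suc.prems by (intro Suc.IH) auto
  finally show ?case by (simp add: algebra_simps)
qed

text \<open>Within a block the right edge moves at most with speed one, which only costs a term of the order
  of the block length \<open>\<delta>\<close>.\<close>

lemma disp_le_shape:
  assumes \<beta>: "\<beta> > 0" and B: "B \<ge> 1" "\<delta> = y_c \<beta> / real B" and T: "0 < T" and \<epsilon>: "0 \<le> \<epsilon>" "\<epsilon> \<le> 1"
    and good: "\<And>i. 1 \<le> i \<Longrightarrow> i < B \<Longrightarrow> block_good \<beta> \<epsilon> T \<delta> i \<omega>"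
    and k: "\<delta> * T \<le> real k" "real k \<le> (1 + \<eta>') * y_c \<beta> * T" and \<eta>': "0 \<le> \<eta>'"
  shows "real_of_int (disp \<omega> 0 0 k) \<le> T * (shape \<beta> (real k / T) + 2 * \<delta> + \<epsilon> * y_c \<beta> + \<eta>' * y_c \<beta>) + 2 * real B + 1"
proof -
  have yc: "y_c \<beta> > 0" using y_c[OF \<beta>] by simp
  have \<delta>: "\<delta> > 0" "real B * \<delta> = y_c \<beta>" using yc B by auto
  have dT: "\<delta> * T > 0" using \<delta> T by simp
  define i where "i = nat \<lfloor>real k / (\<delta> * T)\<rfloor>"
  have ki: "1 \<le> real k / (\<delta> * T)" using k(1) dT by simp
  then have i: "1 \<le> i" "real i \<le> real k / (\<delta> * T)" "real k / (\<delta> * T) < real i + 1"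
    unfolding i_def by linarith+
  \<comment> \<open>\<open>Suc j\<close> is the last controlled block boundary below height
    \<open>k\<close>, capped at the critical height; from there on the edge is allowed one unit per
    step.\<close>
  define j where "j = min B i - 1"
  have j: "Suc j \<le> B" "Suc j \<le> i" "Suc j = B \<or> Suc j = i" using i B by (auto simp: j_def)
  define m where "m = block_level T \<delta> (Suc j)"
  have jk: "real (Suc j) * \<delta> * T \<le> real k"
  proof -
    have "real (Suc j) * (\<delta> * T) \<le> real i * (\<delta> * T)" using j dT by (intro mult_right_mono) auto
    also have "\<dots> \<le> real k" using i(2) dT by (simp add: pos_le_divide_eq)
    finally show ?thesis by simp
  qed
  then have "m \<le> k" unfolding m_def block_level_def by linarith
  have mk: "real k - real m \<le> T * (\<delta> + \<eta>' * y_c \<beta>)"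
  proof -
    have "real k - real m \<le> real k - real (Suc j) * \<delta> * T"
      using block_level_bounds(1)[of \<delta> T "Suc j"] \<delta> T by (simp add: m_def)
    also have "\<dots> \<le> T * (\<delta> + \<eta>' * y_c \<beta>)"
    proof (cases "Suc j = B")
      case True
      then have "real (Suc j) * \<delta> * T = y_c \<beta> * T" using \<delta>(2) by simp
      moreover have "0 \<le> T * \<delta>" using T \<delta> by simp
      ultimately show ?thesis using k(2) by (simp add: algebra_simps)
    next
      case False
      then have "real (Suc j) = real i" using j by simp
      moreover have "real k \<le> (real i + 1) * (\<delta> * T)" using i(3) dT by (simp add: pos_divide_less_eq)
      moreover have "0 \<le> T * (\<eta>' * y_c \<beta>)" using T \<eta>' yc by simp
      ultimately show ?thesis by (simp add: algebra_simps)
    qed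
    finally show ?thesis .
  qed
  have "disp \<omega> 0 0 k \<le> disp \<omega> 0 0 m + int (k - m)"
    using disp_subadd[of \<omega> 0 0 m "k - m"] disp_le[of \<omega> "int m" "disp \<omega> 0 0 m" "k - m"] \<open>m \<le> k\<close> by simp
  then have "real_of_int (disp \<omega> 0 0 k) \<le> real_of_int (disp \<omega> 0 0 m) + (real k - real m)"
    using \<open>m \<le> k\<close> by linarith
  also have "real_of_int (disp \<omega> 0 0 m) \<le> T * (\<delta> + integral {0..real j * \<delta>} (local_drift \<beta>) + \<epsilon> * real j * \<delta>) + 2 * real j + 1"
    unfolding m_def using good j \<delta> T \<epsilon> by (intro disp_block_level[OF \<beta>]) auto
  also have "\<dots> \<le> T * (\<delta> + shape \<beta> (real k / T) + \<epsilon> * y_c \<beta>) + 2 * real B + 1"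
  proof -
    have jd: "real j * \<delta> \<le> real (Suc j) * \<delta>" using \<delta> by (intro mult_right_mono) auto
    have 1: "real (Suc j) * \<delta> \<le> y_c \<beta>"
      using j(1) \<delta> mult_right_mono[of "real (Suc j)" "real B" \<delta>] by simp
    have "integral {0..real j * \<delta>} (local_drift \<beta>) \<le> integral {0..min (real k / T) (y_c \<beta>)} (local_drift \<beta>)"
    proof (rule integral_local_drift_mono[OF \<beta>])
      show "0 \<le> real j * \<delta>" using \<delta> by simp
      have "real (Suc j) * \<delta> \<le> real k / T" using jk T by (simp add: pos_le_divide_eq)
      then show "real j * \<delta> \<le> min (real k / T) (y_c \<beta>)" using jd 1 by linarith
    qed
    moreover have "\<epsilon> * (real j * \<delta>) \<le> \<epsilon> * y_c \<beta>" using jd 1 \<epsilon> by (intro mult_left_mono) auto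
    ultimately have "T * (\<delta> + integral {0..real j * \<delta>} (local_drift \<beta>) + \<epsilon> * real j * \<delta>) \<le>
        T * (\<delta> + shape \<beta> (real k / T) + \<epsilon> * y_c \<beta>)"
      unfolding shape_eq[OF \<beta>] using T by (intro mult_left_mono) (auto simp: mult.assoc)
    moreover have "real j \<le> real B" using j by simp
    ultimately show ?thesis by linarith
  qed
  also have "real k - real m \<le> T * (\<delta> + \<eta>' * y_c \<beta>)" by (rule mk)
  finally show ?thesis by (simp add: algebra_simps)
qed

definition right_bounded :: "real \<Rightarrow> real \<Rightarrow> real \<Rightarrow> real \<Rightarrow> (edge \<Rightarrow> bool) \<Rightarrow> bool" where
  "right_bounded \<beta> \<eta> t h \<omega> \<longleftrightarrow>
     (\<forall>k. real k \<le> h \<longrightarrow> real_of_int (disp \<omega> 0 0 k) \<le> (1 + \<eta>) * Gamma_shape \<beta> t (real k))"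

lemma measurable_right_bounded [measurable]: "Measurable.pred configs (right_bounded \<beta> \<eta> t h)"
  unfolding right_bounded_def[abs_def] by measurable

text \<open>The range ends at a factor \<open>1 + \<eta>'\<close> because above the critical height
  \<open>shape\<close> is constant while the edge is only bounded by one unit per step. Greater
  heights are left to extinction.\<close>

lemma prob_right_bounded:
  fixes \<beta> \<eta> :: real
  assumes \<beta>: "\<beta> > 0" and \<eta>: "\<eta> > 0"
  obtains \<eta>' where "0 < \<eta>'" "\<eta>' \<le> \<eta>"
    "((\<lambda>t. \<P>(u in labels. right_bounded \<beta> \<eta> t ((1 + \<eta>') * (y_c \<beta> * t powr (1 / \<beta>))) (conf (poisson_density \<beta> t) u))) \<longlongrightarrow> 1) at_top"
proof -
  define T where "T t = t powr (1 / \<beta>)" for t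
  have yc: "y_c \<beta> > 0" using y_c[OF \<beta>] by simp
  obtain d where d: "0 < d" "d < y_c \<beta>" "\<And>y. 0 \<le> y \<Longrightarrow> y \<le> d \<Longrightarrow> y \<le> (1 + \<eta>) * shape \<beta> y"
    using shape_near_0[OF \<beta> \<eta>] by blast
  \<comment> \<open>In units of \<open>T t\<close>, the room that the factor
    \<open>1 + \<eta>\<close> leaves at all scaled heights beyond \<open>d\<close>.\<close>
  define \<zeta> where "\<zeta> = \<eta> * shape \<beta> d"
  have "0 < (1 + \<eta>) * shape \<beta> d" using d(3)[of d] d(1) by linarith
  then have \<zeta>: "\<zeta> > 0" using \<eta> by (simp add: \<zeta>_def zero_less_mult_iff)
  \<comment> \<open>The errors from \<open>2 * \<delta>\<close>, \<open>\<epsilon>\<close> and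
    \<open>\<eta>'\<close> take at most \<open>\<zeta> / 8\<close> each; half of
    \<open>\<zeta>\<close> is kept for \<open>2 * real B + 1\<close>, which does not grow with
    \<open>t\<close>.\<close>
  define \<epsilon> where "\<epsilon> = min 1 (\<zeta> / (8 * y_c \<beta>))"
  define \<eta>' where "\<eta>' = min \<eta> (\<zeta> / (8 * y_c \<beta>))"
  have \<epsilon>: "0 < \<epsilon>" "\<epsilon> \<le> 1" "\<epsilon> * y_c \<beta> \<le> \<zeta> / 8"
    using \<zeta> yc mult_right_mono[of \<epsilon> "\<zeta> / (8 * y_c \<beta>)" "y_c \<beta>"] by (auto simp: \<epsilon>_def)
  have \<eta>': "0 < \<eta>'" "\<eta>' \<le> \<eta>" "\<eta>' * y_c \<beta> \<le> \<zeta> / 8"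
    using \<zeta> yc \<eta> mult_right_mono[of \<eta>' "\<zeta> / (8 * y_c \<beta>)" "y_c \<beta>"] by (auto simp: \<eta>'_def)
  obtain B0 :: nat where B0: "y_c \<beta> / min d (\<zeta> / 16) < real B0" using reals_Archimedean2 by blast
  define B where "B = B0 + 1"
  define \<delta> where "\<delta> = y_c \<beta> / real B"
  have B: "B \<ge> 1" by (simp add: B_def)
  have \<delta>: "\<delta> > 0" "real B * \<delta> = y_c \<beta>" using yc B by (auto simp: \<delta>_def)
  have "\<delta> \<le> min d (\<zeta> / 16)"
  proof -
    define g where "g = min d (\<zeta> / 16)"
    have g: "g > 0" using d \<zeta> by (simp add: g_def)
    then have "y_c \<beta> < real B0 * g" using B0 by (simp add: pos_divide_less_eq g_def[symmetric])
    also have "\<dots> \<le> real B * g" using g by (intro mult_right_mono) (auto simp: B_def)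
    finally have "\<delta> \<le> g" using B by (simp add: \<delta>_def pos_divide_le_eq mult.commute)
    then show ?thesis by (simp only: g_def)
  qed
  then have \<delta>d: "\<delta> \<le> d" "2 * \<delta> \<le> \<zeta> / 8" by auto
  define n where "n t i = block_level (T t) \<delta> (Suc i) - block_level (T t) \<delta> i" for t i
  define b where "b i n = \<P>(u in labels. (drift (scaled_density \<beta> (real i * \<delta>)) + \<epsilon>) * real n <
      real_of_int (disp (hconf (scaled_density \<beta> (real i * \<delta>)) u) 0 0 n))" for i n
  have Tinf: "filterlim T at_top at_top" unfolding T_def using \<beta> by (intro filterlim_powr_at_top) simp
  have ninf: "filterlim (\<lambda>t. n t i) at_top at_top" for i
  proof (subst filterlim_at_top, safe)
    fix Z
    have "\<forall>\<^sub>F t in at_top. T t \<ge> (real Z + 1) / \<delta>" "\<forall>\<^sub>F t in at_top. T t \<ge> 0"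
      using Tinf by (simp_all add: filterlim_at_top)
    then show "\<forall>\<^sub>F t in at_top. Z \<le> n t i"
    proof eventually_elim
      case (elim t)
      have "\<delta> * T t \<ge> real Z + 1" using elim(1) \<delta> by (simp add: pos_divide_le_eq mult.commute)
      then have "real (block_level (T t) \<delta> (Suc i)) \<ge> real (block_level (T t) \<delta> i) + real Z"
        using block_level_bounds(1)[of \<delta> "T t" "Suc i"] block_level_bounds(2)[of \<delta> "T t" i] elim(2) \<delta>
        by (simp add: algebra_simps)
      then show ?case unfolding n_def by linarith
    qed
  qed
  have "(b i \<longlongrightarrow> 0) at_top" for i
    unfolding b_def by (rule prob_disp_tail) (rule \<epsilon>)
  then have "((\<lambda>t. 1 - (\<Sum>i\<in>{1..<B}. b i (n t i))) \<longlongrightarrow> 1 - (\<Sum>i\<in>{1..<B}. 0)) at_top"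
    by (intro tendsto_intros filterlim_compose[OF _ ninf])
  then have lim: "((\<lambda>t. 1 - (\<Sum>i\<in>{1..<B}. b i (n t i))) \<longlongrightarrow> 1) at_top" by simp
  let ?R = "\<lambda>t. right_bounded \<beta> \<eta> t ((1 + \<eta>') * (y_c \<beta> * T t))"
  have ev: "\<forall>\<^sub>F t in at_top. 1 - (\<Sum>i\<in>{1..<B}. b i (n t i)) \<le> \<P>(u in labels. ?R t (conf (poisson_density \<beta> t) u))"
  proof -
    have "\<forall>\<^sub>F t in at_top. T t \<ge> (2 * real B + 1) / (\<zeta> / 2)"
      using Tinf by (simp add: filterlim_at_top)
    then show ?thesis
      using eventually_gt_at_top[of "0::real"]
    proof eventually_elim
      case (elim t)
      define Q where "Q = poisson_density \<beta> t"
      have T: "T t > 0" using elim by (simp add: T_def)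
      have TB: "2 * real B + 1 \<le> T t * (\<zeta> / 2)" using elim(1) \<zeta> by (simp add: pos_divide_le_eq)
      define l where "l i = block_level (T t) \<delta> i" for i
      define c where "c i = (drift (scaled_density \<beta> (real i * \<delta>)) + \<epsilon>) * real (n t i)" for i
      \<comment> \<open>Failure of block \<open>i\<close>, split by the position of the edge at its
        start, as \<open>prob_disp_random_start\<close> requires.\<close>
      define E where "E i = (\<Union>x\<in>{- int (l i)..int (l i)}. {u \<in> space labels. disp (conf Q u) 0 0 (l i) = x \<and>
          c i < real_of_int (disp (conf Q u) (int (l i)) x (n t i))})" for i
      have Em: "E i \<in> sets labels" for i unfolding E_def by measurable
      have iB: "real i * \<delta> < y_c \<beta>" if "i < B" for i
        using that \<delta> mult_strict_right_mono[of "real i" "real B" \<delta>] by simp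
      have PE: "measure labels (E i) \<le> b i (n t i)" if i: "i \<in> {1..<B}" for i
        unfolding E_def b_def c_def
      proof (rule prob_disp_random_start)
        fix k assume "int (l i) \<le> k"
        then have "real (l i) \<le> real_of_int k" by linarith
        then have "real i * \<delta> * T t \<le> real_of_int k"
          using block_level_bounds(1)[of \<delta> "T t" i] \<delta> T by (simp add: l_def)
        then show "Q k \<le> scaled_density \<beta> (real i * \<delta>)"
          unfolding Q_def using i \<delta> by (intro poisson_density_le[OF \<beta> elim(2)]) (auto simp: T_def)
      qed
      have "space labels - (\<Union>i\<in>{1..<B}. E i) \<subseteq> {u \<in> space labels. ?R t (conf Q u)}"
      proof
        fix u assume u: "u \<in> space labels - (\<Union>i\<in>{1..<B}. E i)"
        have good: "block_good \<beta> \<epsilon> (T t) \<delta> i (conf Q u)" if i: "1 \<le> i" "i < B" for i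
        proof -
          have "u \<notin> E i" using u i by auto
          moreover have "disp (conf Q u) 0 0 (l i) \<in> {- int (l i)..int (l i)}" by (rule disp_range)
          ultimately have "\<not> c i < real_of_int (disp (conf Q u) (int (l i)) (disp (conf Q u) 0 0 (l i)) (n t i))"
            using u by (auto simp: E_def)
          then show ?thesis
            using iB[OF i(2)] by (simp add: block_good_def c_def n_def l_def local_drift_def)
        qed
        have "real_of_int (disp (conf Q u) 0 0 k) \<le> (1 + \<eta>) * Gamma_shape \<beta> t (real k)"
          if k: "real k \<le> (1 + \<eta>') * (y_c \<beta> * T t)" for k
        proof -
          have G: "(1 + \<eta>) * Gamma_shape \<beta> t (real k) = T t * ((1 + \<eta>) * shape \<beta> (real k / T t))"
            by (simp add: Gamma_shape_def T_def)
          show ?thesis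
          proof (cases "real k / T t \<le> d")
            case True
            have "real_of_int (disp (conf Q u) 0 0 k) \<le> T t * (real k / T t)"
              using disp_le[of "conf Q u" 0 0 k] T by simp
            also have "\<dots> \<le> T t * ((1 + \<eta>) * shape \<beta> (real k / T t))"
              using d(3)[OF _ True] T by (intro mult_left_mono) auto
            finally show ?thesis unfolding G .
          next
            case False
            then have "\<delta> \<le> real k / T t" using \<delta>d by simp
            then have k1: "\<delta> * T t \<le> real k" using T by (simp add: pos_le_divide_eq)
            have "real_of_int (disp (conf Q u) 0 0 k) \<le>
                T t * (shape \<beta> (real k / T t) + 2 * \<delta> + \<epsilon> * y_c \<beta> + \<eta>' * y_c \<beta>) + 2 * real B + 1"
              using k \<epsilon> \<eta>' by (intro disp_le_shape[OF \<beta> B \<delta>_def T _ _ good k1]) (auto simp: mult.assoc)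
            also have "\<dots> \<le> T t * (shape \<beta> (real k / T t) + \<zeta> / 2) + T t * (\<zeta> / 2)"
            proof -
              have "T t * (shape \<beta> (real k / T t) + 2 * \<delta> + \<epsilon> * y_c \<beta> + \<eta>' * y_c \<beta>) \<le> T t * (shape \<beta> (real k / T t) + \<zeta> / 2)"
                using \<delta>d \<epsilon> \<eta>' T \<zeta> by (intro mult_left_mono) auto
              then show ?thesis using TB by linarith
            qed
            also have "\<dots> = T t * (shape \<beta> (real k / T t) + \<zeta>)" by (simp add: algebra_simps)
            also have "\<dots> \<le> T t * ((1 + \<eta>) * shape \<beta> (real k / T t))"
            proof -
              have "shape \<beta> d \<le> shape \<beta> (real k / T t)" using False d by (intro shape_mono[OF \<beta>]) auto
              then have "\<zeta> \<le> \<eta> * shape \<beta> (real k / T t)" using \<eta> by (simp add: \<zeta>_def)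
              then show ?thesis using T by (intro mult_left_mono) (auto simp: algebra_simps)
            qed
            finally show ?thesis unfolding G .
          qed
        qed
        then show "u \<in> {u \<in> space labels. ?R t (conf Q u)}" using u by (auto simp: right_bounded_def)
      qed
      then have "measure labels (space labels - (\<Union>i\<in>{1..<B}. E i)) \<le> \<P>(u in labels. ?R t (conf Q u))"
        by (intro labels.finite_measure_mono) auto
      moreover have "measure labels (space labels - (\<Union>i\<in>{1..<B}. E i)) = 1 - measure labels (\<Union>i\<in>{1..<B}. E i)"
        using Em by (intro labels.prob_compl) auto
      moreover have "measure labels (\<Union>i\<in>{1..<B}. E i) \<le> (\<Sum>i\<in>{1..<B}. measure labels (E i))"
        using Em by (intro labels.finite_measure_subadditive_finite) auto
      moreover have "(\<Sum>i\<in>{1..<B}. measure labels (E i)) \<le> (\<Sum>i\<in>{1..<B}. b i (n t i))"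
        by (rule sum_mono) (rule PE)
      ultimately show ?case unfolding Q_def by linarith
    qed
  qed
  have le1: "\<forall>\<^sub>F t in at_top. \<P>(u in labels. ?R t (conf (poisson_density \<beta> t) u)) \<le> 1"
    by (intro always_eventually allI labels.prob_le_1)
  have "((\<lambda>t. \<P>(u in labels. ?R t (conf (poisson_density \<beta> t) u))) \<longlongrightarrow> 1) at_top"
    by (rule tendsto_sandwich[OF ev le1 lim tendsto_const])
  then show thesis using that[OF \<eta>'(1,2)] by (simp only: T_def)
qed

section \<open>From displacements to the cluster, and the two limits\<close>

lemma cluster_heights_iff:
  "(\<forall>(x, n)\<in>cluster \<omega>. 0 \<le> real_of_int n \<and> real_of_int n \<le> h) \<longleftrightarrow> dies_by h \<omega>"
proof
  assume *: "\<forall>(x, n)\<in>cluster \<omega>. 0 \<le> real_of_int n \<and> real_of_int n \<le> h"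
  show "dies_by h \<omega>"
    unfolding dies_by_def
  proof (intro allI impI equals0I)
    fix n y assume "h < real n" "y \<in> evo \<omega> 0 {0} n"
    then have "(y, int n) \<in> cluster \<omega>" by (simp add: cluster_iff)
    with * \<open>h < real n\<close> show False by fastforce
  qed
next
  assume *: "dies_by h \<omega>"
  show "\<forall>(x, n)\<in>cluster \<omega>. 0 \<le> real_of_int n \<and> real_of_int n \<le> h"
  proof (clarsimp simp: cluster_iff)
    fix x n assume n: "0 \<le> n" "x \<in> evo \<omega> 0 {0} (nat n)"
    then have "\<not> h < real (nat n)" using * by (auto simp: dies_by_def)
    then show "real_of_int n \<le> h" using n by simp
  qed
qed

text \<open>On an empty level both bounds hold by the values of SUP and INF on the empty set, so
  only existing sites have to be bounded.\<close>

lemma cluster_edges_iff: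
  "ereal (- c) \<le> cluster_left \<omega> k \<and> cluster_right \<omega> k \<le> ereal c \<longleftrightarrow>
    (\<forall>x. 0 \<le> k \<and> x \<in> evo \<omega> 0 {0} (nat k) \<longrightarrow> - c \<le> real_of_int x \<and> real_of_int x \<le> c)"
  by (auto simp: cluster_left_def cluster_right_def le_INF_iff SUP_le_iff cluster_iff)

theorem theorem1:
  fixes \<beta> \<eta> :: real
  assumes "\<beta> > 0" and "\<eta> > 0"
  shows
    "((\<lambda>t. \<P>(\<omega> in poisson_percolation \<beta> t.
        \<forall>(x, n) \<in> cluster \<omega>. 0 \<le> real_of_int n \<and> real_of_int n \<le> (1 + \<eta>) * density_height \<beta> p_c t))
        \<longlongrightarrow> 1) at_top
     \<and> ((\<lambda>t. \<P>(\<omega> in poisson_percolation \<beta> t.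
        \<forall>k::int. 0 \<le> k \<and> real_of_int k \<le> (1 + \<eta>) * density_height \<beta> p_c t \<longrightarrow>
          ereal (- ((1 + \<eta>) * Gamma_shape \<beta> t (real_of_int k))) \<le> cluster_left \<omega> k
          \<and> cluster_right \<omega> k \<le> ereal ((1 + \<eta>) * Gamma_shape \<beta> t (real_of_int k))))
        \<longlongrightarrow> 1) at_top"
proof
  show "((\<lambda>t. \<P>(\<omega> in poisson_percolation \<beta> t.
        \<forall>(x, n) \<in> cluster \<omega>. 0 \<le> real_of_int n \<and> real_of_int n \<le> (1 + \<eta>) * density_height \<beta> p_c t))
        \<longlongrightarrow> 1) at_top"
    unfolding cluster_heights_iff
  proof (rule Lim_transform_eventually[OF prob_dies_by[OF assms]])
    show "\<forall>\<^sub>F t in at_top. \<P>(u in labels. dies_by ((1 + \<eta>) * (y_c \<beta> * t powr (1 / \<beta>))) (conf (poisson_density \<beta> t) u)) =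
        \<P>(\<omega> in poisson_percolation \<beta> t. dies_by ((1 + \<eta>) * density_height \<beta> p_c t) \<omega>)"
      using eventually_gt_at_top[of "0::real"]
    proof eventually_elim
      case (elim t)
      show ?case
        unfolding density_height_eq[OF assms(1) elim] by (rule prob_poisson[OF elim, symmetric]) measurable
    qed
  qed
next
  obtain \<eta>' where \<eta>': "0 < \<eta>'" "\<eta>' \<le> \<eta>" and
    lim: "((\<lambda>t. \<P>(u in labels. right_bounded \<beta> \<eta> t ((1 + \<eta>') * (y_c \<beta> * t powr (1 / \<beta>))) (conf (poisson_density \<beta> t) u))) \<longlongrightarrow> 1) at_top"
    using prob_right_bounded[OF assms] by blast
  let ?E = "\<lambda>t \<omega>. \<forall>k::int. 0 \<le> k \<and> real_of_int k \<le> (1 + \<eta>) * density_height \<beta> p_c t \<longrightarrow>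
          ereal (- ((1 + \<eta>) * Gamma_shape \<beta> t (real_of_int k))) \<le> cluster_left \<omega> k
          \<and> cluster_right \<omega> k \<le> ereal ((1 + \<eta>) * Gamma_shape \<beta> t (real_of_int k))"
  define h where "h t = (1 + \<eta>') * (y_c \<beta> * t powr (1 / \<beta>))" for t
  define c where "c t = conf (poisson_density \<beta> t)" for t
  define P where "P t = \<P>(u in labels. right_bounded \<beta> \<eta> t (h t) (c t u))" for t
  define D where "D t = \<P>(u in labels. dies_by (h t) (c t u))" for t
  \<comment> \<open>A union bound: \<open>P t\<close> for the right edge, \<open>P t\<close> again
    for the left edge by reflection, and \<open>D t\<close> for extinction by height
    \<open>h t\<close>.\<close>
  have ev: "\<forall>\<^sub>F t in at_top. 2 * P t + D t - 2 \<le> \<P>(\<omega> in poisson_percolation \<beta> t. ?E t \<omega>)"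
    using eventually_gt_at_top[of "0::real"]
  proof eventually_elim
    case (elim t)
    have E_meas: "Measurable.pred configs (?E t)"
      unfolding cluster_edges_iff by measurable
    have c_meas [measurable]: "c t \<in> measurable labels configs" unfolding c_def by measurable
    let ?A = "{u \<in> space labels. \<not> right_bounded \<beta> \<eta> t (h t) (c t u)}"
    let ?A' = "{u \<in> space labels. \<not> right_bounded \<beta> \<eta> t (h t) (reflect_conf (c t u))}"
    let ?A'' = "{u \<in> space labels. \<not> dies_by (h t) (c t u)}"
    have "{u \<in> space labels. \<not> ?E t (c t u)} \<subseteq> ?A \<union> (?A' \<union> ?A'')"
    proof (rule subsetI, rule ccontr)
      fix u assume u: "u \<in> {u \<in> space labels. \<not> ?E t (c t u)}" and "u \<notin> ?A \<union> (?A' \<union> ?A'')"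
      then have *: "right_bounded \<beta> \<eta> t (h t) (c t u)" "right_bounded \<beta> \<eta> t (h t) (reflect_conf (c t u))" "dies_by (h t) (c t u)"
        by auto
      have E: "?E t (c t u)"
        unfolding cluster_edges_iff
      proof (intro allI impI)
        fix k x :: int assume "0 \<le> k \<and> x \<in> evo (c t u) 0 {0} (nat k)"
        then have k: "0 \<le> k" and x: "x \<in> evo (c t u) 0 {0} (nat k)" by auto
        \<comment> \<open>An occupied level is at most at height \<open>h t\<close>, where both
          edges are controlled; this covers the levels up to the larger height in the claim.\<close>
        have "real (nat k) \<le> h t" using *(3) x by (auto simp: dies_by_def not_less[symmetric])
        with * have b: "real_of_int (disp (c t u) 0 0 (nat k)) \<le> (1 + \<eta>) * Gamma_shape \<beta> t (real (nat k))"
          "real_of_int (disp (reflect_conf (c t u)) 0 0 (nat k)) \<le> (1 + \<eta>) * Gamma_shape \<beta> t (real (nat k))"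
          by (auto simp: right_bounded_def)
        have "real_of_int x \<le> real_of_int (disp (c t u) 0 0 (nat k))"
          "real_of_int (- disp (reflect_conf (c t u)) 0 0 (nat k)) \<le> real_of_int x"
          using evo_origin_bounds[OF x] by (simp_all only: of_int_le_iff)
        with b k show "- ((1 + \<eta>) * Gamma_shape \<beta> t (real_of_int k)) \<le> real_of_int x \<and>
            real_of_int x \<le> (1 + \<eta>) * Gamma_shape \<beta> t (real_of_int k)" by simp
      qed
      from u have "\<not> ?E t (c t u)" unfolding mem_Collect_eq by (rule conjunct2)
      from this E show False by (rule notE)
    qed
    then have "\<P>(u in labels. \<not> ?E t (c t u)) \<le> measure labels (?A \<union> (?A' \<union> ?A''))"
      by (intro labels.finite_measure_mono) measurable
    also have "\<dots> \<le> measure labels ?A + measure labels (?A' \<union> ?A'')"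
      by (rule measure_Un_le) measurable
    also have "measure labels (?A' \<union> ?A'') \<le> measure labels ?A' + measure labels ?A''"
      by (rule measure_Un_le) measurable
    also have "measure labels ?A = 1 - P t" unfolding P_def by (rule labels.prob_neg) measurable
    also have "measure labels ?A'' = 1 - D t" unfolding D_def by (rule labels.prob_neg) measurable
    also have "measure labels ?A' = 1 - \<P>(u in labels. right_bounded \<beta> \<eta> t (h t) (reflect_conf (c t u)))"
      by (rule labels.prob_neg) measurable
    also have "\<P>(u in labels. right_bounded \<beta> \<eta> t (h t) (reflect_conf (c t u))) = P t"
      unfolding P_def c_def by (rule prob_reflect_conf) measurable
    also have "\<P>(u in labels. \<not> ?E t (c t u)) = 1 - \<P>(u in labels. ?E t (c t u))"
      by (rule labels.prob_neg) (rule predE[OF measurable_compose[OF c_meas E_meas]])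
    also have "\<P>(u in labels. ?E t (c t u)) = \<P>(\<omega> in poisson_percolation \<beta> t. ?E t \<omega>)"
      unfolding c_def by (rule prob_poisson[OF elim E_meas, symmetric])
    finally show ?case by linarith
  qed
  have "((\<lambda>t. 2 * P t + D t - 2) \<longlongrightarrow> 2 * 1 + 1 - 2) at_top"
    using lim prob_dies_by[OF assms(1) \<eta>'(1)] unfolding P_def D_def c_def h_def by (intro tendsto_intros)
  then have lower: "((\<lambda>t. 2 * P t + D t - 2) \<longlongrightarrow> 1) at_top" by simp
  have upper: "\<forall>\<^sub>F t in at_top. \<P>(\<omega> in poisson_percolation \<beta> t. ?E t \<omega>) \<le> 1"
    using eventually_gt_at_top[of "0::real"]
  proof eventually_elim
    case (elim t)
    have "prob_space (poisson_percolation \<beta> t)"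
      unfolding poisson_percolation_eq[OF elim] by (rule labels.prob_space_distr) measurable
    then show ?case by (rule prob_space.prob_le_1)
  qed
  show "((\<lambda>t. \<P>(\<omega> in poisson_percolation \<beta> t. ?E t \<omega>)) \<longlongrightarrow> 1) at_top"
    by (rule tendsto_sandwich[OF ev upper lower tendsto_const])
qed

end
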